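(* Let $r \in \{1,2,\ldots,\infty\}$ and let $M$ be a compact Riemannian $C^r$ manifold with induced distance $\rho$. Let $X \subset M$ be a compact set and let $\mu$ be a Borel probability measure on $X$. Fix $k \in \mathbb{N}$. Then the following hold for a prevalent $C^r$ function $\phi : M \to \mathbb{R}^k$ (prevalence in $C^r(M,\mathbb{R}^k)$): (1) if $k > \dim_H X$ and $k \geq \dim M$, then for $\mu$-a.e. $x \in X$ there exists $C = C(x,\phi) \in [0,\infty)$ such that $$\rho(x,y) \leq C\,\|\phi(x) - \phi(y)\| \quad \text{for every } y \in X;$$ (2) if $k > \dim M$, then for $\mu$-a.e. $x \in X$ there exist open neighbourhoods $U$ of $x$ in $M$ and $V$ of $\phi(x)$ in $\mathbb{R}^k$ such that $\phi$ is a $C^r$ diffeomorphism between $U$ and $V \cap \phi(M)$.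
   Context: Notation. $\mathbb{N} = \{1,2,\ldots\}$. Manifolds are finite-dimensional and Hausdorff. A Riemannian $C^r$ manifold is a $C^r$ manifold with a metric tensor depending continuously on the point; $\rho : M \times M \to [0,\infty)$ is the (finite-valued) metric on $M$ induced by the metric tensor, and $\dim_H$ is the Hausdorff dimension with respect to $\rho$. $\|\cdot\|$ is the Euclidean norm on $\mathbb{R}^k$. Part of statement (2) is that $V \cap \phi(M)$ is an embedded $C^r$ submanifold of $\mathbb{R}^k$. Prevalence. $C^r(M,\mathbb{R}^k)$ carries the topology of uniform convergence of derivatives of orders up to $r$ (all orders if $r=\infty$); it is a complete metrizable linear space. In a complete linear metric space $W$, a Borel set $S \subset W$ is prevalent if there is a Borel measure $\nu$ on $W$, positive and finite on some compact set in $W$, such that for every $v \in W$ one has $v + e \in S$ for $\nu$-almost every $e \in W$. A non-Borel set is prevalent if it contains a prevalent Borel set. A property holds for a prevalent element if the set of elements having it is prevalent. *)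

theory Defs
  imports "HOL-Probability.Probability" "HOL-Library.Function_Algebras"
begin

section \<open>Calculus on relatively open subsets of a linear subspace\<close>

text \<open>
  Coordinates take values in a linear subspace \<open>E\<close> of a Euclidean space (and not in the whole type),
  so that every finite dimension, including 0, is available.  For \<open>S\<close> relatively open in \<open>E\<close>
  the Frechet derivative within \<open>S\<close> is only determined on \<open>E\<close>, hence directions range over \<open>E\<close>.
  For \<open>E = UNIV\<close> this is the usual notion on open sets.
\<close>

primrec Ck_on :: "nat \<Rightarrow> 'e::euclidean_space set \<Rightarrow> 'e set \<Rightarrow> ('e \<Rightarrow> 'f::euclidean_space) \<Rightarrow> bool" where
  "Ck_on 0 E S f \<longleftrightarrow> continuous_on S f"
| "Ck_on (Suc k) E S f \<longleftrightarrow>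
     (\<forall>x\<in>S. f differentiable (at x within S)) \<and>
     (\<forall>v\<in>E. Ck_on k E S (\<lambda>x. frechet_derivative f (at x within S) v))"

definition Cr_on :: "enat \<Rightarrow> 'e::euclidean_space set \<Rightarrow> 'e set \<Rightarrow> ('e \<Rightarrow> 'f::euclidean_space) \<Rightarrow> bool" where
  "Cr_on r E S f \<longleftrightarrow> (\<forall>k. enat k \<le> r \<longrightarrow> Ck_on k E S f)"

text \<open>\<open>iter_deriv S f [v1, \<dots>, vj] x\<close> is the derivative of \<open>f\<close> of order \<open>j\<close> at \<open>x\<close>
  applied to \<open>v1, \<dots>, vj\<close>.\<close>

primrec iter_deriv :: "'e::euclidean_space set \<Rightarrow> ('e \<Rightarrow> 'f::euclidean_space) \<Rightarrow> 'e list \<Rightarrow> 'e \<Rightarrow> 'f" where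
  "iter_deriv S f [] = f"
| "iter_deriv S f (v # vs) =
     (\<lambda>x. frechet_derivative (iter_deriv S f vs) (at x within S) v)"


section \<open>Manifolds and maps of class $C^r$\<close>

text \<open>A chart is a pair of its domain and its coordinate map.\<close>

type_synonym ('m, 'e) chart = "'m set \<times> ('m \<Rightarrow> 'e)"

text \<open>
  \<open>A\<close> is a (not necessarily maximal) \<open>C\<^sup>r\<close> atlas, modelled on \<open>E\<close>, of the manifold consisting of the
  whole type \<open>'m\<close>; its dimension is \<open>dim E\<close>.  The Hausdorff property is the class \<open>t2_space\<close>.
\<close>

definition Cr_atlas :: "enat \<Rightarrow> 'e::euclidean_space set \<Rightarrow> ('m::t2_space, 'e) chart set \<Rightarrow> bool" where
  "Cr_atlas r E A \<longleftrightarrow>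
     subspace E \<and>
     (\<Union>(U, c)\<in>A. U) = UNIV \<and>
     (\<forall>(U, c)\<in>A. open U \<and> openin (top_of_set E) (c ` U) \<and>
        homeomorphism U (c ` U) c (inv_into U c)) \<and>
     (\<forall>(U, c)\<in>A. \<forall>(V, d)\<in>A. Cr_on r E (c ` (U \<inter> V)) (d \<circ> inv_into U c))"

text \<open>
  \<open>f\<close> is a \<open>C\<^sup>r\<close> map from \<open>S\<close> to a manifold, with \<open>A\<close>, \<open>E\<close> belonging to the domain and \<open>B\<close>, \<open>F\<close> to
  the target.  \<open>S\<close> is an open subset of the manifold with atlas \<open>A\<close>.
\<close>

definition Cr_map ::
  "enat \<Rightarrow> 'e::euclidean_space set \<Rightarrow> ('m::topological_space, 'e) chart set \<Rightarrow>
   'f::euclidean_space set \<Rightarrow> ('n::topological_space, 'f) chart set \<Rightarrow> 'm set \<Rightarrow> ('m \<Rightarrow> 'n) \<Rightarrow> bool" where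
  "Cr_map r E A F B S f \<longleftrightarrow>
     continuous_on S f \<and>
     (\<forall>(U, c)\<in>A. \<forall>(V, d)\<in>B. Cr_on r E (c ` (S \<inter> U \<inter> f -` V)) (d \<circ> f \<circ> inv_into U c))"

definition Cr_diffeo ::
  "enat \<Rightarrow> 'e::euclidean_space set \<Rightarrow> ('m::topological_space, 'e) chart set \<Rightarrow>
   'f::euclidean_space set \<Rightarrow> ('n::topological_space, 'f) chart set \<Rightarrow>
   'm set \<Rightarrow> 'n set \<Rightarrow> ('m \<Rightarrow> 'n) \<Rightarrow> bool" where
  "Cr_diffeo r E A F B S T f \<longleftrightarrow>
     bij_betw f S T \<and> Cr_map r E A F B S f \<and> Cr_map r F B E A T (inv_into S f)"

definition std_atlas :: "('e, 'e) chart set" where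
  "std_atlas = {(UNIV, \<lambda>x. x)}"


subsection \<open>Embedded submanifolds of Euclidean space\<close>

text \<open>
  Slice charts: a \<open>C\<^sup>r\<close> diffeomorphism \<open>\<psi>\<close> between open sets \<open>W\<close> and \<open>\<psi> ` W\<close> of the ambient space that
  straightens \<open>N\<close> to the linear subspace \<open>L\<close>.
\<close>

definition slice_chart ::
  "enat \<Rightarrow> 'f::euclidean_space set \<Rightarrow> 'f set \<Rightarrow> 'f set \<Rightarrow> ('f \<Rightarrow> 'f) \<Rightarrow> bool" where
  "slice_chart r L N W \<psi> \<longleftrightarrow>
     open W \<and> open (\<psi> ` W) \<and>
     Cr_diffeo r UNIV std_atlas UNIV std_atlas W (\<psi> ` W) \<psi> \<and>
     \<psi> ` (W \<inter> N) = \<psi> ` W \<inter> L"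

definition embedded_submanifold :: "enat \<Rightarrow> 'f::euclidean_space set \<Rightarrow> 'f set \<Rightarrow> bool" where
  "embedded_submanifold r L N \<longleftrightarrow>
     subspace L \<and> (\<forall>p\<in>N. \<exists>W \<psi>. p \<in> W \<and> slice_chart r L N W \<psi>)"

text \<open>The induced atlas, modelled on \<open>L\<close>, of an embedded submanifold \<open>N\<close>.\<close>

definition slice_atlas :: "enat \<Rightarrow> 'f::euclidean_space set \<Rightarrow> 'f set \<Rightarrow> ('f, 'f) chart set" where
  "slice_atlas r L N = {(W \<inter> N, \<psi>) | W \<psi>. slice_chart r L N W \<psi>}"


section \<open>Riemannian metrics and the induced distance\<close>

text \<open>
  A continuous metric tensor is given by its components: \<open>g (U, c) x\<close> is the inner product at
  \<open>x \<in> U\<close> expressed in the coordinates \<open>c\<close>; the last condition is the transformation law.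
\<close>

definition riemannian_metric ::
  "'e::euclidean_space set \<Rightarrow> ('m::t2_space, 'e) chart set \<Rightarrow>
   (('m, 'e) chart \<Rightarrow> 'm \<Rightarrow> 'e \<Rightarrow> 'e \<Rightarrow> real) \<Rightarrow> bool" where
  "riemannian_metric E A g \<longleftrightarrow>
     (\<forall>(U, c)\<in>A.
        (\<forall>x\<in>U.
          (\<forall>u\<in>E. \<forall>v\<in>E. \<forall>w\<in>E. \<forall>a. g (U, c) x (a *\<^sub>R u + v) w = a * g (U, c) x u w + g (U, c) x v w) \<and>
          (\<forall>v\<in>E. \<forall>w\<in>E. g (U, c) x v w = g (U, c) x w v) \<and>
          (\<forall>v\<in>E. v \<noteq> 0 \<longrightarrow> g (U, c) x v v > 0)) \<and>
        (\<forall>v\<in>E. \<forall>w\<in>E. continuous_on U (\<lambda>x. g (U, c) x v w))) \<and>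
     (\<forall>(U, c)\<in>A. \<forall>(V, d)\<in>A. \<forall>x\<in>U \<inter> V. \<forall>v\<in>E. \<forall>w\<in>E.
        let D = frechet_derivative (d \<circ> inv_into U c) (at (c x) within c ` (U \<inter> V))
        in g (V, d) x (D v) (D w) = g (U, c) x v w)"

definition C1_curve_on :: "('m::t2_space, 'e::euclidean_space) chart set \<Rightarrow> real \<Rightarrow> real \<Rightarrow> (real \<Rightarrow> 'm) \<Rightarrow> bool" where
  "C1_curve_on A a b \<gamma> \<longleftrightarrow>
     continuous_on {a..b} \<gamma> \<and>
     (\<forall>(U, c)\<in>A.
        (\<forall>t\<in>{a..b} \<inter> \<gamma> -` U. (c \<circ> \<gamma>) differentiable (at t within {a..b})) \<and>
        continuous_on ({a..b} \<inter> \<gamma> -` U) (\<lambda>t. vector_derivative (c \<circ> \<gamma>) (at t within {a..b})))"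

definition piecewise_C1_curve :: "('m::t2_space, 'e::euclidean_space) chart set \<Rightarrow> (real \<Rightarrow> 'm) \<Rightarrow> bool" where
  "piecewise_C1_curve A \<gamma> \<longleftrightarrow>
     (\<exists>P. finite P \<and> {0, 1} \<subseteq> P \<and> P \<subseteq> {0..1} \<and>
        (\<forall>a\<in>P. \<forall>b\<in>P. a < b \<and> {a<..<b} \<inter> P = {} \<longrightarrow> C1_curve_on A a b \<gamma>))"

text \<open>By the transformation law the choice of the chart is irrelevant.\<close>

definition curve_speed ::
  "('m::t2_space, 'e::euclidean_space) chart set \<Rightarrow> (('m, 'e) chart \<Rightarrow> 'm \<Rightarrow> 'e \<Rightarrow> 'e \<Rightarrow> real) \<Rightarrow>
   (real \<Rightarrow> 'm) \<Rightarrow> real \<Rightarrow> real" where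
  "curve_speed A g \<gamma> t =
     (let p = (SOME p. p \<in> A \<and> \<gamma> t \<in> fst p); v = vector_derivative (snd p \<circ> \<gamma>) (at t)
      in sqrt (g p (\<gamma> t) v v))"

definition curve_length ::
  "('m::t2_space, 'e::euclidean_space) chart set \<Rightarrow> (('m, 'e) chart \<Rightarrow> 'm \<Rightarrow> 'e \<Rightarrow> 'e \<Rightarrow> real) \<Rightarrow>
   (real \<Rightarrow> 'm) \<Rightarrow> real" where
  "curve_length A g \<gamma> = integral {0..1} (curve_speed A g \<gamma>)"

definition curves_between :: "('m::t2_space, 'e::euclidean_space) chart set \<Rightarrow> 'm \<Rightarrow> 'm \<Rightarrow> (real \<Rightarrow> 'm) set" where
  "curves_between A x y = {\<gamma>. piecewise_C1_curve A \<gamma> \<and> \<gamma> 0 = x \<and> \<gamma> 1 = y}"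

text \<open>
  The distance induced by \<open>g\<close> is the infimum of the lengths of connecting curves.  On a connected
  manifold this determines \<open>\<rho>\<close>.  Between points of different components that infimum is infinite,
  and since \<open>\<rho>\<close> is to be finite-valued, any values that make \<open>\<rho>\<close> a metric are admitted there.
\<close>

definition induced_distance ::
  "('m::t2_space, 'e::euclidean_space) chart set \<Rightarrow> (('m, 'e) chart \<Rightarrow> 'm \<Rightarrow> 'e \<Rightarrow> 'e \<Rightarrow> real) \<Rightarrow>
   ('m \<Rightarrow> 'm \<Rightarrow> real) \<Rightarrow> bool" where
  "induced_distance A g \<rho> \<longleftrightarrow>
     Metric_space UNIV \<rho> \<and>
     (\<forall>x y. curves_between A x y \<noteq> {} \<longrightarrow>
        \<rho> x y = (INF \<gamma>\<in>curves_between A x y. curve_length A g \<gamma>))"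


section \<open>Hausdorff dimension with respect to a metric\<close>

definition set_diam :: "('m \<Rightarrow> 'm \<Rightarrow> real) \<Rightarrow> 'm set \<Rightarrow> real" where
  "set_diam \<rho> S = (if S = {} then 0 else SUP (x, y)\<in>S \<times> S. \<rho> x y)"

definition hausdorff_premeasure :: "('m \<Rightarrow> 'm \<Rightarrow> real) \<Rightarrow> real \<Rightarrow> real \<Rightarrow> 'm set \<Rightarrow> ennreal" where
  "hausdorff_premeasure \<rho> s \<delta> X =
     (INF C\<in>{C :: nat \<Rightarrow> 'm set. X \<subseteq> (\<Union>i. C i) \<and> (\<forall>i. \<forall>x\<in>C i. \<forall>y\<in>C i. \<rho> x y \<le> \<delta>)}.
        \<Sum>i. ennreal (set_diam \<rho> (C i) powr s))"

definition hausdorff_measure :: "('m \<Rightarrow> 'm \<Rightarrow> real) \<Rightarrow> real \<Rightarrow> 'm set \<Rightarrow> ennreal" where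
  "hausdorff_measure \<rho> s X = (SUP \<delta>\<in>{0<..}. hausdorff_premeasure \<rho> s \<delta> X)"

definition hausdorff_dim :: "('m \<Rightarrow> 'm \<Rightarrow> real) \<Rightarrow> 'm set \<Rightarrow> ennreal" where
  "hausdorff_dim \<rho> X = (INF s\<in>{s. 0 < s \<and> hausdorff_measure \<rho> s X = 0}. ennreal s)"


section \<open>The space of $C^r$ functions and prevalence\<close>

definition Cr_functions ::
  "enat \<Rightarrow> 'e::euclidean_space set \<Rightarrow> ('m::t2_space, 'e) chart set \<Rightarrow> ('m \<Rightarrow> 'f::euclidean_space) set" where
  "Cr_functions r E A = {\<phi>. Cr_map r E A UNIV std_atlas UNIV \<phi>}"

text \<open>
  The topology of uniform convergence of the derivatives of orders up to \<open>r\<close>: derivatives are taken in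
  charts and compared on compact subsets of the chart domains.  The sets with \<open>K = {}\<close> make
  \<open>Cr_functions r E A\<close> the whole space.
\<close>

definition Cr_topology ::
  "enat \<Rightarrow> 'e::euclidean_space set \<Rightarrow> ('m::t2_space, 'e) chart set \<Rightarrow> ('m \<Rightarrow> 'f::euclidean_space) topology" where
  "Cr_topology r E A = topology_generated_by
     {{\<psi> \<in> Cr_functions r E A. \<forall>x\<in>K.
         dist (iter_deriv (c ` U) (\<psi> \<circ> inv_into U c) vs (c x))
              (iter_deriv (c ` U) (\<phi> \<circ> inv_into U c) vs (c x)) < \<epsilon>}
      | \<phi> U c K vs \<epsilon>.
          \<phi> \<in> Cr_functions r E A \<and> (U, c) \<in> A \<and> compact K \<and> K \<subseteq> U \<and>
          set vs \<subseteq> E \<and> enat (length vs) \<le> r \<and> 0 < \<epsilon>}"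

definition borel_sets_of :: "'w topology \<Rightarrow> 'w set set" where
  "borel_sets_of T = sigma_sets (topspace T) {U. openin T U}"

definition prevalent_borel :: "'w::plus topology \<Rightarrow> 'w set \<Rightarrow> bool" where
  "prevalent_borel T S \<longleftrightarrow>
     S \<in> borel_sets_of T \<and>
     (\<exists>\<nu>. space \<nu> = topspace T \<and> sets \<nu> = borel_sets_of T \<and>
        (\<exists>K. compactin T K \<and> 0 < emeasure \<nu> K \<and> emeasure \<nu> K < \<infinity>) \<and>
        (\<forall>v\<in>topspace T. AE e in \<nu>. v + e \<in> S))"

definition prevalent :: "'w::plus topology \<Rightarrow> 'w set \<Rightarrow> bool" where
  "prevalent T S \<longleftrightarrow> S \<subseteq> topspace T \<and> (\<exists>B. prevalent_borel T B \<and> B \<subseteq> S)"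

end

theory Submission
  imports Defs "HOL-Real_Asymp.Real_Asymp"
begin

text \<open>
  The probe consists of the maps \<open>x \<mapsto> (\<Sum>i<n. f i x *\<^sub>R L i)\<close>, where the finitely many functions \<open>f i\<close> of class
  $C^r$ (bump functions and bump functions times coordinates) form an injective immersion of \<open>M\<close> and the vectors
  \<open>L i\<close> are independent and uniform in the unit ball.  Let \<open>dd x y\<close> be the sum of the \<open>\<bar>f i x - f i y\<bar>\<close>; it is
  comparable to coordinate distances in charts and dominates \<open>\<rho>\<close>.  Both parts follow from the single property
  that for almost every \<open>x\<close> there is \<open>C\<close> with \<open>dd x y \<le> C * norm (\<phi> x - \<phi> y)\<close> for all \<open>y \<in> Y\<close>, with \<open>Y = X\<close> for (1)
  and \<open>Y = M\<close> for (2).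

  For fixed \<open>x\<close> this fails only if the derivative of \<open>\<phi>\<close> at \<open>x\<close> is not injective or \<open>\<phi> y = \<phi> x\<close> for some \<open>y \<noteq> x\<close>
  in \<open>Y\<close>.  Either event says that \<open>a z + (\<Sum>i<n. u i z *\<^sub>R L i)\<close> vanishes for some \<open>z\<close> in a set whose \<open>k\<close>-dimensional
  Hausdorff measure is zero; since this expression lies in a ball of radius \<open>t\<close> with probability of order
  \<open>t ^ k\<close>, covering the set shows that the event is null.  Fubini exchanges the quantifiers over \<open>x\<close> and \<open>L\<close>.
  The property defines a $G_\delta$ set, because a $C^1$-small change of \<open>\<phi>\<close> changes \<open>norm (\<phi> x - \<phi> y)\<close> by at most a
  small multiple of \<open>dd x y\<close>.  For (2), the property with \<open>Y = M\<close> makes \<open>\<phi>\<close> an immersion at \<open>x\<close> whose fibre over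
  \<open>\<phi> x\<close> is \<open>{x}\<close>, and the inverse function theorem together with compactness yields the embedding.
\<close>

section \<open>Calculus of class $C^k$ relative to a subspace\<close>

text \<open>Asking for the bound only at almost every \<open>x\<close> is what makes
  \<open>k\<close> of the size of the dimension sufficient: injectivity on all of \<open>M\<close>
  would mean avoiding zeros over pairs \<open>(x, y)\<close>, a set of twice the dimension, while
  with \<open>x\<close> fixed only \<open>y\<close> moves. The derivative event concerns affine
  slices of dimension \<open>dim E - 1\<close> and therefore tolerates \<open>dim E \<le> k\<close>;
  collisions with other points of \<open>M\<close> require \<open>dim E < k\<close>. Prevalence
  demands one measure for all translates, so every estimate is made for an arbitrary
  \<open>v\<close> plus a probe. Since the \<open>f i\<close> form an injective immersion, some
  coefficient \<open>u i z\<close> is bounded away from 0 on each piece that is covered;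
  conditioning on the other vectors leaves one uniform vector, whence the power
  \<open>t ^ k\<close>. The function \<open>dd\<close> is preferred to \<open>\<rho>\<close> because
  it is made of the same \<open>f i\<close> that multiply the random vectors, so chart estimates,
  perturbations and small-ball bounds are expressed in one quantity, whereas \<open>\<rho>\<close>
  between different components is prescribed only up to being a metric.\<close>

lemma subspace_orthonormal_basis:
  fixes E :: "'e::euclidean_space set"
  assumes "subspace E"
  obtains B where "finite B" "B \<subseteq> E" "card B = dim E" "\<And>b. b \<in> B \<Longrightarrow> norm b = 1"
    "\<And>b b'. b \<in> B \<Longrightarrow> b' \<in> B \<Longrightarrow> b \<noteq> b' \<Longrightarrow> b \<bullet> b' = 0"
    "\<And>x. x \<in> E \<Longrightarrow> (\<Sum>b\<in>B. (x \<bullet> b) *\<^sub>R b) = x"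
proof -
  obtain B where B: "B \<subseteq> E" "pairwise orthogonal B" "\<And>x. x \<in> B \<Longrightarrow> norm x = 1"
    "independent B" "card B = dim E" "span B = E"
    using orthonormal_basis_subspace[OF assms] by metis
  have fin: "finite B" using B(4) by (rule independent_imp_finite)
  have "(\<Sum>b\<in>B. (x \<bullet> b) *\<^sub>R b) = x" if "x \<in> E" for x
  proof -
    have "x \<in> range (\<lambda>u. \<Sum>v\<in>B. u v *\<^sub>R v)"
      unfolding span_finite[OF fin, symmetric] B(6) by (rule that)
    then obtain c where c: "x = (\<Sum>b\<in>B. c b *\<^sub>R b)" by auto
    have "x \<bullet> b = c b" if "b \<in> B" for b
    proof -
      have "x \<bullet> b = (\<Sum>b'\<in>B. c b' * (b' \<bullet> b))" by (simp add: c inner_sum_left)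
      also have "\<dots> = (\<Sum>b'\<in>B. if b' = b then c b else 0)"
        using B(2,3) that
        by (intro sum.cong refl) (auto simp: pairwise_def orthogonal_def norm_eq_1)
      finally show ?thesis using that fin by simp
    qed
    then show ?thesis by (simp add: c)
  qed
  moreover have "b \<bullet> b' = 0" if "b \<in> B" "b' \<in> B" "b \<noteq> b'" for b b'
    using B(2) that by (auto simp: pairwise_def orthogonal_def)
  ultimately show ?thesis using that B fin by blast
qed

lemma openin_subspace_line:
  fixes E :: "'e::euclidean_space set"
  assumes "subspace E" "openin (top_of_set E) S" "x \<in> S" "v \<in> E"
  obtains d where "d > 0" "\<And>t. \<bar>t\<bar> < d \<Longrightarrow> x + t *\<^sub>R v \<in> S"
proof -
  obtain e where e: "e > 0" "ball x e \<inter> E \<subseteq> S"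
    using assms(2,3) by (meson openin_contains_ball)
  have xE: "x \<in> E" using assms by (meson openin_imp_subset subsetD)
  show ?thesis
  proof (rule that[of "e / (norm v + 1)"])
    show "0 < e / (norm v + 1)" using e by (simp add: add_nonneg_pos)
    fix t assume t: "\<bar>t\<bar> < e / (norm v + 1)"
    have "\<bar>t\<bar> * norm v \<le> \<bar>t\<bar> * (norm v + 1)" by (intro mult_left_mono) auto
    also have "\<dots> < e" using t by (simp add: pos_less_divide_eq add_nonneg_pos)
    finally have "x + t *\<^sub>R v \<in> ball x e" by (simp add: dist_norm)
    moreover have "x + t *\<^sub>R v \<in> E" using xE assms by (simp add: subspace_add subspace_scale)
    ultimately show "x + t *\<^sub>R v \<in> S" using e by blast
  qed
qed

text \<open>Restriction to a line in \<open>E\<close> turns a derivative within \<open>S\<close>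
  into an ordinary derivative in one real variable, where uniqueness and difference quotients are
  available.\<close>

lemma has_derivative_along_line:
  fixes f :: "'e::euclidean_space \<Rightarrow> 'f::real_normed_vector"
  assumes "subspace E" "openin (top_of_set E) S" "x \<in> S" "v \<in> E"
    and "(f has_derivative f') (at x within S)"
  shows "((\<lambda>t. f (x + t *\<^sub>R v)) has_vector_derivative f' v) (at 0)"
proof -
  obtain d where d: "d > 0" "\<And>t. \<bar>t\<bar> < d \<Longrightarrow> x + t *\<^sub>R v \<in> S"
    using openin_subspace_line[OF assms(1-4)] by metis
  let ?l = "\<lambda>t. x + t *\<^sub>R v"
  have sub: "?l ` {-d<..<d} \<subseteq> S" using d by (auto simp: abs_less_iff)
  have l: "(?l has_derivative (\<lambda>t. t *\<^sub>R v)) (at 0 within {-d<..<d})"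
    by (auto intro!: derivative_eq_intros)
  have "(f has_derivative f') (at (?l 0) within ?l ` {-d<..<d})"
    using has_derivative_subset[OF assms(5) sub] by simp
  from diff_chain_within[OF l this]
  have "((\<lambda>t. f (?l t)) has_derivative (\<lambda>t. f' (t *\<^sub>R v))) (at 0 within {-d<..<d})"
    by (simp add: o_def)
  moreover have "at (0::real) within {-d<..<d} = at 0" using d by (intro at_within_open) auto
  moreover have "f' (t *\<^sub>R v) = t *\<^sub>R f' v" for t
    using assms(5) by (metis has_derivative_linear linear_scale)
  ultimately show ?thesis by (simp add: has_vector_derivative_def)
qed

text \<open>A relatively open subset of a proper subspace has too few directions for uniqueness on
  the whole space, but every direction in \<open>E\<close> is seen along a line.\<close>

lemma has_derivative_subspace_unique:
  fixes f :: "'e::euclidean_space \<Rightarrow> 'f::real_normed_vector"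
  assumes "subspace E" "openin (top_of_set E) S" "x \<in> S" "v \<in> E"
    and "(f has_derivative f1) (at x within S)" "(f has_derivative f2) (at x within S)"
  shows "f1 v = f2 v"
  using has_derivative_along_line[OF assms(1-5)] has_derivative_along_line[OF assms(1-4,6)]
  by (rule vector_derivative_unique_at)

lemma frechet_derivative_within_eq:
  fixes f :: "'e::euclidean_space \<Rightarrow> 'f::real_normed_vector"
  assumes "subspace E" "openin (top_of_set E) S" "x \<in> S" "v \<in> E"
    and "(f has_derivative f') (at x within S)"
  shows "frechet_derivative f (at x within S) v = f' v"
proof -
  have "(f has_derivative frechet_derivative f (at x within S)) (at x within S)"
    using assms(5) differentiableI frechet_derivative_works by blast
  from has_derivative_subspace_unique[OF assms(1-4) this assms(5)] show ?thesis .
qed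

text \<open>Let \<open>z\<close> be the component of \<open>f' v\<close> orthogonal to
  \<open>F\<close>. The inner product of \<open>f\<close> with \<open>z\<close> vanishes on
  \<open>S\<close>, so its derivative in direction \<open>v\<close>, the squared norm of
  \<open>z\<close>, is 0.\<close>

lemma has_derivative_in_subspace:
  fixes f :: "'e::euclidean_space \<Rightarrow> 'f::euclidean_space"
  assumes "subspace E" "openin (top_of_set E) S" "x \<in> S" "v \<in> E" "subspace F" "f ` S \<subseteq> F"
    and "(f has_derivative f') (at x within S)"
  shows "f' v \<in> F"
proof -
  obtain y z where yz: "y \<in> span F" "\<And>w. w \<in> span F \<Longrightarrow> orthogonal z w" "f' v = y + z"
    using orthogonal_subspace_decomp_exists[of F "f' v"] by metis
  have sF: "span F = F" using assms(5) by (simp add: span_eq_iff)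
  have "((\<lambda>x. f x \<bullet> z) has_derivative (\<lambda>w. f' w \<bullet> z)) (at x within S)"
    using assms(7) by (auto intro!: derivative_eq_intros)
  moreover have "((\<lambda>x. f x \<bullet> z) has_derivative (\<lambda>w. 0)) (at x within S)"
    by (rule has_derivative_transform[OF \<open>x \<in> S\<close> _ has_derivative_const[of 0]])
      (use assms(6) yz(2) sF in \<open>force simp: orthogonal_def inner_commute\<close>)
  ultimately have "f' v \<bullet> z = 0"
    using has_derivative_subspace_unique[OF assms(1-4)] by blast
  moreover have "y \<bullet> z = 0" using yz(1,2) by (simp add: orthogonal_def inner_commute)
  ultimately have "z = 0" using yz(3) by (simp add: inner_add_left)
  then show ?thesis using yz sF by simp
qed

text \<open>The assumption \<open>cong\<close> breaks a circle: congruence at order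
  \<open>Suc k\<close> is proved by this rule from congruence at order \<open>k\<close>.
  \<open>Ck_onI\<close> is the version in which it has been discharged.\<close>

lemma Ck_on_SucI:
  fixes f :: "'e::euclidean_space \<Rightarrow> 'f::euclidean_space"
  assumes "subspace E" "openin (top_of_set E) S"
    and "\<And>x. x \<in> S \<Longrightarrow> (f has_derivative f' x) (at x within S)"
    and "\<And>v. v \<in> E \<Longrightarrow> Ck_on k E S (\<lambda>x. f' x v)"
    and cong: "\<And>g h :: 'e \<Rightarrow> 'f. Ck_on k E S g \<Longrightarrow> (\<And>x. x \<in> S \<Longrightarrow> g x = h x) \<Longrightarrow> Ck_on k E S h"
  shows "Ck_on (Suc k) E S f"
proof -
  have "Ck_on k E S (\<lambda>x. frechet_derivative f (at x within S) v)" if "v \<in> E" for v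
    by (rule cong[OF assms(4)[OF that]])
      (simp add: frechet_derivative_within_eq[OF assms(1,2) _ that assms(3)])
  then show ?thesis using assms(3) by (auto simp: differentiable_def)
qed

lemma Ck_on_cong_imp:
  assumes "subspace E" "openin (top_of_set E) S"
  shows "Ck_on k E S f \<Longrightarrow> (\<And>x. x \<in> S \<Longrightarrow> f x = g x) \<Longrightarrow> Ck_on k E S g"
proof (induction k arbitrary: f g)
  case 0
  then show ?case by (simp cong: continuous_on_cong)
next
  case (Suc k)
  show ?case
  proof (rule Ck_on_SucI[OF assms])
    fix x assume "x \<in> S"
    then have "(f has_derivative frechet_derivative f (at x within S)) (at x within S)"
      using Suc.prems(1) by (simp add: frechet_derivative_works)
    then show "(g has_derivative frechet_derivative f (at x within S)) (at x within S)"
      using has_derivative_transform[OF \<open>x \<in> S\<close>, of g f] Suc.prems(2) by metis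
  qed (use Suc in auto)
qed

lemma Ck_onI:
  assumes "subspace E" "openin (top_of_set E) S"
    and "\<And>x. x \<in> S \<Longrightarrow> (f has_derivative f' x) (at x within S)"
    and "\<And>v. v \<in> E \<Longrightarrow> Ck_on k E S (\<lambda>x. f' x v)"
  shows "Ck_on (Suc k) E S f"
  using Ck_on_SucI[OF assms] Ck_on_cong_imp[OF assms(1,2)] by blast

lemma Ck_onE:
  assumes "Ck_on (Suc k) E S f"
  obtains f' where "\<And>x. x \<in> S \<Longrightarrow> (f has_derivative f' x) (at x within S)"
    "\<And>v. v \<in> E \<Longrightarrow> Ck_on k E S (\<lambda>x. f' x v)"
  using assms that[of "\<lambda>x. frechet_derivative f (at x within S)"]
  by (auto simp: frechet_derivative_works)

lemma Ck_on_continuous_on: "Ck_on k E S f \<Longrightarrow> continuous_on S f"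
  by (cases k) (auto intro!: differentiable_imp_continuous_on simp: differentiable_on_def)

lemma Ck_on_subset:
  assumes "subspace E" "openin (top_of_set E) S" "openin (top_of_set E) T" "T \<subseteq> S"
  shows "Ck_on k E S f \<Longrightarrow> Ck_on k E T f"
proof (induction k arbitrary: f)
  case 0
  then show ?case using assms(4) continuous_on_subset by auto
next
  case (Suc k)
  from Suc.prems obtain f' where f': "\<And>x. x \<in> S \<Longrightarrow> (f has_derivative f' x) (at x within S)"
    "\<And>v. v \<in> E \<Longrightarrow> Ck_on k E S (\<lambda>x. f' x v)" by (erule_tac Ck_onE) blast
  show ?case
    by (rule Ck_onI[OF assms(1,3), of _ f'])
      (use f'(2) Suc.IH assms(4) in \<open>auto intro!: has_derivative_subset[OF f'(1) assms(4)]\<close>)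
qed

lemma Ck_on_Suc_imp:
  assumes "subspace E" "openin (top_of_set E) S"
  shows "Ck_on (Suc k) E S f \<Longrightarrow> Ck_on k E S f"
proof (induction k arbitrary: f)
  case 0
  then show ?case by (metis Ck_on_continuous_on Ck_on.simps(1))
next
  case (Suc k)
  from Suc.prems obtain f' where f': "\<And>x. x \<in> S \<Longrightarrow> (f has_derivative f' x) (at x within S)"
    "\<And>v. v \<in> E \<Longrightarrow> Ck_on (Suc k) E S (\<lambda>x. f' x v)" by (erule_tac Ck_onE) blast
  show ?case by (rule Ck_onI[OF assms, of _ f']) (use f' Suc.IH in auto)
qed

section \<open>Closure properties of the class C^k\<close>

lemma Ck_on_const:
  assumes "subspace E" "openin (top_of_set E) S"
  shows "Ck_on k E S (\<lambda>x. c)"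
proof (induction k arbitrary: c)
  case (Suc k)
  show ?case by (rule Ck_onI[OF assms, of _ "\<lambda>_ _. 0"]) (use Suc in auto)
qed auto

lemma Ck_on_linear:
  assumes "subspace E" "openin (top_of_set E) S" "bounded_linear h"
  shows "Ck_on k E S h"
proof (cases k)
  case 0
  then show ?thesis using assms(3) by (simp add: linear_continuous_on)
next
  case (Suc j)
  then show ?thesis
    using Ck_onI[OF assms(1,2), of h "\<lambda>_. h" j] Ck_on_const[OF assms(1,2)] assms(3)
    by (auto intro: bounded_linear_imp_has_derivative)
qed

lemma Ck_on_compose_linear:
  assumes "subspace E" "openin (top_of_set E) S" "bounded_linear h"
  shows "Ck_on k E S f \<Longrightarrow> Ck_on k E S (\<lambda>x. h (f x))"
proof (induction k arbitrary: f)
  case 0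
  then show ?case using assms(3)
    by (auto intro: continuous_on_compose2[OF linear_continuous_on[of h UNIV]])
next
  case (Suc k)
  from Suc.prems obtain f' where f': "\<And>x. x \<in> S \<Longrightarrow> (f has_derivative f' x) (at x within S)"
    "\<And>v. v \<in> E \<Longrightarrow> Ck_on k E S (\<lambda>x. f' x v)" by (erule_tac Ck_onE) blast
  show ?case
    by (rule Ck_onI[OF assms(1,2), of _ "\<lambda>x v. h (f' x v)"])
      (use f' Suc.IH assms(3) in \<open>auto intro: bounded_linear.has_derivative\<close>)
qed

lemma Ck_on_add:
  assumes "subspace E" "openin (top_of_set E) S"
  shows "Ck_on k E S f \<Longrightarrow> Ck_on k E S g \<Longrightarrow> Ck_on k E S (\<lambda>x. f x + g x)"
proof (induction k arbitrary: f g)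
  case 0
  then show ?case by (auto intro: continuous_intros)
next
  case (Suc k)
  from Suc.prems(1) obtain f' where f': "\<And>x. x \<in> S \<Longrightarrow> (f has_derivative f' x) (at x within S)"
    "\<And>v. v \<in> E \<Longrightarrow> Ck_on k E S (\<lambda>x. f' x v)" by (erule_tac Ck_onE) blast
  from Suc.prems(2) obtain g' where g': "\<And>x. x \<in> S \<Longrightarrow> (g has_derivative g' x) (at x within S)"
    "\<And>v. v \<in> E \<Longrightarrow> Ck_on k E S (\<lambda>x. g' x v)" by (erule_tac Ck_onE) blast
  show ?case
    by (rule Ck_onI[OF assms(1,2), of _ "\<lambda>x v. f' x v + g' x v"])
      (use f' g' Suc.IH in \<open>auto intro: has_derivative_add\<close>)
qed

lemma Ck_on_sum:
  assumes "subspace E" "openin (top_of_set E) S" "\<And>i. i \<in> I \<Longrightarrow> Ck_on k E S (f i)"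
  shows "Ck_on k E S (\<lambda>x. \<Sum>i\<in>I. f i x)"
  using assms(3)
proof (induction I rule: infinite_finite_induct)
  case (insert i I)
  then show ?case by (simp add: Ck_on_add[OF assms(1,2)])
qed (auto simp: Ck_on_const[OF assms(1,2)])

lemma Ck_on_bilinear:
  assumes "subspace E" "openin (top_of_set E) S" "bounded_bilinear p"
  shows "Ck_on k E S f \<Longrightarrow> Ck_on k E S g \<Longrightarrow> Ck_on k E S (\<lambda>x. p (f x) (g x))"
proof (induction k arbitrary: f g)
  case 0
  then show ?case using bounded_bilinear.continuous_on[OF assms(3)] by auto
next
  case (Suc k)
  from Suc.prems(1) obtain f' where f': "\<And>x. x \<in> S \<Longrightarrow> (f has_derivative f' x) (at x within S)"
    "\<And>v. v \<in> E \<Longrightarrow> Ck_on k E S (\<lambda>x. f' x v)" by (erule_tac Ck_onE) blast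
  from Suc.prems(2) obtain g' where g': "\<And>x. x \<in> S \<Longrightarrow> (g has_derivative g' x) (at x within S)"
    "\<And>v. v \<in> E \<Longrightarrow> Ck_on k E S (\<lambda>x. g' x v)" by (erule_tac Ck_onE) blast
  have fg: "Ck_on k E S f" "Ck_on k E S g"
    using Suc.prems Ck_on_Suc_imp[OF assms(1,2)] by auto
  show ?case
    by (rule Ck_onI[OF assms(1,2), of _ "\<lambda>x v. p (f x) (g' x v) + p (f' x v) (g x)"])
      (use f' g' fg Suc.IH in \<open>auto intro!: bounded_bilinear.FDERIV[OF assms(3)] Ck_on_add[OF assms(1,2)]\<close>)
qed

lemmas Ck_on_scaleR = Ck_on_bilinear[OF _ _ bounded_bilinear_scaleR]
lemmas Ck_on_inner = Ck_on_bilinear[OF _ _ bounded_bilinear_inner]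

lemma Ck_on_mult:
  fixes f g :: "'e::euclidean_space \<Rightarrow> real"
  shows "subspace E \<Longrightarrow> openin (top_of_set E) S \<Longrightarrow> Ck_on k E S f \<Longrightarrow> Ck_on k E S g \<Longrightarrow>
    Ck_on k E S (\<lambda>x. f x * g x)"
  by (rule Ck_on_bilinear[OF _ _ bounded_bilinear_mult])

lemma Ck_on_prod:
  fixes f :: "'i \<Rightarrow> 'e::euclidean_space \<Rightarrow> real"
  assumes "subspace E" "openin (top_of_set E) S" "\<And>i. i \<in> I \<Longrightarrow> Ck_on k E S (f i)"
  shows "Ck_on k E S (\<lambda>x. \<Prod>i\<in>I. f i x)"
  using assms(3)
proof (induction I rule: infinite_finite_induct)
  case (insert i I)
  then show ?case by (simp add: Ck_on_mult[OF assms(1,2)])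
qed (auto simp: Ck_on_const[OF assms(1,2)])

text \<open>The derivative of the reciprocal contains only the reciprocal itself and
  \<open>f'\<close>, so the induction hypothesis for the same \<open>f\<close> suffices.\<close>

lemma Ck_on_inverse:
  fixes f :: "'e::euclidean_space \<Rightarrow> real"
  assumes "subspace E" "openin (top_of_set E) S" "\<And>x. x \<in> S \<Longrightarrow> f x \<noteq> 0"
  shows "Ck_on k E S f \<Longrightarrow> Ck_on k E S (\<lambda>x. inverse (f x))"
proof (induction k)
  case 0
  then show ?case using assms(3) by (auto intro!: continuous_intros)
next
  case (Suc k)
  from Suc.prems(1) obtain f' where f': "\<And>x. x \<in> S \<Longrightarrow> (f has_derivative f' x) (at x within S)"
    "\<And>v. v \<in> E \<Longrightarrow> Ck_on k E S (\<lambda>x. f' x v)" by (erule_tac Ck_onE) blast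
  have inv: "Ck_on k E S (\<lambda>x. inverse (f x))"
    using Suc Ck_on_Suc_imp[OF assms(1,2)] by auto
  show ?case
    by (rule Ck_onI[OF assms(1,2), of _ "\<lambda>x v. - (inverse (f x) * f' x v * inverse (f x))"])
      (use f' inv assms(3) in \<open>auto intro!: Ck_on_mult[OF assms(1,2)] has_derivative_inverse
        Ck_on_compose_linear[OF assms(1,2) bounded_linear_minus[OF bounded_linear_ident]]\<close>)
qed

lemma Ck_on_compose:
  assumes E: "subspace E" "openin (top_of_set E) S"
    and F: "subspace F" "openin (top_of_set F) T" and "f ` S \<subseteq> T"
  shows "Ck_on k E S f \<Longrightarrow> Ck_on k F T g \<Longrightarrow> Ck_on k E S (\<lambda>x. g (f x))"
proof (induction k arbitrary: g)
  case 0
  then show ?case using assms(5) by (auto intro: continuous_on_compose2)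
next
  case (Suc k)
  from Suc.prems(1) obtain f' where f': "\<And>x. x \<in> S \<Longrightarrow> (f has_derivative f' x) (at x within S)"
    "\<And>v. v \<in> E \<Longrightarrow> Ck_on k E S (\<lambda>x. f' x v)" by (erule_tac Ck_onE) blast
  from Suc.prems(2) obtain g' where g': "\<And>x. x \<in> T \<Longrightarrow> (g has_derivative g' x) (at x within T)"
    "\<And>v. v \<in> F \<Longrightarrow> Ck_on k F T (\<lambda>x. g' x v)" by (erule_tac Ck_onE) blast
  obtain B where B: "finite B" "B \<subseteq> F" "\<And>x. x \<in> F \<Longrightarrow> (\<Sum>b\<in>B. (x \<bullet> b) *\<^sub>R b) = x"
    using subspace_orthonormal_basis[OF F(1)] by metis
  have TF: "T \<subseteq> F" using F(2) by (rule openin_imp_subset)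
  have fk: "Ck_on k E S f" using Suc.prems Ck_on_Suc_imp[OF E] by auto
  have der: "((\<lambda>x. g (f x)) has_derivative (\<lambda>v. g' (f x) (f' x v))) (at x within S)" if "x \<in> S" for x
    using diff_chain_within[OF f'(1)[OF that] has_derivative_subset[OF g'(1) assms(5)]] that assms(5)
    by (auto simp: o_def)
  have "Ck_on k E S (\<lambda>x. g' (f x) (f' x v))" if v: "v \<in> E" for v
  proof (rule Ck_on_cong_imp[OF E])
    \<comment> \<open>The direction \<open>f' x v\<close> varies with \<open>x\<close>, so the
      induction hypothesis does not apply to the chain rule formula directly. Expanding the
      direction in the basis \<open>B\<close> of \<open>F\<close> leaves composites with fixed
      directions \<open>b\<close>; this is where \<open>f' x v\<close> must lie in
      \<open>F\<close>.\<close>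
    show "Ck_on k E S (\<lambda>x. \<Sum>b\<in>B. (f' x v \<bullet> b) *\<^sub>R g' (f x) b)"
    proof (intro Ck_on_sum[OF E] Ck_on_scaleR[OF E] Ck_on_inner[OF E] f'(2) v Ck_on_const[OF E])
      fix b assume "b \<in> B"
      then show "Ck_on k E S (\<lambda>x. g' (f x) b)"
        using B(2) by (intro Suc.IH[OF fk] g'(2)) auto
    qed
    fix x assume x: "x \<in> S"
    have inF: "f' x v \<in> F"
      using has_derivative_in_subspace[OF E x v F(1) _ f'(1)[OF x]] assms(5) TF by blast
    have lin: "linear (g' (f x))" using g'(1) x assms(5) has_derivative_linear by blast
    show "(\<Sum>b\<in>B. (f' x v \<bullet> b) *\<^sub>R g' (f x) b) = g' (f x) (f' x v)"
      using B(3)[OF inF] linear_sum[OF lin] linear_scale[OF lin] by (metis (mono_tags, lifting) sum.cong)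
  qed
  then show ?case using Ck_onI[OF E der] by blast
qed

lemma Ck_on_iter_deriv:
  assumes "subspace E" "openin (top_of_set E) S"
    and "Ck_on (length vs + k) E S f" "set vs \<subseteq> E"
  shows "Ck_on k E S (iter_deriv S f vs)"
  using assms(3,4)
proof (induction vs arbitrary: k)
  case (Cons v vs)
  have "Ck_on (Suc k) E S (iter_deriv S f vs)" using Cons.IH[of "Suc k"] Cons.prems by simp
  then show ?case using Cons.prems by simp
qed auto

lemma iter_deriv_has_derivative:
  assumes "subspace E" "openin (top_of_set E) S" "Ck_on (Suc (length vs)) E S f" "set vs \<subseteq> E" "x \<in> S"
  shows "(iter_deriv S f vs has_derivative frechet_derivative (iter_deriv S f vs) (at x within S)) (at x within S)"
  using Ck_on_iter_deriv[OF assms(1,2), of vs 1 f] assms by (simp add: frechet_derivative_works)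

text \<open>The coefficient vectors stand on the right because the probe is parametrized by vectors.\<close>

lemma iter_deriv_lincomb:
  fixes f :: "'i \<Rightarrow> 'e::euclidean_space \<Rightarrow> real" and L :: "'i \<Rightarrow> 'f::euclidean_space"
  assumes E: "subspace E" "openin (top_of_set E) S" and "finite I"
    and "\<And>i. i \<in> I \<Longrightarrow> Ck_on (length vs) E S (f i)" "set vs \<subseteq> E" "x \<in> S"
  shows "iter_deriv S (\<lambda>y. \<Sum>i\<in>I. f i y *\<^sub>R L i) vs x = (\<Sum>i\<in>I. iter_deriv S (f i) vs x *\<^sub>R L i)"
  using assms(4-)
proof (induction vs arbitrary: x)
  case (Cons v vs)
  let ?D = "\<lambda>i. frechet_derivative (iter_deriv S (f i) vs) (at x within S)"
  have 1: "((\<lambda>y. \<Sum>i\<in>I. iter_deriv S (f i) vs y *\<^sub>R L i) has_derivative (\<lambda>w. \<Sum>i\<in>I. ?D i w *\<^sub>R L i)) (at x within S)"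
    using Cons.prems by (intro has_derivative_sum has_derivative_scaleR_left iter_deriv_has_derivative[OF E]) auto
  have fk: "Ck_on (length vs) E S (f i)" if "i \<in> I" for i
    using Cons.prems(1)[OF that] Ck_on_Suc_imp[OF E] by simp
  have "(iter_deriv S (\<lambda>y. \<Sum>i\<in>I. f i y *\<^sub>R L i) vs has_derivative (\<lambda>w. \<Sum>i\<in>I. ?D i w *\<^sub>R L i)) (at x within S)"
    by (rule has_derivative_transform[OF Cons.prems(3) _ 1]) (use Cons fk in auto)
  then show ?case using frechet_derivative_within_eq[OF E Cons.prems(3), of v] Cons.prems by auto
qed auto

section \<open>The class C^r and its local nature\<close>

lemma Cr_on_Ck: "Cr_on r E S f \<Longrightarrow> enat k \<le> r \<Longrightarrow> Ck_on k E S f"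
  by (simp add: Cr_on_def)

lemma Cr_on_has_derivative:
  assumes "Cr_on r E S f" "1 \<le> r" "x \<in> S"
  shows "(f has_derivative frechet_derivative f (at x within S)) (at x within S)"
proof -
  have "Ck_on 1 E S f" using assms by (intro Cr_on_Ck) (auto simp: one_enat_def)
  then show ?thesis using assms(3) by (simp add: frechet_derivative_works)
qed

lemma Cr_on_continuous_on: "Cr_on r E S f \<Longrightarrow> continuous_on S f"
  using Cr_on_Ck[of r E S f 0] by (simp add: zero_enat_def[symmetric])

lemma Cr_on_cong:
  assumes "subspace E" "openin (top_of_set E) S" "Cr_on r E S f" "\<And>x. x \<in> S \<Longrightarrow> f x = g x"
  shows "Cr_on r E S g"
  using assms unfolding Cr_on_def by (meson Ck_on_cong_imp)

lemma Cr_on_subset: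
  assumes "subspace E" "openin (top_of_set E) S" "openin (top_of_set E) T" "T \<subseteq> S" "Cr_on r E S f"
  shows "Cr_on r E T f"
  using assms unfolding Cr_on_def by (meson Ck_on_subset)

lemma Cr_on_compose:
  assumes "subspace E" "openin (top_of_set E) S" "subspace F" "openin (top_of_set F) T" "f ` S \<subseteq> T"
    and "Cr_on r E S f" "Cr_on r F T g"
  shows "Cr_on r E S (\<lambda>x. g (f x))"
  using assms(6,7) Ck_on_compose[OF assms(1-5)] unfolding Cr_on_def by blast

lemma Cr_on_linear: "subspace E \<Longrightarrow> openin (top_of_set E) S \<Longrightarrow> bounded_linear h \<Longrightarrow> Cr_on r E S h"
  by (simp add: Cr_on_def Ck_on_linear)

lemma Cr_on_const: "subspace E \<Longrightarrow> openin (top_of_set E) S \<Longrightarrow> Cr_on r E S (\<lambda>x. c)"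
  by (simp add: Cr_on_def Ck_on_const)

lemma Cr_on_add:
  "subspace E \<Longrightarrow> openin (top_of_set E) S \<Longrightarrow> Cr_on r E S f \<Longrightarrow> Cr_on r E S g \<Longrightarrow> Cr_on r E S (\<lambda>x. f x + g x)"
  by (simp add: Cr_on_def Ck_on_add)

lemma Cr_on_scaleR:
  "subspace E \<Longrightarrow> openin (top_of_set E) S \<Longrightarrow> Cr_on r E S f \<Longrightarrow> Cr_on r E S g \<Longrightarrow> Cr_on r E S (\<lambda>x. f x *\<^sub>R g x)"
  by (simp add: Cr_on_def Ck_on_scaleR)

lemma Cr_on_sum:
  "subspace E \<Longrightarrow> openin (top_of_set E) S \<Longrightarrow> (\<And>i. i \<in> I \<Longrightarrow> Cr_on r E S (f i)) \<Longrightarrow>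
    Cr_on r E S (\<lambda>x. \<Sum>i\<in>I. f i x)"
  by (simp add: Cr_on_def Ck_on_sum)

lemma Ck_on_local:
  assumes E: "subspace E" "openin (top_of_set E) S"
  shows "(\<And>x. x \<in> S \<Longrightarrow> \<exists>T. openin (top_of_set E) T \<and> x \<in> T \<and> T \<subseteq> S \<and> Ck_on k E T f) \<Longrightarrow> Ck_on k E S f"
proof (induction k arbitrary: f)
  case 0
  have "continuous (at x within S) f" if x: "x \<in> S" for x
  proof -
    obtain T where T: "openin (top_of_set E) T" "x \<in> T" "T \<subseteq> S" "continuous_on T f"
      using 0[OF x] by auto
    obtain O1 where O1: "open O1" "T = E \<inter> O1" using T(1) by (auto simp: openin_open)
    have "at x within T = at x within S"
      by (rule at_within_nhd[of _ O1]) (use O1 T openin_imp_subset[OF E(2)] in auto)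
    then show ?thesis using T by (metis continuous_on_eq_continuous_within)
  qed
  then show ?case by (simp add: continuous_on_eq_continuous_within)
next
  case (Suc k)
  let ?D = "\<lambda>x. frechet_derivative f (at x within S)"
  \<comment> \<open>\<open>frechet_derivative\<close> is chosen from the filter, so equality of the
    filters makes the derivatives within \<open>T\<close> and within \<open>S\<close> literally the
    same function.\<close>
  have loc: "\<exists>T. openin (top_of_set E) T \<and> x \<in> T \<and> T \<subseteq> S \<and> Ck_on (Suc k) E T f \<and> (\<forall>y\<in>T. at y within T = at y within S)"
    if x: "x \<in> S" for x
  proof -
    obtain T where T: "openin (top_of_set E) T" "x \<in> T" "T \<subseteq> S" "Ck_on (Suc k) E T f"
      using Suc.prems[OF x] by blast
    obtain O1 where O1: "open O1" "T = E \<inter> O1" using T(1) by (auto simp: openin_open)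
    have "at y within T = at y within S" if "y \<in> T" for y
      by (rule at_within_nhd[of _ O1]) (use O1 that T openin_imp_subset[OF E(2)] in auto)
    then show ?thesis using T by blast
  qed
  show ?case
  proof (rule Ck_onI[OF E, of _ ?D])
    fix x assume x: "x \<in> S"
    obtain T where T: "x \<in> T" "Ck_on (Suc k) E T f" "\<forall>y\<in>T. at y within T = at y within S"
      using loc[OF x] by blast
    then have "f differentiable (at x within T)" by simp
    then show "(f has_derivative ?D x) (at x within S)"
      using T(1,3) by (simp only: frechet_derivative_works)
  next
    fix v assume v: "v \<in> E"
    show "Ck_on k E S (\<lambda>x. ?D x v)"
    proof (rule Suc.IH)
      fix x assume x: "x \<in> S"
      obtain T where T: "openin (top_of_set E) T" "x \<in> T" "T \<subseteq> S" "Ck_on (Suc k) E T f"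
        "\<forall>y\<in>T. at y within T = at y within S" using loc[OF x] by blast
      have "Ck_on k E T (\<lambda>x. frechet_derivative f (at x within T) v)" using T(4) v by simp
      from Ck_on_cong_imp[OF E(1) T(1) this, of "\<lambda>x. ?D x v"] T(5)
      have "Ck_on k E T (\<lambda>x. ?D x v)" by simp
      then show "\<exists>T. openin (top_of_set E) T \<and> x \<in> T \<and> T \<subseteq> S \<and> Ck_on k E T (\<lambda>x. ?D x v)"
        using T by blast
    qed
  qed
qed

section \<open>Smooth bump functions and the inverse function theorem\<close>

text \<open>Allowing every exponent \<open>n\<close> closes the family under differentiation up to
  linear combinations, so that one induction gives smoothness; the bumps use
  \<open>flat 0\<close>.\<close>

definition flat :: "nat \<Rightarrow> real \<Rightarrow> real" where
  "flat n t = (if t > 0 then exp (- 1 / t) / t ^ n else 0)"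

lemma flat_tendsto_0: "(flat n \<longlongrightarrow> 0) (at 0)"
proof -
  have "((\<lambda>t::real. exp (- 1 / t) / t ^ n) \<longlongrightarrow> 0) (at_right 0)" by real_asymp
  then have "(flat n \<longlongrightarrow> 0) (at_right 0)"
    by (rule Lim_transform_eventually)
      (auto simp: eventually_at_right_field flat_def intro!: exI[of _ 1])
  moreover have "(flat n \<longlongrightarrow> 0) (at_left 0)"
    by (rule Lim_transform_eventually[OF tendsto_const])
      (auto simp: eventually_at_left_field flat_def intro!: exI[of _ "-1"])
  ultimately show ?thesis by (simp add: filterlim_split_at)
qed

lemma flat_has_derivative:
  "(flat n has_real_derivative (flat (n + 2) t - real n * flat (n + 1) t)) (at t)"
proof -
  consider "t < 0" | "t = 0" | "t > 0" by linarith
  then show ?thesis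
  proof cases
    case 1
    have "(flat n has_real_derivative 0) (at t)"
      by (rule has_field_derivative_transform_within_open[of "\<lambda>_. 0" _ _ "{..<0}"])
        (use 1 in \<open>auto simp: flat_def\<close>)
    then show ?thesis using 1 by (simp add: flat_def)
  next
    case 2
    \<comment> \<open>Away from 0 the difference quotient of \<open>flat n\<close> at 0 is
      \<open>flat (Suc n)\<close>.\<close>
    have "((\<lambda>h. (flat n (0 + h) - flat n 0) / h) \<longlongrightarrow> 0) (at 0)"
      by (rule Lim_transform_eventually[OF flat_tendsto_0[of "Suc n"]])
        (auto simp: eventually_at_filter flat_def)
    then show ?thesis using 2 by (simp add: DERIV_def flat_def)
  next
    case 3
    have "((\<lambda>t. exp (- 1 / t) / t ^ n) has_real_derivative
       (exp (- 1 / t) / t ^ (n + 2) - real n * (exp (- 1 / t) / t ^ (n + 1)))) (at t)"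
      using 3
      by (cases n) (auto intro!: derivative_eq_intros simp: field_simps power2_eq_square,
        metis power_minus_mult One_nat_def mult.commute neq0_conv)
    then have "(flat n has_real_derivative
       (exp (- 1 / t) / t ^ (n + 2) - real n * (exp (- 1 / t) / t ^ (n + 1)))) (at t)"
      by (rule has_field_derivative_transform_within_open[of _ _ _ "{0<..}"])
        (use 3 in \<open>auto simp: flat_def\<close>)
    then show ?thesis using 3 by (simp add: flat_def)
  qed
qed

lemma Ck_on_flat: "Ck_on k UNIV UNIV (flat n)"
proof (induction k arbitrary: n)
  case 0
  then show ?case
    by (auto intro!: continuous_at_imp_continuous_on DERIV_isCont flat_has_derivative)
next
  case (Suc k)
  have UN: "subspace (UNIV :: real set)" "openin (top_of_set UNIV) (UNIV :: real set)" by auto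
  show ?case
  proof (rule Ck_onI[OF UN, of _ "\<lambda>x v. (flat (n + 2) x + - real n * flat (n + 1) x) * v"])
    fix x :: real
    show "(flat n has_derivative (*) (flat (n + 2) x + - real n * flat (n + 1) x)) (at x)"
      using flat_has_derivative[of n x] by (simp add: has_field_derivative_def)
    fix v :: real
    show "Ck_on k UNIV UNIV (\<lambda>x. (flat (n + 2) x + - real n * flat (n + 1) x) * v)"
      by (intro Ck_on_mult[OF UN] Ck_on_add[OF UN] Suc.IH Ck_on_const[OF UN])
  qed
qed

text \<open>The parameter \<open>R\<close> is compared with the squared distance to
  \<open>p\<close>, which keeps the argument of \<open>flat\<close> polynomial.\<close>

lemma Cr_on_bump:
  fixes p :: "'e::euclidean_space"
  assumes E: "subspace E" "openin (top_of_set E) S"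
  shows "Cr_on r E S (\<lambda>x. flat 0 (R - (x - p) \<bullet> (x - p)))"
proof -
  have "Ck_on k E S (\<lambda>x. flat 0 (R + - ((x - p) \<bullet> (x - p))))" for k
  proof (rule Ck_on_compose[OF E, where F = UNIV and T = UNIV and g = "flat 0"])
    have 1: "Ck_on k E S (\<lambda>x. x + - p)"
      by (intro Ck_on_add[OF E] Ck_on_linear[OF E] Ck_on_const[OF E] bounded_linear_ident)
    have 2: "Ck_on k E S (\<lambda>x. - ((x - p) \<bullet> (x - p)))"
      by (intro Ck_on_compose_linear[OF E bounded_linear_minus[OF bounded_linear_ident]] Ck_on_inner[OF E])
        (use 1 in auto)
    show "Ck_on k E S (\<lambda>x. R + - ((x - p) \<bullet> (x - p)))"
      by (intro Ck_on_add[OF E] Ck_on_const[OF E] 2)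
  qed (auto simp: Ck_on_flat)
  then show ?thesis by (simp add: Cr_on_def)
qed

lemma flat_pos_iff: "flat n t > 0 \<longleftrightarrow> t > 0"
  by (simp add: flat_def)

lemma flat_0_mono: "s \<le> t \<Longrightarrow> flat 0 s \<le> flat 0 t"
  by (auto simp: flat_def divide_simps)

section \<open>Regularity of linear systems and of inverse functions\<close>

lemma Ck_on_vecI:
  fixes f :: "'e::euclidean_space \<Rightarrow> real ^ 'k"
  assumes E: "subspace E" "openin (top_of_set E) S" and "\<And>i. Ck_on k E S (\<lambda>x. f x $ i)"
  shows "Ck_on k E S f"
proof -
  have "Ck_on k E S (\<lambda>x. \<Sum>i\<in>UNIV. (f x $ i) *\<^sub>R (axis i 1 :: real ^ 'k))"
    by (intro Ck_on_sum[OF E] Ck_on_scaleR[OF E] assms(3) Ck_on_const[OF E])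
  moreover have "(\<Sum>i\<in>UNIV. (f x $ i) *\<^sub>R axis i 1) = f x" for x
    using basis_expansion[of "f x"] by (simp add: scalar_mult_eq_scaleR)
  ultimately show ?thesis by simp
qed

lemma Ck_on_det:
  fixes a :: "'e::euclidean_space \<Rightarrow> real ^ 'k ^ 'k"
  assumes E: "subspace E" "openin (top_of_set E) S" and "\<And>i j. Ck_on k E S (\<lambda>x. a x $ i $ j)"
  shows "Ck_on k E S (\<lambda>x. det (a x))"
  unfolding det_def
  by (intro Ck_on_sum[OF E] Ck_on_mult[OF E] Ck_on_prod[OF E] assms(3) Ck_on_const[OF E])

text \<open>Cramer's rule makes the solution of a linear system as regular as its matrix.\<close>

lemma Ck_on_solve:
  fixes a :: "'e::euclidean_space \<Rightarrow> real ^ 'k ^ 'k"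
  assumes E: "subspace E" "openin (top_of_set E) S" and a: "\<And>i j. Ck_on k E S (\<lambda>x. a x $ i $ j)"
    and "\<And>x. x \<in> S \<Longrightarrow> det (a x) \<noteq> 0" "\<And>x. x \<in> S \<Longrightarrow> a x *v w x = v"
  shows "Ck_on k E S w"
proof (rule Ck_on_vecI[OF E])
  fix l
  let ?m = "\<lambda>x. \<chi> i j. if j = l then v $ i else a x $ i $ j"
  have "Ck_on k E S (\<lambda>x. det (?m x) * inverse (det (a x)))"
  proof (intro Ck_on_mult[OF E] Ck_on_inverse[OF E] Ck_on_det[OF E] a assms(4))
    fix i j show "Ck_on k E S (\<lambda>x. ?m x $ i $ j)"
      by (cases "j = l") (simp_all add: a Ck_on_const[OF E])
  qed
  then show "Ck_on k E S (\<lambda>x. w x $ l)"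
  proof (rule Ck_on_cong_imp[OF E])
    fix x assume x: "x \<in> S"
    show "det (?m x) * inverse (det (a x)) = w x $ l"
      using cramer[OF assms(4)[OF x], of "w x" v] assms(5)[OF x] by (simp add: divide_inverse)
  qed
qed

text \<open>By the classical theorem \<open>g\<close> is differentiable and its derivative at
  \<open>y\<close> is the inverse of \<open>D (g y)\<close>. If \<open>g\<close> is of class C^k, so
  is the matrix of \<open>D (g y)\<close> and, by \<open>Ck_on_solve\<close>, also
  \<open>g'\<close>; thus \<open>g\<close> gains one order at a time up to \<open>r\<close>.\<close>

lemma Cr_inverse_function:
  fixes f :: "real ^ 'k \<Rightarrow> real ^ 'k"
  assumes "open U" "Cr_on r UNIV U f" "1 \<le> r" "x0 \<in> U"
    and "inj (frechet_derivative f (at x0))"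
  obtains U' V g where "open U'" "U' \<subseteq> U" "x0 \<in> U'" "open V" "f x0 \<in> V" "homeomorphism U' V f g"
    "Cr_on r UNIV V g"
proof -
  have UU: "subspace (UNIV :: (real ^ 'k) set)" "\<And>S :: (real ^ 'k) set. open S \<Longrightarrow> openin (top_of_set UNIV) S"
    by auto
  define D where "D x = frechet_derivative f (at x)" for x
  have at: "at x within U = at x" if "x \<in> U" for x using assms(1) that by (rule at_within_open[rotated])
  have der: "(f has_derivative D x) (at x)" if "x \<in> U" for x
    using Cr_on_has_derivative[OF assms(2,3) that] at[OF that] by (simp add: D_def)
  have DCk: "Ck_on k UNIV U (\<lambda>x. D x v)" if "enat (Suc k) \<le> r" for k v
  proof -
    have "Ck_on (Suc k) UNIV U f" using that assms(2) by (rule Cr_on_Ck[rotated])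
    then have "Ck_on k UNIV U (\<lambda>x. frechet_derivative f (at x within U) v)" by simp
    then show ?thesis
      by (rule Ck_on_cong_imp[OF UU(1) UU(2)[OF assms(1)]]) (simp add: at D_def)
  qed
  have bl: "bounded_linear (D x)" if "x \<in> U" for x using der[OF that] by (rule has_derivative_bounded_linear)
  define f' where "f' x = Blinfun (D x)" for x
  have f': "blinfun_apply (f' x) = D x" if "x \<in> U" for x
    using bl[OF that] by (simp add: f'_def bounded_linear_Blinfun_apply)
  have cont: "continuous_on U f'"
  proof (rule continuous_on_blinfun_componentwise)
    fix i :: "real ^ 'k" assume "i \<in> Basis"
    have "continuous_on U (\<lambda>x. D x i)"
      using Ck_on_continuous_on[OF DCk[of 0 i]] assms(3) by (simp add: one_enat_def)
    then show "continuous_on U (\<lambda>x. blinfun_apply (f' x) i)"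
      by (rule continuous_on_eq) (simp add: f')
  qed
  have linD0: "linear (D x0)" using bl[OF assms(4)] bounded_linear.linear by blast
  obtain h where h: "linear h" "h \<circ> D x0 = id"
    using linear_injective_left_inverse[OF linD0] assms(5) by (auto simp: D_def)
  have bh: "bounded_linear h" using h(1) by (simp add: linear_conv_bounded_linear)
  have "Blinfun h o\<^sub>L f' x0 = id_blinfun"
  proof (rule blinfun_eqI)
    fix i show "blinfun_apply (Blinfun h o\<^sub>L f' x0) i = blinfun_apply id_blinfun i"
      using h(2) f'[OF assms(4)] by (simp add: bounded_linear_Blinfun_apply[OF bh]) (metis comp_apply id_apply)
  qed
  note inv = this
  have der': "(f has_derivative blinfun_apply (f' x)) (at x)" if "x \<in> U" for x
    using der[OF that] f'[OF that] by simp
  show thesis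
  proof (rule inverse_function_theorem[OF assms(1) der' cont assms(4) inv])
    fix U' V g g' assume g: "open U'" "U' \<subseteq> U" "x0 \<in> U'" "open V" "f x0 \<in> V" "homeomorphism U' V f g"
    "\<And>y. y \<in> V \<Longrightarrow> (g has_derivative (g' y)) (at y)"
    "\<And>y. y \<in> V \<Longrightarrow> g' y = inv (blinfun_apply (f'(g y)))"
    "\<And>y. y \<in> V \<Longrightarrow> bij (blinfun_apply (f'(g y)))"
  have gU: "g y \<in> U" if "y \<in> V" for y
  proof -
    have "g ` V = U'" using g(6) by (simp add: homeomorphism_def)
    then show ?thesis using g(2) that by blast
  qed
  have VV: "openin (top_of_set UNIV) V" using g(4) by simp
  have "Ck_on k UNIV V g" if "enat k \<le> r" for k
    using that
  proof (induction k)
    case 0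
    then show ?case using g(6) by (simp add: homeomorphism_def)
  next
    case (Suc k)
    have "enat k \<le> enat (Suc k)" by simp
    then have gk: "Ck_on k UNIV V g" using Suc by (meson order_trans)
    show ?case
    proof (rule Ck_onI[OF UU(1) VV, of _ g'])
      fix y assume "y \<in> V"
      then show "(g has_derivative g' y) (at y within V)" using g(7) has_derivative_at_withinI by blast
    next
      fix v
      show "Ck_on k UNIV V (\<lambda>y. g' y v)"
      proof (rule Ck_on_solve[OF UU(1) VV, of _ "\<lambda>y. matrix (D (g y))"])
        fix i j
        have "Ck_on k UNIV V (\<lambda>y. D (g y) (axis j 1))"
          using gU by (intro Ck_on_compose[OF UU(1) VV UU(1) UU(2)[OF assms(1)] _ gk DCk[OF Suc.prems]]) auto
        then show "Ck_on k UNIV V (\<lambda>y. matrix (D (g y)) $ i $ j)"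
          by (simp add: matrix_def Ck_on_compose_linear[OF UU(1) VV bounded_linear_vec_nth])
      next
        fix y assume y: "y \<in> V"
        have lin: "linear (D (g y))" using bl[OF gU[OF y]] bounded_linear.linear by blast
        have bij: "bij (D (g y))" using g(9)[OF y] f'[OF gU[OF y]] by simp
        have "invertible (matrix (D (g y)))"
          using bij invertible_eq_bij[of "matrix (D (g y))"] lin by (simp add: matrix_vector_mul[symmetric] matrix_works eta_contract_eq)
        then show "det (matrix (D (g y))) \<noteq> 0" by (simp add: invertible_det_nz)
        show "matrix (D (g y)) *v g' y v = v"
          using g(8)[OF y] f'[OF gU[OF y]] bij lin by (simp add: matrix_works bij_is_surj surj_f_inv_f)
      qed
    qed
  qed
  then have "Cr_on r UNIV V g" by (simp add: Cr_on_def)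
  with g show thesis using that by blast
  qed
qed

section \<open>Compact manifolds\<close>

lemma Cr_on_local:
  assumes "subspace E" "openin (top_of_set E) S"
    and "\<And>x. x \<in> S \<Longrightarrow> \<exists>T. openin (top_of_set E) T \<and> x \<in> T \<and> T \<subseteq> S \<and> Cr_on r E T f"
  shows "Cr_on r E S f"
  unfolding Cr_on_def
proof (intro allI impI)
  fix k assume "enat k \<le> r"
  then show "Ck_on k E S f"
    using assms(3) unfolding Cr_on_def by (intro Ck_on_local[OF assms(1,2)]) metis
qed

text \<open>Only derivatives along an orthonormal basis are assumed bounded, since these are what a
  C^r neighbourhood controls; a general direction costs the factor \<open>card B\<close>. The mean
  value inequality is applied along the segment from \<open>y\<close> to \<open>x\<close>.\<close>

lemma derivative_bound_imp_lipschitz: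
  fixes f :: "'e::euclidean_space \<Rightarrow> 'f::euclidean_space"
  assumes E: "subspace E" "openin (top_of_set E) S" and "Q \<subseteq> S" "convex Q"
    and B: "B \<subseteq> E" "\<And>b. b \<in> B \<Longrightarrow> norm b = 1" "\<And>x. x \<in> E \<Longrightarrow> (\<Sum>b\<in>B. (x \<bullet> b) *\<^sub>R b) = x"
    and der: "\<And>z. z \<in> S \<Longrightarrow> (f has_derivative f' z) (at z within S)"
    and bd: "\<And>z b. z \<in> Q \<Longrightarrow> b \<in> B \<Longrightarrow> norm (f' z b) \<le> K"
    and xy: "x \<in> Q" "y \<in> Q"
  shows "norm (f x - f y) \<le> real (card B) * K * norm (x - y)"
proof -
  let ?v = "x - y" and ?l = "\<lambda>t::real. y + t *\<^sub>R (x - y)"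
  have lQ: "?l t \<in> Q" if "t \<in> {0..1}" for t
    using convexD_alt[OF assms(4) xy(2,1), of t] that by (simp add: algebra_simps)
  have vE: "?v \<in> E" using xy assms(3) openin_imp_subset[OF E(2)] by (intro subspace_diff[OF E(1)]) auto
  have dl: "((\<lambda>t. f (?l t)) has_derivative (\<lambda>s. s *\<^sub>R f' (?l t) ?v)) (at t within {0..1})"
    if t: "t \<in> {0..1}" for t
  proof -
    have "(?l has_derivative (\<lambda>s. s *\<^sub>R ?v)) (at t within {0..1})"
      by (auto intro!: derivative_eq_intros)
    moreover have lS: "?l ` {0..1} \<subseteq> S" "?l t \<in> S" using lQ[OF t] lQ assms(3) by blast+
    note d = has_derivative_subset[OF der[OF lS(2)] lS(1)]
    ultimately have "((\<lambda>t. f (?l t)) has_derivative (\<lambda>s. f' (?l t) (s *\<^sub>R ?v))) (at t within {0..1})"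
      using diff_chain_within[OF _ d, of "\<lambda>s. s *\<^sub>R ?v"] by (simp add: o_def)
    moreover have "linear (f' (?l t))" using d by (rule has_derivative_linear)
    ultimately show ?thesis by (simp add: linear_scale)
  qed
  have nb: "norm (f' z ?v) \<le> real (card B) * K * norm ?v" if z: "z \<in> Q" for z
  proof -
    have lin: "linear (f' z)" using der z assms(3) has_derivative_linear by blast
    have "f' z ?v = f' z (\<Sum>b\<in>B. (?v \<bullet> b) *\<^sub>R b)" using B(3)[OF vE] by simp
    also have "\<dots> = (\<Sum>b\<in>B. (?v \<bullet> b) *\<^sub>R f' z b)" by (simp add: linear_sum[OF lin] linear_scale[OF lin])
    also have "norm \<dots> \<le> (\<Sum>b\<in>B. norm ?v * K)"
    proof (rule sum_norm_le)
      fix b assume b: "b \<in> B"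
      have "\<bar>?v \<bullet> b\<bar> \<le> norm ?v" using Cauchy_Schwarz_ineq2[of ?v b] B(2)[OF b] by simp
      then show "norm ((?v \<bullet> b) *\<^sub>R f' z b) \<le> norm ?v * K"
        using bd[OF z b] by (simp add: mult_mono)
    qed
    finally show ?thesis by (simp add: mult_ac)
  qed
  have "norm (f (?l 1) - f (?l 0)) \<le> real (card B) * K * norm ?v * norm (1 - 0 :: real)"
  proof (rule differentiable_bound[OF convex_real_interval(5) dl])
    fix t :: real assume t: "t \<in> {0..1}"
    show "onorm (\<lambda>s. s *\<^sub>R f' (?l t) ?v) \<le> real (card B) * K * norm ?v"
    proof (rule onorm_bound)
      show "0 \<le> real (card B) * K * norm ?v" using order_trans[OF norm_ge_zero nb[OF lQ[OF t]]] .
      show "norm (s *\<^sub>R f' (?l t) ?v) \<le> real (card B) * K * norm ?v * norm s" for s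
        using mult_left_mono[OF nb[OF lQ[OF t]], of "\<bar>s\<bar>"] by (simp add: mult_ac)
    qed
  qed auto
  then show ?thesis by simp
qed

section \<open>Charts and C^r functions on a compact manifold\<close>

locale cr_manifold =
  fixes r :: enat and E :: "'e::euclidean_space set" and A :: "('m::t2_space, 'e) chart set"
  assumes r1: "1 \<le> r" and atlas: "Cr_atlas r E A" and compact_UNIV: "compact (UNIV :: 'm set)"
begin

lemma E: "subspace E"
  using atlas by (simp add: Cr_atlas_def)

lemma charts_cover: "\<exists>(U, c)\<in>A. x \<in> U"
  using atlas unfolding Cr_atlas_def by blast

lemma chart:
  assumes "(U, c) \<in> A"
  shows "open U" "openin (top_of_set E) (c ` U)" "homeomorphism U (c ` U) c (inv_into U c)"
  using atlas assms by (auto simp: Cr_atlas_def)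

lemma chart_inv:
  assumes "(U, c) \<in> A"
  shows "inj_on c U" "continuous_on U c" "continuous_on (c ` U) (inv_into U c)"
    "\<And>x. x \<in> U \<Longrightarrow> inv_into U c (c x) = x" "\<And>x. x \<in> U \<Longrightarrow> c x \<in> E"
    "\<And>y. y \<in> c ` U \<Longrightarrow> inv_into U c y \<in> U" "\<And>y. y \<in> c ` U \<Longrightarrow> c (inv_into U c y) = y"
proof -
  note h = chart[OF assms]
  show inj: "inj_on c U" using h(3) by (metis homeomorphism_def inj_on_inverseI)
  show "continuous_on U c" "continuous_on (c ` U) (inv_into U c)" using h(3) by (auto simp: homeomorphism_def)
  show "\<And>x. x \<in> U \<Longrightarrow> inv_into U c (c x) = x" using inj by simp
  show "\<And>x. x \<in> U \<Longrightarrow> c x \<in> E" using openin_imp_subset[OF h(2)] by blast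
  show "\<And>y. y \<in> c ` U \<Longrightarrow> inv_into U c y \<in> U" by (rule inv_into_into)
  show "\<And>y. y \<in> c ` U \<Longrightarrow> c (inv_into U c y) = y" by (rule f_inv_into_f)
qed

lemma openin_chart_image:
  assumes "(U, c) \<in> A" "open W" "W \<subseteq> U"
  shows "openin (top_of_set E) (c ` W)"
proof -
  have "openin (top_of_set U) W" using assms by (auto intro: open_subset)
  then have "openin (top_of_set (c ` U)) (c ` W)"
    using homeomorphism_imp_open_map[OF chart(3)[OF assms(1)]] by blast
  then show ?thesis using chart(2)[OF assms(1)] openin_trans by blast
qed

lemma Cr_transition:
  assumes "(U, c) \<in> A" "(V, d) \<in> A"
  shows "Cr_on r E (c ` (U \<inter> V)) (\<lambda>y. d (inv_into U c y))"
  using atlas assms by (auto simp: Cr_atlas_def o_def)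

lemma Cr_functions_chart:
  assumes "\<phi> \<in> Cr_functions r E A" "(U, c) \<in> A"
  shows "Cr_on r E (c ` U) (\<lambda>y. \<phi> (inv_into U c y))"
  using assms by (auto simp: Cr_functions_def Cr_map_def std_atlas_def o_def)

lemma Cr_functions_continuous: "\<phi> \<in> Cr_functions r E A \<Longrightarrow> continuous_on S \<phi>"
  using continuous_on_subset by (fastforce simp: Cr_functions_def Cr_map_def)

lemma Cr_functionsI:
  assumes "\<And>U c. (U, c) \<in> A \<Longrightarrow> Cr_on r E (c ` U) (\<lambda>y. \<phi> (inv_into U c y))"
  shows "\<phi> \<in> Cr_functions r E A"
proof -
  have "isCont \<phi> x" for x
  proof -
    obtain U c where U: "(U, c) \<in> A" "x \<in> U" using charts_cover by blast
    have "continuous_on U (\<lambda>x. \<phi> (inv_into U c (c x)))"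
      using continuous_on_compose2[OF Cr_on_continuous_on[OF assms[OF U(1)]] chart_inv(2)[OF U(1)]] by simp
    then have "continuous_on U \<phi>" by (rule continuous_on_eq) (simp add: chart_inv(4)[OF U(1)])
    then show ?thesis using chart(1)[OF U(1)] U(2) continuous_on_eq_continuous_at by blast
  qed
  then have "continuous_on UNIV \<phi>" by (simp add: continuous_at_imp_continuous_on)
  then show ?thesis using assms by (auto simp: Cr_functions_def Cr_map_def std_atlas_def o_def)
qed

lemma Cr_functions_add:
  assumes "\<phi> \<in> Cr_functions r E A" "\<psi> \<in> Cr_functions r E A"
  shows "(\<lambda>x. \<phi> x + \<psi> x) \<in> Cr_functions r E A"
  by (rule Cr_functionsI) (intro Cr_on_add[OF E chart(2)] Cr_functions_chart assms)

lemma Cr_functions_lincomb: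
  assumes "\<And>i. i \<in> I \<Longrightarrow> f i \<in> Cr_functions r E A"
  shows "(\<lambda>x. \<Sum>i\<in>I. f i x *\<^sub>R L i) \<in> Cr_functions r E A"
  by (rule Cr_functionsI)
    (intro Cr_on_sum[OF E chart(2)] Cr_on_scaleR[OF E chart(2)] Cr_on_const[OF E chart(2)] Cr_functions_chart assms)

text \<open>The ball of twice the radius is kept inside the chart so that a bump supported there can
  be bounded below on the ball of radius \<open>R\<close>.\<close>

definition good_ball :: "('m, 'e) chart \<times> 'e \<times> real \<Rightarrow> bool" where
  "good_ball = (\<lambda>((U, c), p, R). (U, c) \<in> A \<and> p \<in> E \<and> 0 < R \<and> E \<inter> cball p (2 * R) \<subseteq> c ` U)"

definition chart_ball :: "('m, 'e) chart \<times> 'e \<times> real \<Rightarrow> 'm set" where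
  "chart_ball = (\<lambda>((U, c), p, R). {x \<in> U. dist (c x) p < R})"

definition chart_cball :: "('m, 'e) chart \<times> 'e \<times> real \<Rightarrow> 'm set" where
  "chart_cball = (\<lambda>((U, c), p, R). {x \<in> U. dist (c x) p \<le> R})"

lemma chart_ball_subset: "chart_ball j \<subseteq> chart_cball j"
  by (auto simp: chart_ball_def chart_cball_def split: prod.splits)

lemma open_chart_ball:
  assumes "(U, c) \<in> A"
  shows "open (chart_ball ((U, c), p, R))"
proof -
  have "open (U \<inter> (\<lambda>x. dist (c x) p) -` {..<R})"
    by (intro continuous_open_preimage chart[OF assms] continuous_intros chart_inv[OF assms] open_lessThan)
  then show ?thesis by (simp add: chart_ball_def vimage_def Int_def)
qed

lemma cball_sub_chart:
  assumes "(U, c) \<in> A" "E \<inter> cball p R \<subseteq> c ` U"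
  shows "c ` {x \<in> U. dist (c x) p \<le> R} = E \<inter> cball p R" "compact {x \<in> U. dist (c x) p \<le> R}"
proof -
  note ch = chart_inv[OF assms(1)]
  show eq: "c ` {x \<in> U. dist (c x) p \<le> R} = E \<inter> cball p R"
    using assms(2) ch(5) by (auto simp: dist_commute)
  have "compact (E \<inter> cball p R)" using closed_subspace[OF E] by (simp add: closed_Int_compact)
  then have "compact (inv_into U c ` (E \<inter> cball p R))"
    using compact_continuous_image continuous_on_subset[OF ch(3) assms(2)] by blast
  moreover have "inv_into U c ` (E \<inter> cball p R) = {x \<in> U. dist (c x) p \<le> R}"
    unfolding eq[symmetric] image_image using ch(4) by (auto simp: image_iff)
  ultimately show "compact {x \<in> U. dist (c x) p \<le> R}" by simp
qed

lemma good_cball: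
  assumes "good_ball ((U, c), p, R)"
  shows "c ` chart_cball ((U, c), p, R) = E \<inter> cball p R" "compact (chart_cball ((U, c), p, R))"
proof -
  have "E \<inter> cball p R \<subseteq> E \<inter> cball p (2 * R)" using assms by (auto simp: good_ball_def)
  then have "(U, c) \<in> A" "E \<inter> cball p R \<subseteq> c ` U" using assms by (auto simp: good_ball_def)
  from cball_sub_chart[OF this]
  show "c ` chart_cball ((U, c), p, R) = E \<inter> cball p R" "compact (chart_cball ((U, c), p, R))"
    by (auto simp: chart_cball_def)
qed

text \<open>Near a point of \<open>U\<close> the extension is a composite with a chart transition.
  Near any other point it is 0, because the compact coordinate ball outside which \<open>h\<close>
  vanishes is closed in the Hausdorff space.\<close>

lemma Cr_bump_extend:
  fixes h :: "'e \<Rightarrow> 'f::euclidean_space"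
  assumes U: "(U, c) \<in> A" and R: "E \<inter> cball p R \<subseteq> c ` U"
    and h: "Cr_on r E (c ` U) h" "\<And>y. y \<in> c ` U \<Longrightarrow> dist y p > R \<Longrightarrow> h y = 0"
  shows "(\<lambda>x. if x \<in> U then h (c x) else 0) \<in> Cr_functions r E A"
proof (rule Cr_functionsI)
  fix V d assume V: "(V, d) \<in> A"
  let ?K = "{x \<in> U. dist (c x) p \<le> R}"
  let ?f = "\<lambda>x. if x \<in> U then h (c x) else 0"
  have "closed ?K" using cball_sub_chart(2)[OF U R] by (rule compact_imp_closed)
  note V' = chart_inv[OF V]
  show "Cr_on r E (d ` V) (\<lambda>y. ?f (inv_into V d y))"
  proof (rule Cr_on_local[OF E chart(2)[OF V]])
    fix y assume y: "y \<in> d ` V"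
    define x where "x = inv_into V d y"
    have x: "x \<in> V" "d x = y" using V' y by (auto simp: x_def)
    show "\<exists>T. openin (top_of_set E) T \<and> y \<in> T \<and> T \<subseteq> d ` V \<and> Cr_on r E T (\<lambda>y. ?f (inv_into V d y))"
    proof (cases "x \<in> U")
      case True
      have op: "openin (top_of_set E) (d ` (V \<inter> U))"
        using openin_chart_image[OF V] chart(1)[OF U] chart(1)[OF V] by blast
      have "Cr_on r E (d ` (V \<inter> U)) (\<lambda>y. h (c (inv_into V d y)))"
        using V' by (intro Cr_on_compose[OF E op E chart(2)[OF U] _ Cr_transition[OF V U] h(1)]) auto
      then have "Cr_on r E (d ` (V \<inter> U)) (\<lambda>y. ?f (inv_into V d y))"
        by (rule Cr_on_cong[OF E op]) (use V' in auto)
      then show ?thesis using op x True by blast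
    next
      case False
      have op: "openin (top_of_set E) (d ` (V - ?K))"
        using openin_chart_image[OF V] \<open>closed ?K\<close> chart(1)[OF V] by blast
      have "Cr_on r E (d ` (V - ?K)) (\<lambda>y. ?f (inv_into V d y))"
        by (rule Cr_on_cong[OF E op Cr_on_const[OF E op, of _ 0]])
          (use V'(4) in \<open>auto, metis h(2) imageI not_le\<close>)
      then show ?thesis using op x False by blast
    qed
  qed
qed

lemma good_ball_cover:
  obtains J where "finite J" "\<And>j. j \<in> J \<Longrightarrow> good_ball j" "(\<Union>j\<in>J. chart_ball j) = UNIV"
proof -
  have "\<exists>j. good_ball j \<and> x \<in> chart_ball j" for x
  proof -
    obtain U c where U: "(U, c) \<in> A" "x \<in> U" using charts_cover by blast
    then obtain e where e: "e > 0" "cball (c x) e \<inter> E \<subseteq> c ` U"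
      using chart(2)[OF U(1)] by (meson imageI openin_contains_cball)
    then have "good_ball ((U, c), c x, e / 2) \<and> x \<in> chart_ball ((U, c), c x, e / 2)"
      using U chart_inv(5)[OF U] by (auto simp: good_ball_def chart_ball_def)
    then show ?thesis by blast
  qed
  then have "UNIV \<subseteq> (\<Union>j\<in>Collect good_ball. chart_ball j)" by blast
  moreover have "open (chart_ball j)" if "j \<in> Collect good_ball" for j
    using that open_chart_ball by (cases j) (auto simp: good_ball_def)
  ultimately obtain J where "J \<subseteq> Collect good_ball" "finite J" "UNIV \<subseteq> (\<Union>j\<in>J. chart_ball j)"
    using compactE_image[OF compact_UNIV] by metis
  then show ?thesis using that by blast
qed

lemma Cr_functions_lipschitz:
  fixes \<phi> :: "'m \<Rightarrow> 'f::euclidean_space"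
  assumes "\<phi> \<in> Cr_functions r E A" "good_ball ((U, c), p, R)"
  obtains C where "C \<ge> 0" "\<And>x y. x \<in> chart_cball ((U, c), p, R) \<Longrightarrow> y \<in> chart_cball ((U, c), p, R) \<Longrightarrow>
    norm (\<phi> x - \<phi> y) \<le> C * norm (c x - c y)"
proof -
  have U: "(U, c) \<in> A" and sub: "E \<inter> cball p R \<subseteq> c ` U" using assms(2) by (auto simp: good_ball_def)
  obtain B where B: "finite B" "B \<subseteq> E" "\<And>b. b \<in> B \<Longrightarrow> norm b = 1"
    "\<And>x. x \<in> E \<Longrightarrow> (\<Sum>b\<in>B. (x \<bullet> b) *\<^sub>R b) = x"
    using subspace_orthonormal_basis[OF E] by metis
  let ?h = "\<lambda>y. \<phi> (inv_into U c y)"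
  let ?D = "\<lambda>y. frechet_derivative ?h (at y within c ` U)"
  note h = Cr_functions_chart[OF assms(1) U]
  have "\<exists>K\<ge>0. \<forall>z\<in>E \<inter> cball p R. norm (?D z b) \<le> K" if "b \<in> B" for b
  proof -
    have "Ck_on 1 E (c ` U) ?h" using r1 by (intro Cr_on_Ck[OF h]) (simp add: one_enat_def)
    then have "continuous_on (c ` U) (\<lambda>y. ?D y b)" using B(2) that by auto
    then have "compact ((\<lambda>y. ?D y b) ` (E \<inter> cball p R))"
      using sub closed_subspace[OF E] by (intro compact_continuous_image closed_Int_compact) (auto intro: continuous_on_subset)
    then obtain K where "\<forall>z\<in>E \<inter> cball p R. norm (?D z b) \<le> K"
      by (meson compact_imp_bounded bounded_iff imageI)
    then show ?thesis by (intro exI[of _ "max K 0"]) (auto simp: le_max_iff_disj)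
  qed
  then obtain K where K: "\<And>b. b \<in> B \<Longrightarrow> K b \<ge> 0 \<and> (\<forall>z\<in>E \<inter> cball p R. norm (?D z b) \<le> K b)" by metis
  have sumK: "norm (?D z b) \<le> sum K B" if "z \<in> E \<inter> cball p R" "b \<in> B" for z b
    using K that member_le_sum[of b B K] B(1) by force
  note lip = derivative_bound_imp_lipschitz[OF E chart(2)[OF U] sub _ B(2,3,4) Cr_on_has_derivative[OF h r1] sumK]
  show ?thesis
  proof (rule that)
    show "0 \<le> real (card B) * sum K B" using K by (simp add: sum_nonneg)
    fix x y assume xy: "x \<in> chart_cball ((U, c), p, R)" "y \<in> chart_cball ((U, c), p, R)"
    then have "c x \<in> E \<inter> cball p R" "c y \<in> E \<inter> cball p R" "x \<in> U" "y \<in> U"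
      using good_cball(1)[OF assms(2)] by (auto simp: chart_cball_def)
    then show "norm (\<phi> x - \<phi> y) \<le> real (card B) * sum K B * norm (c x - c y)"
      using lip[of "c x" "c y"] chart_inv(4)[OF U] by (simp add: convex_Int subspace_imp_convex[OF E])
  qed
qed

text \<open>The distance is a plain function, continuous for the manifold topology, so that the
  lemma applies both to \<open>dd\<close> and to \<open>\<rho>\<close>. The finite subcover uses
  balls of half the admissible radius; a nearby pair then stays within one full ball.\<close>

lemma lebesgue_number:
  fixes d :: "'m \<Rightarrow> 'm \<Rightarrow> real"
  assumes "\<And>x y. d x y = d y x" "\<And>x y z. d x z \<le> d x y + d y z" "\<And>x y. d x y \<ge> 0"
    and "\<And>x. d x x = 0" "\<And>x y. d x y = 0 \<Longrightarrow> x = y" "\<And>x. continuous_on UNIV (d x)"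
    and J: "\<And>j. j \<in> J \<Longrightarrow> open (W j)" "(\<Union>j\<in>J. W j) = (UNIV :: 'm set)"
  obtains \<delta> where "\<delta> > 0" "\<And>x y. d x y < \<delta> \<Longrightarrow> \<exists>j\<in>J. x \<in> W j \<and> y \<in> W j"
proof -
  have "\<exists>e j. e > 0 \<and> j \<in> J \<and> (\<forall>y. d x y < 2 * e \<longrightarrow> y \<in> W j)" for x
  proof -
    obtain j where j: "j \<in> J" "x \<in> W j" using J(2) by blast
    have "compact (- W j)" using J(1)[OF j(1)] compact_UNIV
      by (metis Compl_eq_Diff_UNIV compact_diff)
    show ?thesis
    proof (cases "W j = UNIV")
      case True
      then show ?thesis using j by (intro exI[of _ 1] exI[of _ j]) auto
    next
      case False
      then obtain z where z: "z \<in> - W j" "\<And>y. y \<in> - W j \<Longrightarrow> d x z \<le> d x y"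
        using continuous_attains_inf[OF \<open>compact (- W j)\<close> _ continuous_on_subset[OF assms(6)]] by blast
      then have "d x z > 0" using assms(3,5) j by (metis ComplD order_le_less)
      then show ?thesis using z(2) j by (intro exI[of _ "d x z / 2"] exI[of _ j]) (auto, fastforce)
    qed
  qed
  then obtain e k where ek: "\<And>x. e x > 0" "\<And>x. k x \<in> J" "\<And>x y. d x y < 2 * e x \<Longrightarrow> y \<in> W (k x)" by metis
  have op: "open {y. d x y < e x}" for x
    using open_Collect_less[OF assms(6)[of x] continuous_on_const] by simp
  have "UNIV \<subseteq> (\<Union>x. {y. d x y < e x})" using ek(1) assms(4) by auto
  then obtain X where X: "finite X" "UNIV \<subseteq> (\<Union>x\<in>X. {y. d x y < e x})"
    using compactE_image[OF compact_UNIV, of UNIV "\<lambda>x. {y. d x y < e x}"] op by metis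
  have Xne: "X \<noteq> {}" using X(2) by auto
  show ?thesis
  proof (rule that[of "Min (e ` X)"])
    show "Min (e ` X) > 0" using X(1) Xne ek(1) by simp
    fix x y assume xy: "d x y < Min (e ` X)"
    obtain z where z: "z \<in> X" "d z x < e z" using X(2) by blast
    have "Min (e ` X) \<le> e z" using X(1) z(1) by simp
    then have "d x y < e z" using xy by linarith
    then have "d z y < 2 * e z" using z(2) assms(2)[of z y x] by linarith
    moreover have "d z x < 2 * e z" using z(2) ek(1)[of z] by linarith
    ultimately show "\<exists>j\<in>J. x \<in> W j \<and> y \<in> W j" using ek(2,3) by blast
  qed
qed

text \<open>Each chart ball contributes a bump \<open>q\<close> and \<open>q\<close> times every
  coordinate. If all values at \<open>x\<close> and \<open>y\<close> agree, then \<open>y\<close>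
  lies in a chart around \<open>x\<close> because \<open>q\<close> is positive at \<open>x\<close>
  and 0 off the chart, and the coordinates agree as well. Quantitatively, the coordinates are
  recovered by dividing by \<open>q\<close>, which is bounded below on the smaller ball.\<close>

lemma bump_family:
  assumes J: "finite J" "\<And>j. j \<in> J \<Longrightarrow> good_ball j" "(\<Union>j\<in>J. chart_ball j) = UNIV"
  obtains n :: nat and f where "\<And>i. i < n \<Longrightarrow> f i \<in> Cr_functions r E A"
    "\<And>x y. (\<And>i. i < n \<Longrightarrow> f i x = f i y) \<Longrightarrow> x = y"
    "\<And>U c p R. ((U, c), p, R) \<in> J \<Longrightarrow> \<exists>C\<ge>0. \<forall>x\<in>chart_cball ((U, c), p, R). \<forall>y\<in>chart_cball ((U, c), p, R).
       norm (c x - c y) \<le> C * (\<Sum>i<n. \<bar>f i x - f i y\<bar>)"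
proof -
  define q where "q = (\<lambda>(p :: 'e, R) y. flat 0 ((2 * R)\<^sup>2 - (y - p) \<bullet> (y - p)))"
  define F :: "(('m, 'e) chart \<times> 'e \<times> real) \<times> 'e option \<Rightarrow> 'm \<Rightarrow> real" where
    "F = (\<lambda>(((U, c), pR), b) x. if x \<in> U then q pR (c x) * (case b of None \<Rightarrow> 1 | Some b \<Rightarrow> c x \<bullet> b) else 0)"
  define I where "I = J \<times> (insert None (Some ` (Basis :: 'e set)))"
  have "finite I" using J(1) by (simp add: I_def)
  then obtain h where h: "bij_betw h {0..<card I} I" using ex_bij_betw_nat_finite by blast
  let ?f = "\<lambda>i. F (h i)"
  have fin: "\<And>i. i < card I \<Longrightarrow> h i \<in> I" using h by (auto simp: bij_betw_def)
  have sum_eq: "(\<Sum>i<card I. \<bar>?f i x - ?f i y\<bar>) = (\<Sum>i\<in>I. \<bar>F i x - F i y\<bar>)" for x y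
    using sum.reindex_bij_betw[OF h, of "\<lambda>i. \<bar>F i x - F i y\<bar>"] by (simp add: atLeast0LessThan)
  have F_Cr: "F i \<in> Cr_functions r E A" if "i \<in> I" for i
  proof -
    obtain U c p R b where i: "i = (((U, c), p, R), b)" by (metis surj_pair)
    then have good: "good_ball ((U, c), p, R)" using that J(2) by (auto simp: I_def)
    then have U: "(U, c) \<in> A" "E \<inter> cball p (2 * R) \<subseteq> c ` U" "R > 0" by (auto simp: good_ball_def)
    note EU = E chart(2)[OF U(1)]
    let ?g = "\<lambda>y. q (p, R) y *\<^sub>R (case b of None \<Rightarrow> 1 | Some b \<Rightarrow> y \<bullet> b)"
    have lin: "Cr_on r E (c ` U) (\<lambda>y. case b of None \<Rightarrow> 1 | Some b \<Rightarrow> y \<bullet> b)"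
      by (cases b) (auto intro!: Cr_on_const[OF EU] Cr_on_linear[OF EU] bounded_linear_inner_left)
    have "Cr_on r E (c ` U) ?g"
      unfolding q_def prod.case by (intro Cr_on_scaleR[OF EU] Cr_on_bump[OF EU] lin)
    moreover have "?g y = 0" if "dist y p > 2 * R" for y
    proof -
      have "(2 * R)\<^sup>2 < (norm (y - p))\<^sup>2" using that U(3) by (intro power_strict_mono) (auto simp: dist_norm)
      then show ?thesis by (simp add: q_def flat_def power2_norm_eq_inner)
    qed
    ultimately have "(\<lambda>x. if x \<in> U then ?g (c x) else 0) \<in> Cr_functions r E A"
      using Cr_bump_extend[OF U(1,2)] by blast
    then show ?thesis unfolding F_def i real_scaleR_def prod.case .
  qed
  have low: "\<exists>C\<ge>0. \<forall>x\<in>chart_cball ((U, c), p, R). \<forall>y\<in>chart_cball ((U, c), p, R).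
       norm (c x - c y) \<le> C * (\<Sum>i\<in>I. \<bar>F i x - F i y\<bar>)" if j: "((U, c), p, R) \<in> J" for U c p R
  proof -
    have R: "R > 0" using J(2)[OF j] by (auto simp: good_ball_def)
    \<comment> \<open>On the ball of radius \<open>R\<close> the argument of the bump is at least
      \<open>(2 * R)\<^sup>2 - R\<^sup>2\<close>, which is \<open>3 * R\<^sup>2\<close>.\<close>
    define \<eta> where "\<eta> = flat 0 (3 * R\<^sup>2)"
    have eta: "\<eta> > 0" using R by (simp add: \<eta>_def flat_pos_iff)
    define M where "M = norm p + R"
    \<comment> \<open>\<open>M\<close> bounds \<open>norm (c y)\<close>. The product majorizes
      \<open>DIM('e) + M\<close>, the joint contribution of the weighted coordinates and of the bump
      itself.\<close>
    define C where "C = (M + 1) * (real DIM('e) + 1) / \<eta>"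
    have C: "C \<ge> 0" using eta R by (simp add: C_def M_def)
    have "norm (c x - c y) \<le> C * (\<Sum>i\<in>I. \<bar>F i x - F i y\<bar>)"
      if xy: "x \<in> chart_cball ((U, c), p, R)" "y \<in> chart_cball ((U, c), p, R)" for x y
    proof -
      let ?d = "\<Sum>i\<in>I. \<bar>F i x - F i y\<bar>" and ?a = "q (p, R) (c x)" and ?b = "q (p, R) (c y)"
      have xU: "x \<in> U" "y \<in> U" "dist (c x) p \<le> R" "dist (c y) p \<le> R" using xy by (auto simp: chart_cball_def)
      have mem: "\<bar>F (((U, c), p, R), b) x - F (((U, c), p, R), b) y\<bar> \<le> ?d" if "b \<in> insert None (Some ` Basis)" for b
        by (rule member_le_sum[of "(((U, c), p, R), b)" I "\<lambda>i. \<bar>F i x - F i y\<bar>"])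
          (use that j \<open>finite I\<close> in \<open>auto simp: I_def\<close>)
      have d0: "?d \<ge> 0" by (simp add: sum_nonneg)
      have 1: "\<bar>?a - ?b\<bar> \<le> ?d" using mem[of None] xU by (simp add: F_def)
      have "(norm (c x - p))\<^sup>2 \<le> R\<^sup>2" using xU by (intro power_mono) (auto simp: dist_norm)
      then have a: "?a \<ge> \<eta>" unfolding q_def \<eta>_def prod.case
        by (intro flat_0_mono) (simp add: power2_norm_eq_inner power_mult_distrib)
      have M: "norm (c y) \<le> M" using xU(4) norm_triangle_ineq[of p "c y - p"] by (simp add: dist_norm M_def)
      have 2: "norm (?a *\<^sub>R c x - ?b *\<^sub>R c y) \<le> real DIM('e) * ?d"
      proof -
        have "norm (?a *\<^sub>R c x - ?b *\<^sub>R c y) \<le> (\<Sum>b\<in>Basis. \<bar>(?a *\<^sub>R c x - ?b *\<^sub>R c y) \<bullet> b\<bar>)"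
          by (rule norm_le_l1)
        also have "\<dots> \<le> (\<Sum>b\<in>(Basis :: 'e set). ?d)"
        proof (rule sum_mono)
          fix b :: 'e assume "b \<in> Basis"
          then show "\<bar>(?a *\<^sub>R c x - ?b *\<^sub>R c y) \<bullet> b\<bar> \<le> ?d"
            using mem[of "Some b"] xU by (simp add: F_def inner_diff_left)
        qed
        finally show ?thesis by simp
      qed
      \<comment> \<open>Only differences of weighted coordinates and of weights are controlled by
        \<open>?d\<close>, so the coordinate difference is expressed through these two.\<close>
      have "?a *\<^sub>R (c x - c y) = (?a *\<^sub>R c x - ?b *\<^sub>R c y) + (?b - ?a) *\<^sub>R c y"
        by (simp add: algebra_simps)
      then have "norm (?a *\<^sub>R (c x - c y)) \<le> real DIM('e) * ?d + \<bar>?b - ?a\<bar> * norm (c y)"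
        using norm_triangle_le[of "?a *\<^sub>R c x - ?b *\<^sub>R c y" "(?b - ?a) *\<^sub>R c y"] 2 by (simp only: norm_scaleR)
      also have "\<bar>?b - ?a\<bar> * norm (c y) \<le> ?d * M"
        using 1 M d0 by (intro mult_mono) (auto simp: abs_minus_commute)
      finally have "?a * norm (c x - c y) \<le> (real DIM('e) + M) * ?d"
        using a eta by (simp only: norm_scaleR) (simp add: distrib_right mult.commute)
      moreover have "\<eta> * norm (c x - c y) \<le> ?a * norm (c x - c y)" using a by (intro mult_right_mono) auto
      moreover have "(real DIM('e) + M) * ?d \<le> ((M + 1) * (real DIM('e) + 1)) * ?d"
        using R by (intro mult_right_mono d0) (simp add: M_def algebra_simps)
      ultimately have "\<eta> * norm (c x - c y) \<le> ((M + 1) * (real DIM('e) + 1)) * ?d" by linarith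
      then show ?thesis using eta by (simp add: C_def field_simps)
    qed
    then show ?thesis using C by blast
  qed
  have inj: "x = y" if eq: "\<And>i. i \<in> I \<Longrightarrow> F i x = F i y" for x y
  proof -
    obtain j where j: "j \<in> J" "x \<in> chart_ball j" using J(3) by blast
    obtain U c p R where jj: "j = ((U, c), p, R)" by (metis surj_pair)
    have R: "R > 0" and U: "(U, c) \<in> A" using J(2)[OF j(1)] by (auto simp: good_ball_def jj)
    have xU: "x \<in> U" "dist (c x) p < R" using j by (auto simp: jj chart_ball_def)
    have "(norm (c x - p))\<^sup>2 < (2 * R)\<^sup>2" using xU R by (intro power_strict_mono) (auto simp: dist_norm)
    then have qx: "q (p, R) (c x) > 0" by (simp add: q_def flat_pos_iff power2_norm_eq_inner)
    have "F (j, None) x = F (j, None) y" using eq j by (simp add: I_def)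
    then have y: "y \<in> U" "q (p, R) (c y) = q (p, R) (c x)"
      using xU qx by (auto simp: F_def jj split: if_splits)
    have "c x \<bullet> b = c y \<bullet> b" if "b \<in> Basis" for b
    proof -
      have "F (j, Some b) x = F (j, Some b) y" using eq j that by (simp add: I_def)
      then show ?thesis using xU y qx by (auto simp: F_def jj)
    qed
    then have "c x = c y" by (rule euclidean_eqI)
    then show ?thesis using chart_inv(4)[OF U] xU y by metis
  qed
  show ?thesis
  proof (rule that[of "card I" ?f])
    fix x y assume "\<And>i. i < card I \<Longrightarrow> ?f i x = ?f i y"
    moreover have "\<exists>j<card I. i = h j" if "i \<in> I" for i
    proof -
      have "i \<in> h ` {0..<card I}" using h that by (simp add: bij_betw_def)
      then show ?thesis by auto
    qed
    ultimately have "F i x = F i y" if "i \<in> I" for i using that by metis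
    then show "x = y" by (rule inj)
  qed (use F_Cr fin low sum_eq in auto)
qed

end

section \<open>A fixed finite chart cover with an injective immersion into Euclidean space\<close>

locale cr_embedded = cr_manifold r E A
  for r :: enat and E :: "'e::euclidean_space set" and A :: "('m::t2_space, 'e) chart set" +
  fixes J :: "(('m, 'e) chart \<times> 'e \<times> real) set" and n :: nat and f :: "nat \<Rightarrow> 'm \<Rightarrow> real"
  assumes fin_J: "finite J"
    and good: "\<And>j. j \<in> J \<Longrightarrow> good_ball j"
    and cover: "(\<Union>j\<in>J. chart_ball j) = UNIV"
    and f_Cr: "\<And>i. i < n \<Longrightarrow> f i \<in> Cr_functions r E A"
    and f_inj: "\<And>x y. (\<And>i. i < n \<Longrightarrow> f i x = f i y) \<Longrightarrow> x = y"
    and f_low: "\<And>U c p R. ((U, c), p, R) \<in> J \<Longrightarrow> \<exists>C\<ge>0. \<forall>x\<in>chart_cball ((U, c), p, R). \<forall>y\<in>chart_cball ((U, c), p, R).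
       norm (c x - c y) \<le> C * (\<Sum>i<n. \<bar>f i x - f i y\<bar>)"
begin

definition dd :: "'m \<Rightarrow> 'm \<Rightarrow> real" where
  "dd x y = (\<Sum>i<n. \<bar>f i x - f i y\<bar>)"

lemma dd_commute: "dd x y = dd y x"
  by (simp add: dd_def abs_minus_commute)

lemma dd_triangle: "dd x z \<le> dd x y + dd y z"
  unfolding dd_def sum.distrib[symmetric] by (intro sum_mono) linarith

lemma dd_nonneg: "dd x y \<ge> 0"
  by (simp add: dd_def sum_nonneg)

lemma dd_self: "dd x x = 0"
  by (simp add: dd_def)

lemma dd_eq_0: "dd x y = 0 \<Longrightarrow> x = y"
  by (rule f_inj) (auto simp: dd_def sum_nonneg_eq_0_iff)

lemma continuous_on_f: "i < n \<Longrightarrow> continuous_on S (f i)"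
  using f_Cr by (rule Cr_functions_continuous)

lemma continuous_on_dd: "continuous_on S (dd x)"
  unfolding dd_def by (intro continuous_intros continuous_on_f) auto

lemma open_chart_ball_J: "j \<in> J \<Longrightarrow> open (chart_ball j)"
  using good[of j] open_chart_ball by (cases j) (auto simp: good_ball_def)

lemma lebesgue_number_J:
  assumes "\<And>x y. d x y = d y x" "\<And>x y z. d x z \<le> d x y + d y z" "\<And>x y. d x y \<ge> (0::real)"
    and "\<And>x. d x x = 0" "\<And>x y. d x y = 0 \<Longrightarrow> x = y" "\<And>x. continuous_on UNIV (d x)"
  obtains \<delta> where "\<delta> > 0" "\<And>x y. d x y < \<delta> \<Longrightarrow> \<exists>j\<in>J. x \<in> chart_ball j \<and> y \<in> chart_ball j"
  using lebesgue_number[OF assms open_chart_ball_J cover] by blast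

lemma dd_lebesgue:
  obtains \<delta> where "\<delta> > 0" "\<And>x y. dd x y < \<delta> \<Longrightarrow> \<exists>j\<in>J. x \<in> chart_ball j \<and> y \<in> chart_ball j"
  by (rule lebesgue_number_J[of dd])
    (auto intro: dd_commute dd_triangle dd_nonneg dd_self dd_eq_0 continuous_on_dd)

lemma dd_upper:
  assumes "((U, c), p, R) \<in> J"
  obtains C where "C \<ge> 0" "\<And>x y. x \<in> chart_cball ((U, c), p, R) \<Longrightarrow> y \<in> chart_cball ((U, c), p, R) \<Longrightarrow>
    dd x y \<le> C * norm (c x - c y)"
proof -
  have "\<exists>C\<ge>0. \<forall>x\<in>chart_cball ((U, c), p, R). \<forall>y\<in>chart_cball ((U, c), p, R).
      norm (f i x - f i y) \<le> C * norm (c x - c y)" if "i < n" for i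
    using Cr_functions_lipschitz[OF f_Cr[OF that] good[OF assms]] by metis
  then obtain C where C: "\<And>i. i < n \<Longrightarrow> C i \<ge> 0 \<and> (\<forall>x\<in>chart_cball ((U, c), p, R). \<forall>y\<in>chart_cball ((U, c), p, R).
      norm (f i x - f i y) \<le> C i * norm (c x - c y))" by metis
  show ?thesis
  proof (rule that[of "\<Sum>i<n. C i"])
    show "(\<Sum>i<n. C i) \<ge> 0" using C by (auto intro: sum_nonneg)
    fix x y assume "x \<in> chart_cball ((U, c), p, R)" "y \<in> chart_cball ((U, c), p, R)"
    then show "dd x y \<le> (\<Sum>i<n. C i) * norm (c x - c y)"
      unfolding dd_def sum_distrib_right using C by (intro sum_mono) auto
  qed
qed

lemma dd_lower:
  assumes "((U, c), p, R) \<in> J"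
  obtains C where "C \<ge> 0" "\<And>x y. x \<in> chart_cball ((U, c), p, R) \<Longrightarrow> y \<in> chart_cball ((U, c), p, R) \<Longrightarrow>
    norm (c x - c y) \<le> C * dd x y"
  using f_low[OF assms] by (auto simp: dd_def)

lemma chart_at:
  obtains U c p R where "((U, c), p, R) \<in> J" "(U, c) \<in> A" "x \<in> chart_ball ((U, c), p, R)" "x \<in> U"
    "x \<in> chart_cball ((U, c), p, R)"
proof -
  obtain j where j: "j \<in> J" "x \<in> chart_ball j" using cover by blast
  obtain U c p R where jj: "j = ((U, c), p, R)" by (metis surj_pair)
  show ?thesis using that[of U c p R] j jj good[OF j(1)] chart_ball_subset[of j]
    by (auto simp: good_ball_def chart_ball_def)
qed

end

section \<open>The Riemannian distance\<close>

text \<open>Velocities are derivatives within \<open>{a..b}\<close>. Restricting to the times spent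
  in an open set leaves the filter unchanged, so computations in a chart are legitimate.\<close>

lemma at_within_vimage_open:
  fixes \<gamma> :: "real \<Rightarrow> 'm::topological_space"
  assumes "continuous_on {a..b} \<gamma>" "open W" "t \<in> {a..b}" "\<gamma> t \<in> W"
  shows "at t within ({a..b} \<inter> \<gamma> -` W) = at t within {a..b}"
proof -
  have "openin (top_of_set {a..b}) ({a..b} \<inter> \<gamma> -` W)"
    using assms(1,2) by (rule continuous_openin_preimage_gen)
  then obtain O1 where O1: "open O1" "{a..b} \<inter> \<gamma> -` W = {a..b} \<inter> O1" by (auto simp: openin_open)
  moreover have "t \<in> {a..b} \<inter> \<gamma> -` W" using assms by simp
  ultimately show ?thesis by (intro at_within_nhd[of _ O1]) auto
qed

lemma vector_derivative_norm_le:
  fixes \<phi> :: "real \<Rightarrow> 'f::real_normed_vector"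
  assumes der: "(\<phi> has_vector_derivative v) (at 0)" and "d > 0"
    and le: "\<And>t. \<bar>t\<bar> < d \<Longrightarrow> norm (\<phi> t - \<phi> 0) \<le> K * \<bar>t\<bar>"
  shows "norm v \<le> K"
proof (rule field_le_epsilon)
  fix e :: real assume "e > 0"
  then obtain d' where d': "d' > 0" "\<And>y. \<bar>y\<bar> < d' \<Longrightarrow> norm (\<phi> y - \<phi> 0 - y *\<^sub>R v) \<le> e * \<bar>y\<bar>"
    using der unfolding has_vector_derivative_def has_derivative_at_alt by auto
  define t where "t = min d d' / 2"
  have t: "t > 0" "t < d" "t < d'" using d' \<open>d > 0\<close> by (auto simp: t_def)
  have "t * norm v = norm (t *\<^sub>R v)" using t by simp
  also have "\<dots> \<le> norm (\<phi> t - \<phi> 0) + norm (\<phi> t - \<phi> 0 - t *\<^sub>R v)"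
    using norm_triangle_ineq4[of "\<phi> t - \<phi> 0" "\<phi> t - \<phi> 0 - t *\<^sub>R v"] by simp
  also have "\<dots> \<le> K * t + e * t" using le[of t] d'(2)[of t] t by simp
  finally have "t * norm v \<le> t * (K + e)" by (simp add: algebra_simps)
  then show "norm v \<le> K + e" using t by simp
qed

lemma vector_derivative_norm_ge:
  fixes \<phi> :: "real \<Rightarrow> 'f::real_normed_vector"
  assumes der: "(\<phi> has_vector_derivative v) (at 0)" and "d > 0"
    and ge: "\<And>t. \<bar>t\<bar> < d \<Longrightarrow> K * \<bar>t\<bar> \<le> norm (\<phi> t - \<phi> 0)"
  shows "K \<le> norm v"
proof (rule field_le_epsilon)
  fix e :: real assume "e > 0"
  then obtain d' where d': "d' > 0" "\<And>y. \<bar>y\<bar> < d' \<Longrightarrow> norm (\<phi> y - \<phi> 0 - y *\<^sub>R v) \<le> e * \<bar>y\<bar>"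
    using der unfolding has_vector_derivative_def has_derivative_at_alt by auto
  define t where "t = min d d' / 2"
  have t: "t > 0" "t < d" "t < d'" using d' \<open>d > 0\<close> by (auto simp: t_def)
  have "K * t \<le> norm (\<phi> t - \<phi> 0)" using ge[of t] t by simp
  also have "\<dots> \<le> norm (\<phi> t - \<phi> 0 - t *\<^sub>R v) + norm (t *\<^sub>R v)"
    using norm_triangle_ineq[of "\<phi> t - \<phi> 0 - t *\<^sub>R v" "t *\<^sub>R v"] by simp
  also have "\<dots> \<le> e * t + t * norm v" using d'(2)[of t] t by simp
  finally have "t * K \<le> t * (norm v + e)" by (simp add: algebra_simps)
  then show "K \<le> norm v + e" using t by simp
qed

lemma vector_derivative_in_subspace:
  fixes \<phi> :: "real \<Rightarrow> 'e::euclidean_space"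
  assumes "subspace E" "a < b" "t \<in> {a..b}" "(\<phi> has_vector_derivative v) (at t within {a..b})"
    and T: "at t within T = at t within {a..b}" "t \<in> T" "\<And>s. s \<in> T \<Longrightarrow> \<phi> s \<in> E"
  shows "v \<in> E"
proof -
  obtain y z where yz: "y \<in> span E" "\<And>w. w \<in> span E \<Longrightarrow> orthogonal z w" "v = y + z"
    using orthogonal_subspace_decomp_exists[of E v] by metis
  have sE: "span E = E" using assms(1) by (simp add: span_eq_iff)
  have "((\<lambda>s. \<phi> s \<bullet> z) has_vector_derivative v \<bullet> z) (at t within {a..b})"
    using assms(4) unfolding has_vector_derivative_def by (auto intro!: derivative_eq_intros)
  moreover have "((\<lambda>s. \<phi> s \<bullet> z) has_vector_derivative 0) (at t within {a..b})"
  proof -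
    have "\<phi> s \<bullet> z = 0" if "s \<in> T" for s
      using yz(2)[of "\<phi> s"] T(3)[OF that] sE by (simp add: orthogonal_def inner_commute)
    then have "((\<lambda>s. \<phi> s \<bullet> z) has_vector_derivative 0) (at t within T)"
      using has_vector_derivative_weaken[OF has_vector_derivative_const[of 0], of t T T "\<lambda>s. \<phi> s \<bullet> z"] T(2) by auto
    then show ?thesis using T(1) by simp
  qed
  ultimately have "v \<bullet> z = 0"
    using vector_derivative_unique_within_closed_interval[of a b t] assms(2,3) by simp
  moreover have "y \<bullet> z = 0" using yz(1,2) by (simp add: orthogonal_def inner_commute)
  ultimately have "z = 0" using yz(3) by (simp add: inner_add_left)
  then show ?thesis using yz sE by simp
qed

text \<open>Induction on the number of partition points below \<open>q\<close>: the last of them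
  starts the final piece, and \<open>trans\<close> glues this piece to what precedes it.\<close>

lemma partition_chain:
  fixes P :: "real set"
  assumes P: "finite P" "0 \<in> P" "P \<subseteq> {0..1}" "q \<in> P" "0 < q"
    and step: "\<And>a b. a \<in> P \<Longrightarrow> b \<in> P \<Longrightarrow> a < b \<Longrightarrow> {a<..<b} \<inter> P = {} \<Longrightarrow> Q a b"
    and trans: "\<And>b c. 0 < b \<Longrightarrow> b < c \<Longrightarrow> Q 0 b \<Longrightarrow> Q b c \<Longrightarrow> Q 0 c"
  shows "Q 0 q"
  using P(4,5)
proof (induction "card {p \<in> P. p < q}" arbitrary: q rule: less_induct)
  case less
  let ?S = "{p \<in> P. p < q}"
  have S: "finite ?S" "?S \<noteq> {}" using P(1,2) less.prems by auto
  define a where "a = Max ?S"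
  have a: "a \<in> P" "a < q" using Max_in[OF S] by (auto simp: a_def)
  have gap: "{a<..<q} \<inter> P = {}"
    using Max_ge[OF S(1)] by (force simp: a_def)
  have Qaq: "Q a q" by (rule step[OF a(1) less.prems(1) a(2) gap])
  show ?case
  proof (cases "a = 0")
    case True
    then show ?thesis using Qaq by simp
  next
    case False
    then have "0 < a" using a P(3) by (auto simp: subset_eq order_less_le)
    have "{p \<in> P. p < a} \<subset> ?S" using a by auto
    then have "card {p \<in> P. p < a} < card ?S" using S(1) by (rule psubset_card_mono[rotated])
    from less.hyps[OF this a(1) \<open>0 < a\<close>] show ?thesis using trans[OF \<open>0 < a\<close> a(2) _ Qaq] by blast
  qed
qed

section \<open>Bounds for the metric tensor and for the speed of curves\<close>

locale cr_riemannian = cr_embedded r E A J n f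
  for r :: enat and E :: "'e::euclidean_space set" and A :: "('m::t2_space, 'e) chart set"
    and J n f +
  fixes g :: "('m, 'e) chart \<Rightarrow> 'm \<Rightarrow> 'e \<Rightarrow> 'e \<Rightarrow> real" and \<rho> :: "'m \<Rightarrow> 'm \<Rightarrow> real"
  assumes metric: "riemannian_metric E A g" and rho: "induced_distance A g \<rho>"
begin

lemma g_facts:
  assumes "(U, c) \<in> A" "x \<in> U"
  shows "\<And>u v w a. u \<in> E \<Longrightarrow> v \<in> E \<Longrightarrow> w \<in> E \<Longrightarrow> g (U, c) x (a *\<^sub>R u + v) w = a * g (U, c) x u w + g (U, c) x v w"
    "\<And>v w. v \<in> E \<Longrightarrow> w \<in> E \<Longrightarrow> g (U, c) x v w = g (U, c) x w v"
    "\<And>v. v \<in> E \<Longrightarrow> v \<noteq> 0 \<Longrightarrow> g (U, c) x v v > 0"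
proof -
  note m = metric[unfolded riemannian_metric_def, THEN conjunct1, THEN bspec, OF assms(1), unfolded prod.case,
      THEN conjunct1, THEN bspec, OF assms(2)]
  show "\<And>u v w a. u \<in> E \<Longrightarrow> v \<in> E \<Longrightarrow> w \<in> E \<Longrightarrow> g (U, c) x (a *\<^sub>R u + v) w = a * g (U, c) x u w + g (U, c) x v w"
    "\<And>v w. v \<in> E \<Longrightarrow> w \<in> E \<Longrightarrow> g (U, c) x v w = g (U, c) x w v"
    "\<And>v. v \<in> E \<Longrightarrow> v \<noteq> 0 \<Longrightarrow> g (U, c) x v v > 0"
    using m by blast+
qed

lemma g_continuous:
  assumes "(U, c) \<in> A" "v \<in> E" "w \<in> E"
  shows "continuous_on U (\<lambda>x. g (U, c) x v w)"
  using metric[unfolded riemannian_metric_def, THEN conjunct1, THEN bspec, OF assms(1), unfolded prod.case,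
      THEN conjunct2] assms(2,3) by blast

lemma g_transform:
  assumes "(U, c) \<in> A" "(V, d) \<in> A" "x \<in> U" "x \<in> V" "v \<in> E" "w \<in> E"
  shows "g (V, d) x (frechet_derivative (\<lambda>y. d (inv_into U c y)) (at (c x) within c ` (U \<inter> V)) v)
      (frechet_derivative (\<lambda>y. d (inv_into U c y)) (at (c x) within c ` (U \<inter> V)) w) = g (U, c) x v w"
  using metric[unfolded riemannian_metric_def, THEN conjunct2, THEN bspec, OF assms(1), unfolded prod.case,
      THEN bspec, OF assms(2), unfolded prod.case, THEN bspec, OF IntI[OF assms(3,4)],
      THEN bspec, OF assms(5), THEN bspec, OF assms(6)]
  by (simp add: Let_def o_def)

lemma g_scale:
  assumes "(U, c) \<in> A" "x \<in> U" "v \<in> E"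
  shows "g (U, c) x (a *\<^sub>R v) (a *\<^sub>R v) = a\<^sup>2 * g (U, c) x v v"
proof -
  note gf = g_facts[OF assms(1,2)]
  have z: "0 \<in> E" using E by (simp add: subspace_0)
  have "g (U, c) x 0 w = 0" if "w \<in> E" for w using gf(1)[of 0 0 w 1] z that by simp
  then have sc: "g (U, c) x (a *\<^sub>R v) w = a * g (U, c) x v w" if "w \<in> E" for w
    using gf(1)[of v 0 w a] z that assms(3) by simp
  have av: "a *\<^sub>R v \<in> E" using E assms(3) by (simp add: subspace_scale)
  then have "g (U, c) x (a *\<^sub>R v) (a *\<^sub>R v) = a * g (U, c) x (a *\<^sub>R v) v"
    using sc gf(2)[OF assms(3) av] by simp
  then show ?thesis using sc[OF assms(3)] by (simp add: power2_eq_square)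
qed

lemma g_nonneg:
  assumes "(U, c) \<in> A" "x \<in> U" "v \<in> E"
  shows "g (U, c) x v v \<ge> 0"
  using g_facts(3)[OF assms] g_scale[OF assms, of 0] by (cases "v = 0") auto

lemma g_lincomb:
  assumes "(U, c) \<in> A" "x \<in> U" "finite B" "B \<subseteq> E" "w \<in> E"
  shows "(\<Sum>b\<in>B. a b *\<^sub>R b) \<in> E \<and> g (U, c) x (\<Sum>b\<in>B. a b *\<^sub>R b) w = (\<Sum>b\<in>B. a b * g (U, c) x b w)"
  using assms(3,4)
proof (induction B rule: finite_induct)
  case empty
  have z: "0 \<in> E" using E by (simp add: subspace_0)
  then show ?case using g_facts(1)[OF assms(1,2), of 0 0 w 1] assms(5) by simp
next
  case (insert b B)
  then show ?case using g_facts(1)[OF assms(1,2), of b "\<Sum>b\<in>B. a b *\<^sub>R b" w "a b"] assms(5) E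
    by (simp add: subspace_add subspace_scale)
qed

text \<open>Continuity of the metric tensor is given for fixed vectors only; bilinearity reduces the
  joint dependence to finitely many components in a basis of \<open>E\<close>.\<close>

lemma g_joint_continuous:
  fixes x :: "'t::topological_space \<Rightarrow> 'm"
  assumes U: "(U, c) \<in> A" and x: "continuous_on T x" "x ` T \<subseteq> U" and w: "continuous_on T w" "w ` T \<subseteq> E"
  shows "continuous_on T (\<lambda>t. g (U, c) (x t) (w t) (w t))"
proof -
  obtain B where B: "finite B" "B \<subseteq> E" "\<And>x. x \<in> E \<Longrightarrow> (\<Sum>b\<in>B. (x \<bullet> b) *\<^sub>R b) = x"
    using subspace_orthonormal_basis[OF E] by metis
  have "g (U, c) (x t) (w t) (w t) = (\<Sum>b\<in>B. (w t \<bullet> b) * (\<Sum>b'\<in>B. (w t \<bullet> b') * g (U, c) (x t) b' b))"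
    if t: "t \<in> T" for t
  proof -
    have xt: "x t \<in> U" "w t \<in> E" using x w t by auto
    have lin: "g (U, c) (x t) (w t) v = (\<Sum>b\<in>B. (w t \<bullet> b) * g (U, c) (x t) b v)" if "v \<in> E" for v
      using g_lincomb[OF U xt(1) B(1,2) that, of "\<lambda>b. w t \<bullet> b"] B(3)[OF xt(2)] by simp
    have "g (U, c) (x t) (w t) (w t) = (\<Sum>b\<in>B. (w t \<bullet> b) * g (U, c) (x t) (w t) b)"
      unfolding lin[OF xt(2)] using g_facts(2)[OF U xt(1)] xt(2) B(2) by (intro sum.cong refl) auto
    then show ?thesis using lin B(2) by (auto intro!: sum.cong)
  qed
  moreover have "continuous_on T (\<lambda>t. \<Sum>b\<in>B. (w t \<bullet> b) * (\<Sum>b'\<in>B. (w t \<bullet> b') * g (U, c) (x t) b' b))"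
  proof (intro continuous_intros w)
    fix b b' assume "b \<in> B" "b' \<in> B"
    then show "continuous_on T (\<lambda>t. g (U, c) (x t) b' b)"
      using continuous_on_compose2[OF g_continuous[OF U] x] B(2) by blast
  qed
  ultimately show ?thesis by (simp cong: continuous_on_cong)
qed

text \<open>Compactness of the closed ball times the unit sphere of \<open>E\<close>, followed by
  homogeneity. In dimension 0 the sphere is empty and any constants serve.\<close>

lemma g_bounds:
  assumes j: "((U, c), p, R) \<in> J"
  obtains m M where "m > 0" "M \<ge> 0"
    "\<And>x w. x \<in> chart_cball ((U, c), p, R) \<Longrightarrow> w \<in> E \<Longrightarrow> m * norm w \<le> sqrt (g (U, c) x w w)"
    "\<And>x w. x \<in> chart_cball ((U, c), p, R) \<Longrightarrow> w \<in> E \<Longrightarrow> sqrt (g (U, c) x w w) \<le> M * norm w"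
proof -
  have U: "(U, c) \<in> A" using good[OF j] by (auto simp: good_ball_def)
  let ?K = "chart_cball ((U, c), p, R)" and ?S = "E \<inter> sphere 0 1"
  have KU: "?K \<subseteq> U" by (auto simp: chart_cball_def)
  have cpt: "compact (?K \<times> ?S)"
    using good_cball(2)[OF good[OF j]] closed_subspace[OF E] by (intro compact_Times closed_Int_compact) auto
  have cont: "continuous_on (?K \<times> ?S) (\<lambda>z. sqrt (g (U, c) (fst z) (snd z) (snd z)))"
    using KU by (intro continuous_intros g_joint_continuous[OF U]) (auto intro!: continuous_intros)
  have "\<exists>m M. m > 0 \<and> M \<ge> 0 \<and> (\<forall>x\<in>?K. \<forall>w\<in>?S. m \<le> sqrt (g (U, c) x w w) \<and> sqrt (g (U, c) x w w) \<le> M)"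
  proof (cases "?K \<times> ?S = {}")
    case True
    then show ?thesis by (intro exI[of _ 1]) auto
  next
    case False
    obtain z where z: "z \<in> ?K \<times> ?S" "\<forall>z'\<in>?K \<times> ?S. sqrt (g (U, c) (fst z) (snd z) (snd z)) \<le> sqrt (g (U, c) (fst z') (snd z') (snd z'))"
      using continuous_attains_inf[OF cpt False cont] by blast
    obtain y where y: "y \<in> ?K \<times> ?S" "\<forall>z'\<in>?K \<times> ?S. sqrt (g (U, c) (fst z') (snd z') (snd z')) \<le> sqrt (g (U, c) (fst y) (snd y) (snd y))"
      using continuous_attains_sup[OF cpt False cont] by blast
    have "snd z \<noteq> 0" using z(1) by auto
    then have "g (U, c) (fst z) (snd z) (snd z) > 0" using z(1) KU by (intro g_facts(3)[OF U]) auto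
    moreover have "g (U, c) (fst y) (snd y) (snd y) \<ge> 0" using y(1) KU by (intro g_nonneg[OF U]) auto
    ultimately show ?thesis using z(2) y(2)
      by (intro exI[of _ "sqrt (g (U, c) (fst z) (snd z) (snd z))"] exI[of _ "sqrt (g (U, c) (fst y) (snd y) (snd y))"]) auto
  qed
  then obtain m M where mM: "m > 0" "M \<ge> 0"
    "\<And>x w. x \<in> ?K \<Longrightarrow> w \<in> ?S \<Longrightarrow> m \<le> sqrt (g (U, c) x w w) \<and> sqrt (g (U, c) x w w) \<le> M" by blast
  have "m * norm w \<le> sqrt (g (U, c) x w w) \<and> sqrt (g (U, c) x w w) \<le> M * norm w"
    if x: "x \<in> ?K" and w: "w \<in> E" for x w
  proof (cases "w = 0")
    case True
    then show ?thesis using g_scale[OF U _ w, of x 0] x KU by auto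
  next
    case False
    let ?u = "(1 / norm w) *\<^sub>R w"
    have u: "?u \<in> ?S" using False w E by (simp add: subspace_scale)
    have "w = norm w *\<^sub>R ?u" using False by simp
    then have "g (U, c) x w w = (norm w)\<^sup>2 * g (U, c) x ?u ?u"
      using g_scale[OF U, of x ?u "norm w"] x KU u by auto
    then have "sqrt (g (U, c) x w w) = norm w * sqrt (g (U, c) x ?u ?u)"
      by (simp only: real_sqrt_mult real_sqrt_abs abs_norm_cancel)
    moreover have "norm w * m \<le> norm w * sqrt (g (U, c) x ?u ?u)" "norm w * sqrt (g (U, c) x ?u ?u) \<le> norm w * M"
      using mM(3)[OF x u] by (auto intro: mult_left_mono)
    ultimately show ?thesis by (simp add: mult.commute)
  qed
  then show ?thesis using that mM(1,2) by blast
qed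

text \<open>Variant of \<open>curve_speed\<close> with the derivative taken within the piece. It is
  continuous up to the endpoints of a piece, where the two-sided derivative may fail to
  exist.\<close>

definition piece_speed :: "real \<Rightarrow> real \<Rightarrow> (real \<Rightarrow> 'm) \<Rightarrow> real \<Rightarrow> real" where
  "piece_speed a b \<gamma> t = (let p = (SOME p. p \<in> A \<and> \<gamma> t \<in> fst p);
     v = vector_derivative (snd p \<circ> \<gamma>) (at t within {a..b}) in sqrt (g p (\<gamma> t) v v))"

lemma velocity_change:
  assumes ab: "a < b" "t \<in> {a..b}" and cont: "continuous_on {a..b} \<gamma>"
    and U: "(U, c) \<in> A" "\<gamma> t \<in> U" and V: "(V, d) \<in> A" "\<gamma> t \<in> V"
    and der: "((\<lambda>s. c (\<gamma> s)) has_vector_derivative v) (at t within {a..b})"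
  shows "v \<in> E" "((\<lambda>s. d (\<gamma> s)) has_vector_derivative
     frechet_derivative (\<lambda>y. d (inv_into U c y)) (at (c (\<gamma> t)) within c ` (U \<inter> V)) v) (at t within {a..b})"
proof -
  let ?T = "{a..b} \<inter> \<gamma> -` (U \<inter> V)" and ?h = "\<lambda>y. d (inv_into U c y)"
  let ?D = "frechet_derivative ?h (at (c (\<gamma> t)) within c ` (U \<inter> V))"
  have op: "open (U \<inter> V)" using chart(1) U V by blast
  have T: "at t within ?T = at t within {a..b}"
    using at_within_vimage_open[OF cont op ab(2)] U V by blast
  show "v \<in> E"
    by (rule vector_derivative_in_subspace[OF E ab der T]) (use U V ab chart_inv(5)[OF U(1)] in auto)
  have h: "(?h has_derivative ?D) (at (c (\<gamma> t)) within c ` (U \<inter> V))"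
    using Cr_on_has_derivative[OF Cr_transition[OF U(1) V(1)] r1] U V by blast
  have "((\<lambda>s. c (\<gamma> s)) has_derivative (\<lambda>s. s *\<^sub>R v)) (at t within ?T)"
    using der T by (simp add: has_vector_derivative_def)
  moreover have "(?h has_derivative ?D) (at (c (\<gamma> t)) within (\<lambda>s. c (\<gamma> s)) ` ?T)"
    by (rule has_derivative_subset[OF h]) auto
  ultimately have "((\<lambda>s. ?h (c (\<gamma> s))) has_derivative (\<lambda>s. ?D (s *\<^sub>R v))) (at t within ?T)"
    using diff_chain_within by (fastforce simp: o_def)
  moreover have "?D (s *\<^sub>R v) = s *\<^sub>R ?D v" for s
    using has_derivative_linear[OF h] by (rule linear_scale)
  ultimately have "((\<lambda>s. ?h (c (\<gamma> s))) has_vector_derivative ?D v) (at t within ?T)"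
    by (simp add: has_vector_derivative_def)
  then have "((\<lambda>s. d (\<gamma> s)) has_vector_derivative ?D v) (at t within ?T)"
    by (rule has_vector_derivative_weaken) (use ab U V chart_inv(4)[OF U(1)] in auto)
  then show "((\<lambda>s. d (\<gamma> s)) has_vector_derivative ?D v) (at t within {a..b})" using T by simp
qed

lemma C1_curve_velocity:
  assumes "C1_curve_on A a b \<gamma>" "(U, c) \<in> A" "t \<in> {a..b}" "\<gamma> t \<in> U"
  shows "((\<lambda>s. c (\<gamma> s)) has_vector_derivative vector_derivative (\<lambda>s. c (\<gamma> s)) (at t within {a..b})) (at t within {a..b})"
  using assms(1)[unfolded C1_curve_on_def, THEN conjunct2, THEN bspec, OF assms(2), unfolded prod.case,
      THEN conjunct1, THEN bspec, of t] assms(3,4)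
  by (simp add: o_def vector_derivative_works)

text \<open>The chart selected by choice in the definition is exchanged for a convenient one: the
  transformation law cancels the change of coordinates of the velocity.\<close>

lemma piece_speed_eq:
  assumes ab: "a < b" "t \<in> {a..b}" and \<gamma>: "continuous_on {a..b} \<gamma>"
    and U: "(U, c) \<in> A" "\<gamma> t \<in> U"
    and der: "((\<lambda>s. c (\<gamma> s)) has_vector_derivative v) (at t within {a..b})"
  shows "piece_speed a b \<gamma> t = sqrt (g (U, c) (\<gamma> t) v v)"
proof -
  define q where "q = (SOME q. q \<in> A \<and> \<gamma> t \<in> fst q)"
  have "q \<in> A \<and> \<gamma> t \<in> fst q"
    unfolding q_def by (rule someI[of _ "(U, c)"]) (use U in auto)
  then obtain V d where q: "q = (V, d)" "(V, d) \<in> A" "\<gamma> t \<in> V" by (metis prod.collapse)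
  let ?D = "frechet_derivative (\<lambda>y. d (inv_into U c y)) (at (c (\<gamma> t)) within c ` (U \<inter> V))"
  note vc = velocity_change[OF ab \<gamma> U q(2,3) der]
  have "vector_derivative (\<lambda>s. d (\<gamma> s)) (at t within {a..b}) = ?D v"
    using vector_derivative_within_cbox[of a b t] vc(2) ab by simp
  then show ?thesis
    using g_transform[OF U(1) q(2) U(2) q(3) vc(1) vc(1)]
    by (simp add: piece_speed_def q_def[symmetric] q(1) Let_def o_def)
qed

lemma piece_speed_continuous:
  assumes ab: "a < b" and \<gamma>: "C1_curve_on A a b \<gamma>"
  shows "continuous_on {a..b} (piece_speed a b \<gamma>)"
proof -
  have cont: "continuous_on {a..b} \<gamma>" using \<gamma> by (simp add: C1_curve_on_def)
  have "continuous (at t within {a..b}) (piece_speed a b \<gamma>)" if t: "t \<in> {a..b}" for t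
  proof -
    obtain U c where U: "(U, c) \<in> A" "\<gamma> t \<in> U" using charts_cover by blast
    let ?T = "{a..b} \<inter> \<gamma> -` U"
    let ?v = "\<lambda>t. vector_derivative (\<lambda>s. c (\<gamma> s)) (at t within {a..b})"
    have v: "continuous_on ?T ?v" 
      using \<gamma>[unfolded C1_curve_on_def, THEN conjunct2, THEN bspec, OF U(1), unfolded prod.case, THEN conjunct2]
      by (simp add: o_def)
    have vE: "?v s \<in> E" if "s \<in> ?T" for s
      using velocity_change(1)[OF ab _ cont U(1) _ U(1) _ C1_curve_velocity[OF \<gamma> U(1)]] that by auto
    have eq: "piece_speed a b \<gamma> s = sqrt (g (U, c) (\<gamma> s) (?v s) (?v s))" if "s \<in> ?T" for s
      using piece_speed_eq[OF ab _ cont U(1) _ C1_curve_velocity[OF \<gamma> U(1)]] that by auto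
    have "continuous_on ?T (\<lambda>s. sqrt (g (U, c) (\<gamma> s) (?v s) (?v s)))"
      using vE by (intro continuous_intros g_joint_continuous[OF U(1)] v continuous_on_subset[OF cont]) auto
    then have "continuous_on ?T (piece_speed a b \<gamma>)" by (rule continuous_on_eq) (simp add: eq)
    moreover have "at t within ?T = at t within {a..b}"
      using at_within_vimage_open[OF cont chart(1)[OF U(1)] t U(2)] .
    moreover have "t \<in> ?T" using t U by simp
    ultimately show ?thesis by (metis continuous_on_eq_continuous_within)
  qed
  then show ?thesis by (simp add: continuous_on_eq_continuous_within)
qed

lemma piece_speed_nonneg:
  assumes ab: "a < b" and \<gamma>: "C1_curve_on A a b \<gamma>" and t: "t \<in> {a..b}"
  shows "piece_speed a b \<gamma> t \<ge> 0"
proof -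
  have cont: "continuous_on {a..b} \<gamma>" using \<gamma> by (simp add: C1_curve_on_def)
  obtain U c where U: "(U, c) \<in> A" "\<gamma> t \<in> U" using charts_cover by blast
  note vel = C1_curve_velocity[OF \<gamma> U(1) t U(2)]
  show ?thesis
    using piece_speed_eq[OF ab t cont U vel] velocity_change(1)[OF ab t cont U U vel] g_nonneg[OF U] by simp
qed

lemma curve_speed_eq:
  assumes "t \<in> {a<..<b}"
  shows "curve_speed A g \<gamma> t = piece_speed a b \<gamma> t"
proof -
  have "at t within {a..b} = at t" using assms by (intro at_within_interior) auto
  then show ?thesis by (simp add: curve_speed_def piece_speed_def)
qed

lemma curve_speed_integral_piece:
  assumes ab: "a < b" and \<gamma>: "C1_curve_on A a b \<gamma>"
  shows "(curve_speed A g \<gamma> has_integral integral {a..b} (piece_speed a b \<gamma>)) {a..b}"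
proof -
  have "(piece_speed a b \<gamma> has_integral integral {a..b} (piece_speed a b \<gamma>)) {a..b}"
    using piece_speed_continuous[OF ab \<gamma>] by (simp add: integrable_continuous_real integrable_integral)
  then show ?thesis
    by (rule has_integral_spike_finite[of "{a, b}", rotated 2]) (use curve_speed_eq in auto)
qed

text \<open>Compactness gives the constant in the finitely many chart balls, and the speed may be computed in any
  chart.\<close>

lemma speed_dominates:
  fixes h :: "'m \<Rightarrow> 'f::euclidean_space"
  assumes h: "h \<in> Cr_functions r E A"
  obtains C where "C > 0" "\<And>a b \<gamma> t. a < b \<Longrightarrow> C1_curve_on A a b \<gamma> \<Longrightarrow> t \<in> {a<..<b} \<Longrightarrow>
    \<exists>v. ((\<lambda>s. h (\<gamma> s)) has_vector_derivative v) (at t) \<and> norm v \<le> C * piece_speed a b \<gamma> t"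
proof -
  have "\<exists>C\<ge>0. \<forall>x\<in>chart_ball ((U, c), p, R). \<forall>w\<in>E.
      norm (frechet_derivative (\<lambda>y. h (inv_into U c y)) (at (c x) within c ` U) w) \<le> C * sqrt (g (U, c) x w w)"
    if j: "((U, c), p, R) \<in> J" for U c p R
  proof -
    have U: "(U, c) \<in> A" using good[OF j] by (auto simp: good_ball_def)
    obtain C where C: "C \<ge> 0" "\<And>x y. x \<in> chart_cball ((U, c), p, R) \<Longrightarrow> y \<in> chart_cball ((U, c), p, R) \<Longrightarrow>
      norm (h x - h y) \<le> C * norm (c x - c y)" using Cr_functions_lipschitz[OF h good[OF j]] by blast
    obtain m M where m: "m > 0" "M \<ge> 0"
      "\<And>x w. x \<in> chart_cball ((U, c), p, R) \<Longrightarrow> w \<in> E \<Longrightarrow> m * norm w \<le> sqrt (g (U, c) x w w)"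
      "\<And>x w. x \<in> chart_cball ((U, c), p, R) \<Longrightarrow> w \<in> E \<Longrightarrow> sqrt (g (U, c) x w w) \<le> M * norm w"
      using g_bounds[OF j] by metis
    \<comment> \<open>The Lipschitz constant \<open>C\<close> in coordinates bounds the derivative
      by \<open>C * norm w\<close>, and \<open>m\<close> converts the Euclidean norm of
      \<open>w\<close> into the metric one.\<close>
    have "norm (frechet_derivative (\<lambda>y. h (inv_into U c y)) (at (c x) within c ` U) w) \<le> C / m * sqrt (g (U, c) x w w)"
      if x: "x \<in> chart_ball ((U, c), p, R)" and w: "w \<in> E" for x w
    proof -
      have xU: "x \<in> U" using x by (auto simp: chart_ball_def)
      have bU: "chart_ball ((U, c), p, R) \<subseteq> U" by (auto simp: chart_ball_def)
      have op: "openin (top_of_set E) (c ` chart_ball ((U, c), p, R))"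
        using openin_chart_image[OF U open_chart_ball[OF U] bU] .
      obtain d where d: "d > 0" "\<And>t. \<bar>t\<bar> < d \<Longrightarrow> c x + t *\<^sub>R w \<in> c ` chart_ball ((U, c), p, R)"
        using openin_subspace_line[OF E op _ w, of "c x"] x by blast
      have "((\<lambda>t. h (inv_into U c (c x + t *\<^sub>R w))) has_vector_derivative
          frechet_derivative (\<lambda>y. h (inv_into U c y)) (at (c x) within c ` U) w) (at 0)"
        using has_derivative_along_line[OF E chart(2)[OF U] _ w Cr_on_has_derivative[OF Cr_functions_chart[OF h U] r1]] xU by blast
      then have "norm (frechet_derivative (\<lambda>y. h (inv_into U c y)) (at (c x) within c ` U) w) \<le> C * norm w"
      proof (rule vector_derivative_norm_le[OF _ d(1)])
        fix t assume "\<bar>t\<bar> < d"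
        then obtain z where z: "z \<in> chart_ball ((U, c), p, R)" "c x + t *\<^sub>R w = c z" using d(2) by blast
        then have "norm (h z - h x) \<le> C * norm (c z - c x)"
          using C(2) x chart_ball_subset by blast
        moreover have "c z - c x = t *\<^sub>R w" using z(2) by (simp add: algebra_simps)
        moreover have "inv_into U c (c z) = z" "inv_into U c (c x) = x" using chart_inv(4)[OF U] z(1) bU xU by auto
        ultimately show "norm (h (inv_into U c (c x + t *\<^sub>R w)) - h (inv_into U c (c x + 0 *\<^sub>R w))) \<le> C * norm w * \<bar>t\<bar>"
          using z(2) by (simp add: mult_ac)
      qed
      also have "\<dots> \<le> C * (sqrt (g (U, c) x w w) / m)"
        using C(1) m(1) m(3)[OF subsetD[OF chart_ball_subset x] w] by (intro mult_left_mono) (auto simp: field_simps)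
      finally show ?thesis by simp
    qed
    then show ?thesis using C(1) m(1) by (intro exI[of _ "C / m"]) auto
  qed
  then have "\<forall>j\<in>J. \<exists>C\<ge>0. case j of ((U, c), p, R) \<Rightarrow> \<forall>x\<in>chart_ball ((U, c), p, R). \<forall>w\<in>E.
      norm (frechet_derivative (\<lambda>y. h (inv_into U c y)) (at (c x) within c ` U) w) \<le> C * sqrt (g (U, c) x w w)"
    by auto
  then obtain C where C: "\<And>j. j \<in> J \<Longrightarrow> C j \<ge> 0" "\<And>U c p R x w. ((U, c), p, R) \<in> J \<Longrightarrow> x \<in> chart_ball ((U, c), p, R) \<Longrightarrow> w \<in> E \<Longrightarrow>
      norm (frechet_derivative (\<lambda>y. h (inv_into U c y)) (at (c x) within c ` U) w) \<le> C ((U, c), p, R) * sqrt (g (U, c) x w w)"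
    by (fastforce dest: bchoice)
  show ?thesis
  \<comment> \<open>The summand 1 makes the constant positive, so that lengths can later be
    estimated by dividing by it.\<close>
  proof (rule that[of "sum C J + 1"])
    show "sum C J + 1 > 0" using C(1) by (simp add: sum_nonneg add_nonneg_pos)
    fix a b :: real and \<gamma> :: "real \<Rightarrow> 'm" and t assume ab: "a < b" and \<gamma>: "C1_curve_on A a b \<gamma>" and t: "t \<in> {a<..<b}"
    have cont: "continuous_on {a..b} \<gamma>" using \<gamma> by (simp add: C1_curve_on_def)
    obtain U c p R where j: "((U, c), p, R) \<in> J" "(U, c) \<in> A" "\<gamma> t \<in> chart_ball ((U, c), p, R)" "\<gamma> t \<in> U"
      using chart_at[of "\<gamma> t"] by metis
    have t': "t \<in> {a..b}" using t by auto
    define v where "v = vector_derivative (\<lambda>s. c (\<gamma> s)) (at t within {a..b})"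
    have vel: "((\<lambda>s. c (\<gamma> s)) has_vector_derivative v) (at t within {a..b})"
      unfolding v_def by (rule C1_curve_velocity[OF \<gamma> j(2) t' j(4)])
    have vE: "v \<in> E" by (rule velocity_change(1)[OF ab t' cont j(2,4) j(2,4) vel])
    let ?h = "\<lambda>y. h (inv_into U c y)"
    let ?D = "frechet_derivative ?h (at (c (\<gamma> t)) within c ` U)" and ?T = "{a..b} \<inter> \<gamma> -` U"
    have T: "at t within ?T = at t within {a..b}"
      using at_within_vimage_open[OF cont chart(1)[OF j(2)] t' j(4)] .
    have hd: "(?h has_derivative ?D) (at (c (\<gamma> t)) within c ` U)"
      using Cr_on_has_derivative[OF Cr_functions_chart[OF h j(2)] r1] j(4) by blast
    have "((\<lambda>s. c (\<gamma> s)) has_derivative (\<lambda>s. s *\<^sub>R v)) (at t within ?T)"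
      using vel T by (simp add: has_vector_derivative_def)
    moreover have "(?h has_derivative ?D) (at (c (\<gamma> t)) within (\<lambda>s. c (\<gamma> s)) ` ?T)"
      by (rule has_derivative_subset[OF hd]) auto
    ultimately have "((\<lambda>s. ?h (c (\<gamma> s))) has_derivative (\<lambda>s. ?D (s *\<^sub>R v))) (at t within ?T)"
      using diff_chain_within by (fastforce simp: o_def)
    moreover have "?D (s *\<^sub>R v) = s *\<^sub>R ?D v" for s
      using has_derivative_linear[OF hd] by (rule linear_scale)
    ultimately have "((\<lambda>s. ?h (c (\<gamma> s))) has_vector_derivative ?D v) (at t within ?T)"
      by (simp add: has_vector_derivative_def)
    then have "((\<lambda>s. h (\<gamma> s)) has_vector_derivative ?D v) (at t within ?T)"
      by (rule has_vector_derivative_weaken) (use t' j chart_inv(4)[OF j(2)] in auto)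
    moreover have "at t within {a..b} = at t" using t by (intro at_within_interior) auto
    ultimately have 1: "((\<lambda>s. h (\<gamma> s)) has_vector_derivative ?D v) (at t)" using T by simp
    have sp: "piece_speed a b \<gamma> t = sqrt (g (U, c) (\<gamma> t) v v)"
      by (rule piece_speed_eq[OF ab t' cont j(2,4) vel])
    have "norm (?D v) \<le> C ((U, c), p, R) * piece_speed a b \<gamma> t"
      using C(2)[OF j(1,3) vE] sp by simp
    also have "\<dots> \<le> (sum C J + 1) * piece_speed a b \<gamma> t"
      using member_le_sum[OF j(1), of C] C(1) fin_J piece_speed_nonneg[OF ab \<gamma> t']
      by (intro mult_right_mono) fastforce+
    finally show "\<exists>v. ((\<lambda>s. h (\<gamma> s)) has_vector_derivative v) (at t) \<and> norm v \<le> (sum C J + 1) * piece_speed a b \<gamma> t"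
      using 1 by blast
  qed
qed

text \<open>On each piece the fundamental theorem of calculus bounds the increment of
  \<open>h\<close> by the integral of the speed; \<open>partition_chain\<close> adds the
  pieces.\<close>

lemma curve_length_bound:
  fixes h :: "'m \<Rightarrow> 'f::euclidean_space"
  assumes h: "h \<in> Cr_functions r E A"
  obtains C where "C > 0" "\<And>\<gamma>. piecewise_C1_curve A \<gamma> \<Longrightarrow> norm (h (\<gamma> 1) - h (\<gamma> 0)) \<le> C * curve_length A g \<gamma>"
proof -
  obtain C where C: "C > 0" "\<And>a b \<gamma> t. a < b \<Longrightarrow> C1_curve_on A a b \<gamma> \<Longrightarrow> t \<in> {a<..<b} \<Longrightarrow>
    \<exists>v. ((\<lambda>s. h (\<gamma> s)) has_vector_derivative v) (at t) \<and> norm v \<le> C * piece_speed a b \<gamma> t"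
    using speed_dominates[OF h] by blast
  have "norm (h (\<gamma> 1) - h (\<gamma> 0)) \<le> C * curve_length A g \<gamma>" if pw: "piecewise_C1_curve A \<gamma>" for \<gamma>
  proof -
    \<comment> \<open>Integrability is carried along because \<open>integral\<close> is 0 on
      functions that are not integrable, and adjacent integrals add up only for integrable
      ones.\<close>
    define Q where "Q a b \<longleftrightarrow> curve_speed A g \<gamma> integrable_on {a..b} \<and>
      norm (h (\<gamma> b) - h (\<gamma> a)) \<le> C * integral {a..b} (curve_speed A g \<gamma>)" for a b
    have step: "Q a b" if ab: "a < b" and \<gamma>: "C1_curve_on A a b \<gamma>" for a b
    proof -
      let ?s = "piece_speed a b \<gamma>"
      note int = curve_speed_integral_piece[OF ab \<gamma>]
      have cont: "continuous_on {a..b} \<gamma>" using \<gamma> by (simp add: C1_curve_on_def)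
      \<comment> \<open>At the endpoints no two-sided derivative is available; the value 0 there
        still obeys the bound by the nonnegative speed.\<close>
      define v where "v t = (if t \<in> {a<..<b} then vector_derivative (\<lambda>s. h (\<gamma> s)) (at t) else 0)" for t
      have v: "((\<lambda>s. h (\<gamma> s)) has_vector_derivative v t) (at t)" "norm (v t) \<le> C * ?s t" if t: "t \<in> {a<..<b}" for t
        using C(2)[OF ab \<gamma> t] t vector_derivative_at by (auto simp: v_def)
      have vb: "norm (v t) \<le> C * ?s t" if t: "t \<in> {a..b}" for t
        using v(2)[of t] piece_speed_nonneg[OF ab \<gamma> t] C(1) by (cases "t \<in> {a<..<b}") (auto simp: v_def)
      have vi: "(v has_integral (h (\<gamma> b) - h (\<gamma> a))) {a..b}"
        using ab v(1) by (intro fundamental_theorem_of_calculus_interior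
            continuous_on_compose2[OF Cr_functions_continuous[OF h] cont]) auto
      have si: "?s integrable_on {a..b}"
        using piece_speed_continuous[OF ab \<gamma>] by (rule integrable_continuous_real)
      have "norm (integral {a..b} v) \<le> integral {a..b} (\<lambda>t. C * ?s t)"
        using vi si vb by (intro integral_norm_bound_integral) (auto intro: integrable_on_mult_right)
      then have "norm (h (\<gamma> b) - h (\<gamma> a)) \<le> C * integral {a..b} ?s"
        using vi by (simp add: integral_unique)
      then show ?thesis using int by (auto simp: Q_def integral_unique)
    qed
    obtain P where P: "finite P" "{0, 1} \<subseteq> P" "P \<subseteq> {0..1}"
      and P4: "\<forall>a\<in>P. \<forall>b\<in>P. a < b \<and> {a<..<b} \<inter> P = {} \<longrightarrow> C1_curve_on A a b \<gamma>"
      using pw unfolding piecewise_C1_curve_def by metis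
    have "Q 0 1"
    proof (rule partition_chain[of P])
      fix b c' :: real assume bc: "0 < b" "b < c'" "Q 0 b" "Q b c'"
      have "curve_speed A g \<gamma> integrable_on {0..c'}"
        using bc by (intro Henstock_Kurzweil_Integration.integrable_combine[of 0 b c']) (auto simp: Q_def)
      moreover have "norm (h (\<gamma> c') - h (\<gamma> 0)) \<le> norm (h (\<gamma> c') - h (\<gamma> b)) + norm (h (\<gamma> b) - h (\<gamma> 0))"
        using norm_triangle_ineq[of "h (\<gamma> c') - h (\<gamma> b)" "h (\<gamma> b) - h (\<gamma> 0)"] by simp
      moreover have "integral {0..c'} (curve_speed A g \<gamma>) = integral {0..b} (curve_speed A g \<gamma>) + integral {b..c'} (curve_speed A g \<gamma>)"
        using bc calculation(1) Henstock_Kurzweil_Integration.integral_combine[of 0 b c' "curve_speed A g \<gamma>"] by simp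
      ultimately show "Q 0 c'" using bc(3,4) by (simp add: Q_def distrib_left)
    qed (use P P4 step in auto)
    then show ?thesis by (simp add: Q_def curve_length_def)
  qed
  then show ?thesis using that C(1) by blast
qed

text \<open>The estimate for the zero function reads
  \<open>0 \<le> C * curve_length A g \<gamma>\<close> with positive \<open>C\<close>, which spares
  another passage over the pieces.\<close>

lemma curve_length_nonneg: "piecewise_C1_curve A \<gamma> \<Longrightarrow> curve_length A g \<gamma> \<ge> 0"
proof -
  assume \<gamma>: "piecewise_C1_curve A \<gamma>"
  have "(\<lambda>x. 0 :: real) \<in> Cr_functions r E A" by (rule Cr_functionsI) (intro Cr_on_const[OF E chart(2)])
  from curve_length_bound[OF this] obtain C where "C > 0"
    "\<And>\<gamma>. piecewise_C1_curve A \<gamma> \<Longrightarrow> norm (0 - 0 :: real) \<le> C * curve_length A g \<gamma>" by blast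
  then show "curve_length A g \<gamma> \<ge> 0" using \<gamma> by (force simp: zero_le_mult_iff)
qed

section \<open>The induced distance compared with coordinates and with \<open>dd\<close>\<close>

lemma rho_eq: "curves_between A x y \<noteq> {} \<Longrightarrow> \<rho> x y = (INF \<gamma>\<in>curves_between A x y. curve_length A g \<gamma>)"
  using rho by (simp add: induced_distance_def)

lemma rho_metric:
  "\<rho> x y \<ge> 0" "\<rho> x y = \<rho> y x" "\<rho> x y = 0 \<longleftrightarrow> x = y" "\<rho> x z \<le> \<rho> x y + \<rho> y z"
  using rho unfolding induced_distance_def Metric_space_def by auto

text \<open>The segment between the coordinates stays in the closed ball, which is convex within
  \<open>E\<close>, and forms a curve with a single piece.\<close>

lemma segment_curve:
  assumes j: "((U, c), p, R) \<in> J" and x: "x \<in> chart_cball ((U, c), p, R)" and y: "y \<in> chart_cball ((U, c), p, R)"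
    and M: "\<And>x w. x \<in> chart_cball ((U, c), p, R) \<Longrightarrow> w \<in> E \<Longrightarrow> sqrt (g (U, c) x w w) \<le> M * norm w"
  obtains \<gamma> where "\<gamma> \<in> curves_between A x y" "curve_length A g \<gamma> \<le> M * norm (c x - c y)"
proof -
  have U: "(U, c) \<in> A" using good[OF j] by (auto simp: good_ball_def)
  note ch = chart_inv[OF U]
  let ?K = "chart_cball ((U, c), p, R)"
  have K: "c ` ?K = E \<inter> cball p R" using good_cball(1)[OF good[OF j]] .
  have KU: "?K \<subseteq> U" by (auto simp: chart_cball_def)
  let ?v = "c y - c x"
  define l where "l t = c x + t *\<^sub>R ?v" for t :: real
  define \<gamma> where "\<gamma> t = inv_into U c (l t)" for t
  have lK: "l t \<in> c ` ?K" if "t \<in> {0..1}" for t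
  proof -
    have "convex (E \<inter> cball p R)" by (simp add: convex_Int subspace_imp_convex[OF E])
    moreover have "c x \<in> E \<inter> cball p R" "c y \<in> E \<inter> cball p R" using K x y by blast+
    moreover have "l t = (1 - t) *\<^sub>R c x + t *\<^sub>R c y" by (simp add: l_def algebra_simps)
    ultimately show ?thesis using that convexD_alt[of "E \<inter> cball p R" "c x" "c y" t] K by simp
  qed
  have \<gamma>K: "\<gamma> t \<in> ?K" "c (\<gamma> t) = l t" "\<gamma> t \<in> U" if t: "t \<in> {0..1}" for t
  proof -
    obtain z where "z \<in> ?K" "l t = c z" using lK[OF t] by blast
    then show "\<gamma> t \<in> ?K" "c (\<gamma> t) = l t" "\<gamma> t \<in> U" using ch(4)[of z] KU by (auto simp: \<gamma>_def)
  qed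
  have xU: "x \<in> U" "y \<in> U" using x y KU by auto
  have \<gamma>01: "\<gamma> 0 = x" "\<gamma> 1 = y" using ch(4) xU by (auto simp: \<gamma>_def l_def)
  have vE: "?v \<in> E" using ch(5) xU E by (simp add: subspace_diff)
  have lc: "continuous_on {0..1} l" unfolding l_def by (intro continuous_intros)
  have cont: "continuous_on {0..1} \<gamma>"
    unfolding \<gamma>_def using lK KU by (intro continuous_on_compose2[OF ch(3) lc]) blast
  have vel: "((\<lambda>s. c (\<gamma> s)) has_vector_derivative ?v) (at t within {0..1})" if t: "t \<in> {0..1}" for t
  proof -
    have "(l has_vector_derivative ?v) (at t within {0..1})"
      unfolding l_def has_vector_derivative_def by (auto intro!: derivative_eq_intros)
    then show ?thesis by (rule has_vector_derivative_weaken) (use t \<gamma>K in auto)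
  qed
  have C1: "C1_curve_on A 0 1 \<gamma>"
    unfolding C1_curve_on_def
  proof (intro conjI cont ballI, clarify, intro conjI ballI)
    fix V d assume V: "(V, d) \<in> A"
    let ?D = "\<lambda>z. frechet_derivative (\<lambda>y. d (inv_into U c y)) (at z within c ` (U \<inter> V)) ?v"
    have der: "((\<lambda>s. d (\<gamma> s)) has_vector_derivative ?D (l t)) (at t within {0..1})" if "t \<in> {0..1} \<inter> \<gamma> -` V" for t
      using velocity_change(2)[OF zero_less_one _ cont U _ V _ vel, of t] that \<gamma>K(2,3)[of t] by simp
    then show "(d \<circ> \<gamma>) differentiable at t within {0..1}" if "t \<in> {0..1} \<inter> \<gamma> -` V" for t
      using that by (auto simp: o_def has_vector_derivative_def differentiable_def)
    have "Ck_on 1 E (c ` (U \<inter> V)) (\<lambda>y. d (inv_into U c y))"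
      using r1 by (intro Cr_on_Ck[OF Cr_transition[OF U V]]) (simp add: one_enat_def)
    then have "continuous_on (c ` (U \<inter> V)) ?D" using vE by auto
    then have "continuous_on ({0..1} \<inter> \<gamma> -` V) (\<lambda>t. ?D (l t))"
    proof (rule continuous_on_compose2[OF _ continuous_on_subset[OF lc]])
      show "l ` ({0..1} \<inter> \<gamma> -` V) \<subseteq> c ` (U \<inter> V)"
      proof clarify
        fix t :: real assume "t \<in> {0..1}" "\<gamma> t \<in> V"
        then show "l t \<in> c ` (U \<inter> V)" using \<gamma>K(2,3)[of t] by (intro image_eqI[of _ _ "\<gamma> t"]) auto
      qed
    qed auto
    moreover have "?D (l t) = vector_derivative (\<lambda>s. d (\<gamma> s)) (at t within {0..1})" if "t \<in> {0..1} \<inter> \<gamma> -` V" for t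
      by (rule sym, rule vector_derivative_within_cbox[of 0 1 t, unfolded box_real]) (use der[OF that] that in auto)
    ultimately show "continuous_on ({0..1} \<inter> \<gamma> -` V) (\<lambda>t. vector_derivative (d \<circ> \<gamma>) (at t within {0..1}))"
      unfolding o_def by (rule continuous_on_eq)
  qed
  have "C1_curve_on A a b \<gamma>" if "a \<in> {0, 1}" "b \<in> {0, 1}" "a < b" for a b :: real
  proof -
    have "a = 0" "b = 1" using that by auto
    then show ?thesis using C1 by simp
  qed
  then have pw: "piecewise_C1_curve A \<gamma>"
    unfolding piecewise_C1_curve_def by (intro exI[of _ "{0, 1}"] conjI ballI impI) simp_all
  have "piece_speed 0 1 \<gamma> t \<le> M * norm ?v" if t: "t \<in> {0..1}" for t
    using piece_speed_eq[OF zero_less_one t cont U \<gamma>K(3)[OF t] vel[OF t]] M[OF \<gamma>K(1)[OF t] vE] by simp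
  then have "integral {0..1} (piece_speed 0 1 \<gamma>) \<le> integral {0..1} (\<lambda>t::real. M * norm ?v)"
    using piece_speed_continuous[OF zero_less_one C1]
    by (intro Henstock_Kurzweil_Integration.integral_le) (auto intro: integrable_continuous_real)
  then have "curve_length A g \<gamma> \<le> M * norm (c x - c y)"
    using curve_speed_integral_piece[OF zero_less_one C1]
    by (simp add: curve_length_def integral_unique norm_minus_commute)
  then show ?thesis using that[of \<gamma>] pw \<gamma>01 by (simp add: curves_between_def)
qed

lemma rho_le_length:
  assumes "\<gamma> \<in> curves_between A x y"
  shows "\<rho> x y \<le> curve_length A g \<gamma>"
proof -
  have "bdd_below (curve_length A g ` curves_between A x y)"
    using curve_length_nonneg by (intro bdd_belowI2[of _ 0]) (auto simp: curves_between_def)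
  moreover have "curves_between A x y \<noteq> {}" using assms by blast
  ultimately show ?thesis using assms unfolding rho_eq[OF \<open>curves_between A x y \<noteq> {}\<close>] by (intro cINF_lower)
qed

text \<open>The existence of a connecting curve is part of the claim, since only then is
  \<open>\<rho>\<close> the infimum of lengths.\<close>

lemma rho_local:
  assumes j: "j \<in> J"
  shows "\<exists>C\<ge>0. \<forall>x\<in>chart_cball j. \<forall>y\<in>chart_cball j. curves_between A x y \<noteq> {} \<and> \<rho> x y \<le> C * dd x y"
proof -
  obtain U c p R where jj: "j = ((U, c), p, R)" by (metis surj_pair)
  obtain m M where "m > 0" and M: "M \<ge> 0"
    "\<And>x w. x \<in> chart_cball ((U, c), p, R) \<Longrightarrow> w \<in> E \<Longrightarrow> m * norm w \<le> sqrt (g (U, c) x w w)"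
    "\<And>x w. x \<in> chart_cball ((U, c), p, R) \<Longrightarrow> w \<in> E \<Longrightarrow> sqrt (g (U, c) x w w) \<le> M * norm w"
    using g_bounds[OF j[unfolded jj]] by metis
  obtain C where C: "C \<ge> 0" "\<And>x y. x \<in> chart_cball ((U, c), p, R) \<Longrightarrow> y \<in> chart_cball ((U, c), p, R) \<Longrightarrow>
    norm (c x - c y) \<le> C * dd x y" using dd_lower[OF j[unfolded jj]] by blast
  have "curves_between A x y \<noteq> {} \<and> \<rho> x y \<le> (M * C) * dd x y" if xy: "x \<in> chart_cball j" "y \<in> chart_cball j" for x y
  proof -
    obtain \<gamma> where \<gamma>: "\<gamma> \<in> curves_between A x y" "curve_length A g \<gamma> \<le> M * norm (c x - c y)"
      using segment_curve[OF j[unfolded jj] xy[unfolded jj] M(3)] by blast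
    have "\<rho> x y \<le> M * norm (c x - c y)" using rho_le_length[OF \<gamma>(1)] \<gamma>(2) by linarith
    also have "\<dots> \<le> M * (C * dd x y)" using C(2) xy M(1) by (auto simp: jj intro: mult_left_mono)
    finally show ?thesis using \<gamma>(1) by (auto simp: mult.assoc)
  qed
  then show ?thesis using C(1) M(1) by (intro exI[of _ "M * C"]) auto
qed

text \<open>\<open>\<rho>\<close> is only known to be a metric on the set of points; the local
  estimate by \<open>dd\<close> and the triangle inequality relate it to the manifold
  topology.\<close>

lemma continuous_on_rho: "continuous_on UNIV (\<rho> x)"
proof (intro continuous_at_imp_continuous_on ballI)
  fix y
  obtain j where j: "j \<in> J" "y \<in> chart_ball j" using cover by blast
  obtain C where C: "C \<ge> 0" "\<And>x y. x \<in> chart_cball j \<Longrightarrow> y \<in> chart_cball j \<Longrightarrow> \<rho> x y \<le> C * dd x y"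
    using rho_local[OF j(1)] by blast
  have "((\<lambda>z. C * dd y z) \<longlongrightarrow> C * dd y y) (at y)"
    using continuous_on_dd[of UNIV y] by (intro tendsto_intros) (simp add: continuous_on_def)
  then have lim: "((\<lambda>z. C * dd y z) \<longlongrightarrow> 0) (at y)" by (simp add: dd_self)
  have "\<forall>\<^sub>F z in at y. z \<in> chart_ball j"
    using open_chart_ball_J[OF j(1)] j(2) by (intro eventually_at_topological[THEN iffD2]) blast
  then have "\<forall>\<^sub>F z in at y. norm (\<rho> x z - \<rho> x y) \<le> C * dd y z"
  proof eventually_elim
    case (elim z)
    have "\<rho> y z \<le> C * dd y z" using C(2) elim j(2) chart_ball_subset by blast
    then show ?case using rho_metric(4)[of x z y] rho_metric(4)[of x y z] rho_metric(2)[of y z] by auto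
  qed
  then have "((\<lambda>z. \<rho> x z - \<rho> x y) \<longlongrightarrow> 0) (at y)" using lim by (rule Lim_null_comparison)
  then show "isCont (\<rho> x) y" by (simp add: isCont_def LIM_zero_cancel)
qed

text \<open>Pairs with small \<open>dd x y\<close> share a chart ball. For the others it is enough
  that \<open>\<rho>\<close> is bounded, which its continuity and compactness give; this includes
  pairs in different components.\<close>

lemma rho_le_dd:
  obtains C where "C \<ge> 0" "\<And>x y. \<rho> x y \<le> C * dd x y"
proof -
  obtain C where C: "\<And>j. j \<in> J \<Longrightarrow> C j \<ge> 0" "\<And>j x y. j \<in> J \<Longrightarrow> x \<in> chart_cball j \<Longrightarrow> y \<in> chart_cball j \<Longrightarrow> \<rho> x y \<le> C j * dd x y"
    using rho_local by metis
  obtain \<delta> where \<delta>: "\<delta> > 0" "\<And>x y. dd x y < \<delta> \<Longrightarrow> \<exists>j\<in>J. x \<in> chart_ball j \<and> y \<in> chart_ball j"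
    using dd_lebesgue by blast
  \<comment> \<open>By the triangle inequality, twice the maximal distance from an arbitrary base
    point, here \<open>undefined\<close>, bounds \<open>\<rho>\<close>.\<close>
  obtain z where z: "\<And>y. \<rho> undefined y \<le> \<rho> undefined z"
    using continuous_attains_sup[OF compact_UNIV _ continuous_on_rho[of undefined]] by auto
  let ?D = "2 * \<rho> undefined z"
  have D: "\<rho> x y \<le> ?D" for x y
    using rho_metric(4)[of x y undefined] rho_metric(2)[of x undefined] z[of x] z[of y] by linarith
  have D0: "?D \<ge> 0" using rho_metric(1) by simp
  have S0: "sum C J \<ge> 0" using C(1) by (simp add: sum_nonneg)
  show ?thesis
  proof (rule that[of "sum C J + ?D / \<delta>"])
    show "sum C J + ?D / \<delta> \<ge> 0" using S0 D0 \<delta>(1) by simp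
    fix x y
    show "\<rho> x y \<le> (sum C J + ?D / \<delta>) * dd x y"
    proof (cases "dd x y < \<delta>")
      case True
      then obtain j where j: "j \<in> J" "x \<in> chart_cball j" "y \<in> chart_cball j"
        using \<delta>(2) chart_ball_subset by blast
      have "C j \<le> sum C J" using member_le_sum[OF j(1), of C] C(1) fin_J by auto
      then have "C j * dd x y \<le> (sum C J + ?D / \<delta>) * dd x y"
        using D0 \<delta>(1) by (intro mult_right_mono dd_nonneg) (simp add: add_increasing2)
      then show ?thesis using C(2)[OF j] by linarith
    next
      case False
      then have "?D * 1 \<le> ?D * (dd x y / \<delta>)" using D0 \<delta>(1) by (intro mult_left_mono) auto
      then have "?D \<le> ?D / \<delta> * dd x y" by simp
      moreover have "0 \<le> sum C J * dd x y" using S0 dd_nonneg by simp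
      ultimately show ?thesis using D[of x y] by (simp add: distrib_right)
    qed
  qed
qed

text \<open>Points at small \<open>\<rho>\<close>-distance lie in a common chart ball and are
  therefore joined by a curve, so the length estimate passes to the infimum. Fine Hausdorff covers
  involve only such pairs.\<close>

lemma Cr_functions_rho_lipschitz:
  fixes h :: "'m \<Rightarrow> 'f::euclidean_space"
  assumes "h \<in> Cr_functions r E A"
  obtains C \<delta> where "C \<ge> 0" "\<delta> > 0" "\<And>x y. \<rho> x y < \<delta> \<Longrightarrow> norm (h x - h y) \<le> C * \<rho> x y"
proof -
  obtain C where C: "C > 0" "\<And>\<gamma>. piecewise_C1_curve A \<gamma> \<Longrightarrow> norm (h (\<gamma> 1) - h (\<gamma> 0)) \<le> C * curve_length A g \<gamma>"
    using curve_length_bound[OF assms] by blast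
  obtain \<delta> where \<delta>: "\<delta> > 0" "\<And>x y. \<rho> x y < \<delta> \<Longrightarrow> \<exists>j\<in>J. x \<in> chart_ball j \<and> y \<in> chart_ball j"
    by (rule lebesgue_number_J[of \<rho>]) (auto intro: rho_metric(1,2,4) continuous_on_rho simp: rho_metric(3))
  have "norm (h x - h y) \<le> C * \<rho> x y" if "\<rho> x y < \<delta>" for x y
  proof -
    have ne: "curves_between A x y \<noteq> {}" using \<delta>(2)[OF that] rho_local chart_ball_subset by blast
    have "norm (h x - h y) / C \<le> curve_length A g \<gamma>" if "\<gamma> \<in> curves_between A x y" for \<gamma>
      using C(2)[of \<gamma>] that C(1) by (auto simp: curves_between_def field_simps norm_minus_commute)
    then have "norm (h x - h y) / C \<le> \<rho> x y" unfolding rho_eq[OF ne] by (rule cINF_greatest[OF ne])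
    then show ?thesis using C(1) by (simp add: field_simps)
  qed
  then show ?thesis using that[of C \<delta>] C(1) \<delta>(1) by auto
qed

end

section \<open>The topology on $C^r$ functions\<close>

context cr_manifold
begin

abbreviation Cr_nhd :: "('m \<Rightarrow> 'f::euclidean_space) \<Rightarrow> 'm set \<Rightarrow> ('m \<Rightarrow> 'e) \<Rightarrow> 'm set \<Rightarrow> 'e list \<Rightarrow> real \<Rightarrow> ('m \<Rightarrow> 'f) set" where
  "Cr_nhd \<phi> U c K vs \<epsilon> \<equiv> {\<psi> \<in> Cr_functions r E A. \<forall>x\<in>K.
         dist (iter_deriv (c ` U) (\<psi> \<circ> inv_into U c) vs (c x))
              (iter_deriv (c ` U) (\<phi> \<circ> inv_into U c) vs (c x)) < \<epsilon>}"

lemma openin_Cr_nhd: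
  assumes "\<phi> \<in> Cr_functions r E A" "(U, c) \<in> A" "compact K" "K \<subseteq> U" "set vs \<subseteq> E" "enat (length vs) \<le> r" "0 < \<epsilon>"
  shows "openin (Cr_topology r E A) (Cr_nhd \<phi> U c K vs \<epsilon>)"
  unfolding Cr_topology_def
  by (rule topology_generated_by_Basis, rule CollectI, rule exI[of _ \<phi>], rule exI[of _ U], rule exI[of _ c],
      rule exI[of _ K], rule exI[of _ vs], rule exI[of _ \<epsilon>], intro conjI refl assms)

lemma self_in_Cr_nhd: "\<phi> \<in> Cr_functions r E A \<Longrightarrow> 0 < \<epsilon> \<Longrightarrow> \<phi> \<in> Cr_nhd \<phi> U c K vs \<epsilon>"
  by simp

lemma topspace_Cr_topology: "topspace (Cr_topology r E A) = (Cr_functions r E A :: ('m \<Rightarrow> 'f::euclidean_space) set)"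
proof
  show "topspace (Cr_topology r E A) \<subseteq> (Cr_functions r E A :: ('m \<Rightarrow> 'f) set)"
    unfolding Cr_topology_def topology_generated_by_topspace by blast
  show "(Cr_functions r E A :: ('m \<Rightarrow> 'f) set) \<subseteq> topspace (Cr_topology r E A)"
  proof
    fix \<phi> :: "'m \<Rightarrow> 'f" assume \<phi>: "\<phi> \<in> Cr_functions r E A"
    obtain U c where U: "(U, c) \<in> A" using charts_cover by blast
    have "openin (Cr_topology r E A) (Cr_nhd \<phi> U c {} [] 1)"
      by (rule openin_Cr_nhd[OF \<phi> U]) (auto simp: zero_enat_def[symmetric])
    from openin_subset[OF this] self_in_Cr_nhd[OF \<phi> zero_less_one]
    show "\<phi> \<in> topspace (Cr_topology r E A)" by (rule subsetD)
  qed
qed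

text \<open>Values at a single point, the case of order 0, already separate functions. The Hausdorff
  property makes the compact set of probes closed and hence Borel.\<close>

lemma Hausdorff_Cr_topology: "Hausdorff_space (Cr_topology r E A :: ('m \<Rightarrow> 'f::euclidean_space) topology)"
  unfolding Hausdorff_space_def topspace_Cr_topology
proof (intro allI impI, elim conjE)
  fix \<phi> \<psi> :: "'m \<Rightarrow> 'f" assume fg: "\<phi> \<in> Cr_functions r E A" "\<psi> \<in> Cr_functions r E A" "\<phi> \<noteq> \<psi>"
  then obtain x where x: "\<phi> x \<noteq> \<psi> x" by blast
  obtain U c where U: "(U, c) \<in> A" "x \<in> U" using charts_cover by blast
  define \<epsilon> where "\<epsilon> = dist (\<phi> x) (\<psi> x) / 2"
  have e: "\<epsilon> > 0" using x by (simp add: \<epsilon>_def)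
  let ?O = "\<lambda>\<phi>. Cr_nhd \<phi> U c {x} [] \<epsilon>"
  have op: "openin (Cr_topology r E A) (?O \<phi>)" if "\<phi> \<in> Cr_functions r E A" for \<phi> :: "'m \<Rightarrow> 'f"
    by (rule openin_Cr_nhd[OF that U(1)]) (use U e in \<open>auto simp: zero_enat_def[symmetric]\<close>)
  have "disjnt (?O \<phi>) (?O \<psi>)"
  proof -
    have "False" if "h \<in> ?O \<phi>" "h \<in> ?O \<psi>" for h
    proof -
      have "dist (h x) (\<phi> x) < \<epsilon>" "dist (h x) (\<psi> x) < \<epsilon>" using that chart_inv(4)[OF U] by auto
      then show False using dist_triangle2[of "\<phi> x" "\<psi> x" "h x"] by (simp add: \<epsilon>_def dist_commute)
    qed
    then show ?thesis unfolding disjnt_def by blast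
  qed
  then show "\<exists>U V. openin (Cr_topology r E A) U \<and> openin (Cr_topology r E A) V \<and> \<phi> \<in> U \<and> \<psi> \<in> V \<and> disjnt U V"
    by (intro exI[of _ "?O \<phi>"] exI[of _ "?O \<psi>"] conjI op fg self_in_Cr_nhd e)
qed

end

context cr_embedded
begin

text \<open>First derivatives control pairs in a common chart ball and values control pairs with
  \<open>dd x y \<ge> \<delta>\<close>; neighbourhoods of order 1 are available because
  \<open>r\<close> is at least 1.\<close>

lemma Cr_nhd_lipschitz_small:
  fixes \<phi> :: "'m \<Rightarrow> 'f::euclidean_space"
  assumes \<phi>: "\<phi> \<in> Cr_functions r E A" and "\<epsilon> > 0"
  obtains W where "openin (Cr_topology r E A) W" "\<phi> \<in> W"
    "\<And>\<psi> x y. \<psi> \<in> W \<Longrightarrow> norm ((\<psi> x - \<phi> x) - (\<psi> y - \<phi> y)) \<le> \<epsilon> * dd x y"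
proof -
  obtain B where B: "finite B" "B \<subseteq> E" "\<And>b. b \<in> B \<Longrightarrow> norm b = 1"
    "\<And>x. x \<in> E \<Longrightarrow> (\<Sum>b\<in>B. (x \<bullet> b) *\<^sub>R b) = x"
    using subspace_orthonormal_basis[OF E] by metis
  have "\<forall>j\<in>J. \<exists>C\<ge>0. \<forall>x\<in>chart_cball j. \<forall>y\<in>chart_cball j. norm (snd (fst j) x - snd (fst j) y) \<le> C * dd x y"
  proof
    fix j assume j: "j \<in> J"
    obtain U c p R where jj: "j = ((U, c), p, R)" by (metis surj_pair)
    show "\<exists>C\<ge>0. \<forall>x\<in>chart_cball j. \<forall>y\<in>chart_cball j. norm (snd (fst j) x - snd (fst j) y) \<le> C * dd x y"
      unfolding jj fst_conv snd_conv dd_def by (rule f_low[OF j[unfolded jj]])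
  qed
  then obtain C where C: "\<And>j. j \<in> J \<Longrightarrow> C j \<ge> 0"
    "\<And>j x y. j \<in> J \<Longrightarrow> x \<in> chart_cball j \<Longrightarrow> y \<in> chart_cball j \<Longrightarrow> norm (snd (fst j) x - snd (fst j) y) \<le> C j * dd x y"
    by metis
  obtain \<delta> where \<delta>: "\<delta> > 0" "\<And>x y. dd x y < \<delta> \<Longrightarrow> \<exists>j\<in>J. x \<in> chart_ball j \<and> y \<in> chart_ball j"
    using dd_lebesgue by blast
  \<comment> \<open>The summands serve pairs in a common chart ball, distant pairs, and the
    positivity of \<open>D\<close>.\<close>
  define D where "D = real (card B) * sum C J + 2 / \<delta> + 1"
  have S0: "sum C J \<ge> 0" using C(1) by (simp add: sum_nonneg)
  then have D: "D > 0" using \<delta>(1) by (simp add: D_def add_nonneg_pos)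
  define \<eta> where "\<eta> = \<epsilon> / D"
  have eta: "\<eta> > 0" using D \<open>\<epsilon> > 0\<close> by (simp add: \<eta>_def)
  have eps: "\<epsilon> = D * \<eta>" using D by (simp add: \<eta>_def)
  \<comment> \<open>The empty list stands for values, the lists of length 1 for first derivatives
    along the basis.\<close>
  define VS where "VS = insert [] ((\<lambda>b. [b]) ` B)"
  define N where "N j vs = Cr_nhd \<phi> (fst (fst j)) (snd (fst j)) (chart_cball j) vs \<eta>" for j vs
  define W where "W = (\<Inter>q\<in>J \<times> VS. N (fst q) (snd q))"
  \<comment> \<open>A finite intersection of open sets is open in the topology only for a nonempty
    family, so \<open>J\<close> must have an element.\<close>
  obtain j0 where j0: "j0 \<in> J" using cover by blast
  show ?thesis
  proof (rule that[of W])
    show "\<phi> \<in> W" using self_in_Cr_nhd[OF \<phi> eta] by (simp add: W_def N_def)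
    have "openin (Cr_topology r E A) (N j vs)" if "j \<in> J" "vs \<in> VS" for j vs
      unfolding N_def
    proof (rule openin_Cr_nhd[OF \<phi>])
      obtain U c p R where jj: "j = ((U, c), p, R)" by (metis surj_pair)
      show "(fst (fst j), snd (fst j)) \<in> A" "compact (chart_cball j)" "chart_cball j \<subseteq> fst (fst j)"
        using good[OF that(1)] good_cball(2) by (auto simp: jj good_ball_def chart_cball_def)
      show "set vs \<subseteq> E" "enat (length vs) \<le> r" using that(2) B(2) r1
        by (auto simp: VS_def zero_enat_def[symmetric] one_enat_def)
    qed (rule eta)
    then show "openin (Cr_topology r E A) W"
      unfolding W_def using fin_J B(1) j0
      by (intro openin_Inter) (auto simp: VS_def)
    fix \<psi> x y assume \<psi>: "\<psi> \<in> W"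
    have mem: "\<psi> \<in> N j vs" if "j \<in> J" "vs \<in> VS" for j vs
      using \<psi> that by (auto simp: W_def)
    have near: "dist (iter_deriv (c ` U) (\<psi> \<circ> inv_into U c) vs (c x)) (iter_deriv (c ` U) (\<phi> \<circ> inv_into U c) vs (c x)) < \<eta>"
      if "((U, c), p, R) \<in> J" "vs \<in> VS" "x \<in> chart_cball ((U, c), p, R)" for U c p R vs x
      using mem[OF that(1,2)] that(3) by (simp add: N_def)
    have "[] \<in> VS" by (simp add: VS_def)
    then have \<psi>C: "\<psi> \<in> Cr_functions r E A" using mem[OF j0, of "[]"] by (simp add: N_def)
    let ?h = "\<lambda>x. \<psi> x - \<phi> x"
    have small: "norm (?h x) \<le> \<eta>" for x
    proof -
      obtain U c p R where j: "((U, c), p, R) \<in> J" "(U, c) \<in> A" "x \<in> U" "x \<in> chart_cball ((U, c), p, R)"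
        using chart_at[of x] by metis
      have "dist (iter_deriv (c ` U) (\<psi> \<circ> inv_into U c) [] (c x)) (iter_deriv (c ` U) (\<phi> \<circ> inv_into U c) [] (c x)) < \<eta>"
        by (rule near[OF j(1) _ j(4)]) (simp add: VS_def)
      then show ?thesis using chart_inv(4)[OF j(2,3)] by (simp add: dist_norm)
    qed
    show "norm (?h x - ?h y) \<le> \<epsilon> * dd x y"
    proof (cases "dd x y < \<delta>")
      case True
      then obtain j where j: "j \<in> J" "x \<in> chart_cball j" "y \<in> chart_cball j"
        using \<delta>(2) chart_ball_subset by blast
      obtain U c p R where jj: "j = ((U, c), p, R)" by (metis surj_pair)
      note j' = j[unfolded jj]
      have U: "(U, c) \<in> A" and sub: "E \<inter> cball p R \<subseteq> c ` U" using good[OF j'(1)] by (auto simp: good_ball_def)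
      note ch = chart_inv[OF U] and K = good_cball(1)[OF good[OF j'(1)]]
      have KU: "chart_cball ((U, c), p, R) \<subseteq> U" by (auto simp: chart_cball_def)
      let ?D = "\<lambda>\<psi> z. frechet_derivative (\<lambda>y. \<psi> (inv_into U c y)) (at z within c ` U)"
      have der: "((\<lambda>y. ?h (inv_into U c y)) has_derivative (\<lambda>v. ?D \<psi> z v - ?D \<phi> z v)) (at z within c ` U)"
        if "z \<in> c ` U" for z
        using Cr_on_has_derivative[OF Cr_functions_chart[OF \<psi>C U] r1 that]
          Cr_on_has_derivative[OF Cr_functions_chart[OF \<phi> U] r1 that] by (rule has_derivative_diff)
      have "norm (?h (inv_into U c (c x)) - ?h (inv_into U c (c y))) \<le> real (card B) * \<eta> * norm (c x - c y)"
      proof (rule derivative_bound_imp_lipschitz[OF E chart(2)[OF U] sub _ B(2,3,4) der])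
        show "convex (E \<inter> cball p R)" by (simp add: convex_Int subspace_imp_convex[OF E])
        show "c x \<in> E \<inter> cball p R" "c y \<in> E \<inter> cball p R" using K j'(2,3) by blast+
        fix z b assume z: "z \<in> E \<inter> cball p R" and b: "b \<in> B"
        then obtain w where w: "w \<in> chart_cball ((U, c), p, R)" "z = c w" using K by blast
        have "dist (iter_deriv (c ` U) (\<psi> \<circ> inv_into U c) [b] (c w)) (iter_deriv (c ` U) (\<phi> \<circ> inv_into U c) [b] (c w)) < \<eta>"
          by (rule near[OF j'(1) _ w(1)]) (simp add: VS_def b)
        then show "norm (?D \<psi> z b - ?D \<phi> z b) \<le> \<eta>" using w(2) by (simp add: dist_norm o_def)
      qed
      then have "norm (?h x - ?h y) \<le> real (card B) * \<eta> * norm (c x - c y)"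
        using ch(4) KU j'(2,3) by (simp add: subset_eq)
      also have "\<dots> \<le> real (card B) * \<eta> * (C j * dd x y)"
        using C(2)[OF j] eta by (intro mult_left_mono) (auto simp: jj)
      also have "\<dots> \<le> real (card B) * \<eta> * (sum C J * dd x y)"
        using member_le_sum[OF j(1), of C] C(1) fin_J eta dd_nonneg
        by (intro mult_left_mono mult_right_mono) auto
      also have "\<dots> = (real (card B) * sum C J) * (\<eta> * dd x y)" by simp
      also have "\<dots> \<le> D * (\<eta> * dd x y)"
        using \<delta>(1) eta dd_nonneg by (intro mult_right_mono) (auto simp: D_def)
      finally show ?thesis by (simp add: eps)
    next
      case False
      have "norm (?h x - ?h y) \<le> 2 * \<eta>"
        using norm_triangle_ineq4[of "?h x" "?h y"] small[of x] small[of y] by linarith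
      also have "\<dots> = (2 * \<eta>) * 1" by simp
      also have "\<dots> \<le> (2 * \<eta>) * (dd x y / \<delta>)"
        using False \<delta>(1) eta by (intro mult_left_mono) auto
      also have "\<dots> = 2 / \<delta> * (\<eta> * dd x y)" by simp
      also have "\<dots> \<le> D * (\<eta> * dd x y)"
        using S0 eta dd_nonneg by (intro mult_right_mono) (auto simp: D_def)
      finally show ?thesis by (simp add: eps)
    qed
  qed
qed

section \<open>The finite-dimensional family of probes\<close>

definition probe :: "(nat \<Rightarrow> 'f::euclidean_space) \<Rightarrow> 'm \<Rightarrow> 'f" where
  "probe L = (\<lambda>x. \<Sum>i<n. f i x *\<^sub>R L i)"

lemma probe_Cr: "probe L \<in> Cr_functions r E A"
  unfolding probe_def by (rule Cr_functions_lincomb) (simp add: f_Cr)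

text \<open>Yields both the measurability of \<open>probe\<close> and the compactness of the image
  of a product of balls. Derivatives of a probe in a chart are linear in \<open>L\<close>, with
  coefficients bounded on the compact set \<open>K\<close>.\<close>

lemma continuous_map_probe:
  "continuous_map euclidean (Cr_topology r E A) (probe :: (nat \<Rightarrow> 'f::euclidean_space) \<Rightarrow> 'm \<Rightarrow> 'f)"
  unfolding Cr_topology_def
proof (rule continuous_on_generated_topo)
  show "(probe :: (nat \<Rightarrow> 'f) \<Rightarrow> 'm \<Rightarrow> 'f) ` topspace euclidean \<subseteq> \<Union> {Cr_nhd \<phi> U c K vs \<epsilon> | \<phi> U c K vs \<epsilon>.
      \<phi> \<in> Cr_functions r E A \<and> (U, c) \<in> A \<and> compact K \<and> K \<subseteq> U \<and> set vs \<subseteq> E \<and> enat (length vs) \<le> r \<and> 0 < \<epsilon>}"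
    unfolding topspace_Cr_topology[unfolded Cr_topology_def topology_generated_by_topspace] using probe_Cr by auto
next
  fix S :: "('m \<Rightarrow> 'f) set"
  assume "S \<in> {Cr_nhd \<phi> U c K vs \<epsilon> | \<phi> U c K vs \<epsilon>.
      \<phi> \<in> Cr_functions r E A \<and> (U, c) \<in> A \<and> compact K \<and> K \<subseteq> U \<and> set vs \<subseteq> E \<and> enat (length vs) \<le> r \<and> 0 < \<epsilon>}"
  then obtain \<phi> U c K vs \<epsilon> where S: "S = Cr_nhd \<phi> U c K vs \<epsilon>" and \<phi>: "\<phi> \<in> Cr_functions r E A"
    and U: "(U, c) \<in> A" and K: "compact K" "K \<subseteq> U" and vs: "set vs \<subseteq> E" "enat (length vs) \<le> r" and e: "0 < \<epsilon>"
    by blast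
  note EU = E chart(2)[OF U]
  define D where "D i x = iter_deriv (c ` U) (\<lambda>y. f i (inv_into U c y)) vs (c x)" for i x
  define G where "G x = iter_deriv (c ` U) (\<lambda>y. \<phi> (inv_into U c y)) vs (c x)" for x
  have cK: "c ` K \<subseteq> c ` U" "continuous_on K c" using K chart_inv(2)[OF U] continuous_on_subset by blast+
  have Ck: "Ck_on (length vs) E (c ` U) (\<lambda>y. h (inv_into U c y))" if "h \<in> Cr_functions r E A" for h :: "'m \<Rightarrow> 'g::euclidean_space"
    using Cr_on_Ck[OF Cr_functions_chart[OF that U] vs(2)] .
  have contI: "continuous_on K (\<lambda>x. iter_deriv (c ` U) (\<lambda>y. h (inv_into U c y)) vs (c x))"
    if "h \<in> Cr_functions r E A" for h :: "'m \<Rightarrow> 'g::euclidean_space"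
  proof (rule continuous_on_compose2[OF _ cK(2,1)])
    show "continuous_on (c ` U) (iter_deriv (c ` U) (\<lambda>y. h (inv_into U c y)) vs)"
      using Ck_on_iter_deriv[OF EU, of vs 0] Ck[OF that] vs(1) by simp
  qed
  have Dc: "continuous_on K (D i)" if "i < n" for i
    unfolding D_def using contI[OF f_Cr[OF that]] .
  have Gc: "continuous_on K G" unfolding G_def using contI[OF \<phi>] .
  have pr: "iter_deriv (c ` U) (probe L \<circ> inv_into U c) vs (c x) = (\<Sum>i<n. D i x *\<^sub>R L i)" if "x \<in> K" for L :: "nat \<Rightarrow> 'f" and x
    unfolding probe_def D_def o_def
    by (rule iter_deriv_lincomb[OF EU]) (use that K vs Ck f_Cr in auto)
  have "\<exists>b. \<forall>x\<in>K. \<bar>D i x\<bar> \<le> b" if "i < n" for i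
    using compact_imp_bounded[OF compact_continuous_image[OF Dc[OF that] K(1)]] by (force simp: bounded_iff)
  then obtain b where b: "\<And>i x. i < n \<Longrightarrow> x \<in> K \<Longrightarrow> \<bar>D i x\<bar> \<le> b i" by metis
  define H where "H L x = norm ((\<Sum>i<n. D i x *\<^sub>R L i) - G x)" for L :: "nat \<Rightarrow> 'f" and x
  have pre: "probe -` S = {L. \<forall>x\<in>K. H L x < \<epsilon>}"
    using pr probe_Cr by (auto simp: S H_def dist_norm G_def o_def)
  have "open {L. \<forall>x\<in>K. H L x < \<epsilon>}"
  proof (cases "K = {}")
    case False
    show ?thesis
    proof (rule Topological_Spaces.openI)
      fix L0 assume L0: "L0 \<in> {L. \<forall>x\<in>K. H L x < \<epsilon>}"
      have "continuous_on K (H L0)"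
        unfolding H_def by (intro continuous_intros Dc Gc) auto
      then obtain z where z: "z \<in> K" "\<And>x. x \<in> K \<Longrightarrow> H L0 x \<le> H L0 z"
        using continuous_attains_sup[OF K(1) False] by blast
      \<comment> \<open>The maximum of \<open>H L0\<close> on \<open>K\<close> leaves a margin below
        \<open>\<epsilon>\<close>, which a change of the coefficients may use up. Only finitely many
        coordinates enter, so \<open>N\<close> is open in the product topology.\<close>
      define N where "N = {L :: nat \<Rightarrow> 'f. (\<Sum>i<n. b i * norm (L i - L0 i)) < \<epsilon> - H L0 z}"
      have "open N"
        unfolding N_def by (intro open_Collect_less continuous_intros continuous_on_product_coordinates)
      moreover have "L0 \<in> N" using L0 z(1) by (simp add: N_def)
      moreover have "N \<subseteq> {L. \<forall>x\<in>K. H L x < \<epsilon>}"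
      proof clarify
        fix L x assume L: "L \<in> N" and x: "x \<in> K"
        have "(\<Sum>i<n. D i x *\<^sub>R L i) - G x = ((\<Sum>i<n. D i x *\<^sub>R L0 i) - G x) + (\<Sum>i<n. D i x *\<^sub>R (L i - L0 i))"
          by (simp add: scaleR_diff_right sum_subtractf)
        then have "H L x \<le> H L0 x + norm (\<Sum>i<n. D i x *\<^sub>R (L i - L0 i))"
          unfolding H_def by (metis norm_triangle_ineq)
        also have "norm (\<Sum>i<n. D i x *\<^sub>R (L i - L0 i)) \<le> (\<Sum>i<n. b i * norm (L i - L0 i))"
          by (rule sum_norm_le) (use b x in \<open>auto intro: mult_right_mono\<close>)
        finally show "H L x < \<epsilon>" using z(2)[OF x] L by (simp add: N_def)
      qed
      ultimately show "\<exists>T. open T \<and> L0 \<in> T \<and> T \<subseteq> {L. \<forall>x\<in>K. H L x < \<epsilon>}" by blast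
    qed
  qed auto
  then show "openin euclidean (probe -` S \<inter> topspace euclidean)" using pre by simp
qed

end

section \<open>Random linear combinations and small covers\<close>

definition unif :: "'f::euclidean_space measure" where
  "unif = uniform_measure lborel (cball 0 1)"

lemma unif_cball_1: "emeasure lborel (cball (0::'f::euclidean_space) 1) = ennreal (unit_ball_vol (real DIM('f)))"
  by (simp add: emeasure_cball)

lemma prob_space_unif: "prob_space (unif :: 'f::euclidean_space measure)"
  unfolding unif_def
  by (rule prob_space_uniform_measure) (auto simp: unif_cball_1 ennreal_eq_0_iff not_le unit_ball_vol_pos)

lemma space_unif [simp]: "space unif = UNIV" and sets_unif [simp, measurable_cong]: "sets unif = sets borel"
  by (auto simp: unif_def)

lemma AE_unif: "AE x in unif. norm x \<le> 1"
  unfolding unif_def by (rule AE_uniform_measureI) auto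

lemma emeasure_unif_cball:
  fixes q :: "'f::euclidean_space"
  assumes "s \<ge> 0"
  shows "emeasure unif (cball q s) \<le> ennreal (s ^ DIM('f))"
proof -
  let ?v = "unit_ball_vol (real DIM('f))"
  have v: "?v > 0" by (simp add: unit_ball_vol_pos)
  have "emeasure unif (cball q s) = emeasure lborel (cball 0 1 \<inter> cball q s) / emeasure lborel (cball (0::'f) 1)"
    unfolding unif_def by (rule emeasure_uniform_measure) auto
  also have "\<dots> \<le> emeasure lborel (cball q s) / emeasure lborel (cball (0::'f) 1)"
    by (intro divide_right_mono_ennreal emeasure_mono) auto
  also have "\<dots> = ennreal (?v * s ^ DIM('f)) / ennreal ?v"
    using assms by (simp add: emeasure_cball)
  also have "\<dots> = ennreal (s ^ DIM('f))"
  proof -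
    have "?v \<noteq> 0" using v by linarith
    moreover have "0 \<le> ?v * s ^ DIM('f)" using v assms by (intro mult_nonneg_nonneg) auto
    moreover have "v * x / v = x" if "v \<noteq> 0" for v x :: real using that by simp
    ultimately show ?thesis by (subst divide_ennreal[OF _ v]) metis+
  qed
  finally show ?thesis .
qed

definition coeff_measure :: "nat \<Rightarrow> (nat \<Rightarrow> 'f::euclidean_space) measure" where
  "coeff_measure n = PiM {..<n} (\<lambda>_. unif)"

lemma prob_space_coeff: "prob_space (coeff_measure n)"
  unfolding coeff_measure_def by (intro prob_space_PiM prob_space_unif)

lemma measurable_coeff [measurable]: "i < n \<Longrightarrow> (\<lambda>L. L i) \<in> borel_measurable (coeff_measure n)"
  unfolding coeff_measure_def measurable_cong_sets[OF refl sets_unif, symmetric]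
  by (rule measurable_component_singleton) auto

lemma AE_coeff: "AE L in coeff_measure n. \<forall>i<n. norm (L i :: 'f::euclidean_space) \<le> 1"
proof -
  have "AE L in coeff_measure n. norm (L i :: 'f) \<le> 1" if "i < n" for i
    unfolding coeff_measure_def
    by (rule AE_PiM_component[OF prob_space_unif]) (use that AE_unif in auto)
  then have "\<forall>i\<in>{..<n}. AE L in coeff_measure n. norm (L i :: 'f) \<le> 1" by simp
  then have "AE L in coeff_measure n. \<forall>i\<in>{..<n}. norm (L i :: 'f) \<le> 1"
    by (intro AE_finite_allI) auto
  then show ?thesis by (rule AE_mp) auto
qed

text \<open>With all vectors but \<open>L i\<close> fixed, the event confines \<open>L i\<close> to
  a ball of radius at most \<open>t / \<delta>\<close>. Integrating first over \<open>L i\<close>,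
  which the product measure permits, gives the bound.\<close>

lemma small_ball_probability:
  fixes a :: "'f::euclidean_space"
  assumes i: "i < n" "\<bar>u i\<bar> \<ge> \<delta>" and "\<delta> > 0" "t \<ge> 0"
  shows "emeasure (coeff_measure n) {L \<in> space (coeff_measure n). norm (a + (\<Sum>j<n. u j *\<^sub>R L j)) \<le> t}
    \<le> ennreal ((t / \<delta>) ^ DIM('f))"
proof -
  interpret product_sigma_finite "\<lambda>_::nat. unif :: 'f measure"
    by (intro product_sigma_finite.intro prob_space_imp_sigma_finite prob_space_unif)
  define I where "I = {..<n} - {i}"
  have I: "finite I" "i \<notin> I" "{..<n} = insert i I" using i by (auto simp: I_def)
  interpret P: prob_space "PiM I (\<lambda>_. unif :: 'f measure)" by (intro prob_space_PiM prob_space_unif)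
  let ?S = "{L \<in> space (coeff_measure n). norm (a + (\<Sum>j<n. u j *\<^sub>R L j)) \<le> t}"
  have S: "?S \<in> sets (coeff_measure n)" by measurable
  have "emeasure (coeff_measure n) ?S = (\<integral>\<^sup>+ L. indicator ?S L \<partial>coeff_measure n)"
    using S by simp
  also have "\<dots> = (\<integral>\<^sup>+ x. (\<integral>\<^sup>+ y. indicator ?S (x(i := y)) \<partial>unif) \<partial>PiM I (\<lambda>_. unif))"
    unfolding coeff_measure_def I(3)
    by (rule product_nn_integral_insert[OF I(1,2)]) (use S in \<open>simp add: coeff_measure_def I(3)\<close>)
  also have "\<dots> \<le> (\<integral>\<^sup>+ x. ennreal ((t / \<delta>) ^ DIM('f)) \<partial>PiM I (\<lambda>_. unif :: 'f measure))"
  proof (rule nn_integral_mono)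
    fix x :: "nat \<Rightarrow> 'f"
    define b where "b = a + (\<Sum>j\<in>I. u j *\<^sub>R x j)"
    define q where "q = - ((1 / u i) *\<^sub>R b)"
    have ui: "u i \<noteq> 0" using assms by auto
    have "indicator ?S (x(i := y)) \<le> (indicator (cball q (t / \<delta>)) y :: ennreal)" for y
    proof (cases "x(i := y) \<in> ?S")
      case True
      have "(\<Sum>j<n. u j *\<^sub>R (x(i := y)) j) = u i *\<^sub>R y + (\<Sum>j\<in>I. u j *\<^sub>R (x(i := y)) j)"
        unfolding I(3) using I(1,2) by simp
      also have "(\<Sum>j\<in>I. u j *\<^sub>R (x(i := y)) j) = (\<Sum>j\<in>I. u j *\<^sub>R x j)"
        using I(2) by (intro sum.cong) auto
      finally have "norm (b + u i *\<^sub>R y) \<le> t" using True by (simp add: b_def algebra_simps)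
      moreover have "b + u i *\<^sub>R y = u i *\<^sub>R (y - q)" using ui by (simp add: q_def algebra_simps)
      ultimately have "\<bar>u i\<bar> * norm (y - q) \<le> t" by simp
      moreover have "\<delta> * norm (y - q) \<le> \<bar>u i\<bar> * norm (y - q)" using i by (intro mult_right_mono) auto
      ultimately have "dist q y \<le> t / \<delta>" using \<open>\<delta> > 0\<close> by (simp add: field_simps dist_norm norm_minus_commute)
      then show ?thesis by (simp add: indicator_def)
    qed simp
    then have "(\<integral>\<^sup>+ y. indicator ?S (x(i := y)) \<partial>unif) \<le> (\<integral>\<^sup>+ y. indicator (cball q (t / \<delta>)) y \<partial>unif)"
      by (intro nn_integral_mono) auto
    also have "\<dots> \<le> ennreal ((t / \<delta>) ^ DIM('f))"
      using emeasure_unif_cball[of "t / \<delta>" q] assms by simp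
    finally show "(\<integral>\<^sup>+ y. indicator ?S (x(i := y)) \<partial>unif) \<le> ennreal ((t / \<delta>) ^ DIM('f))" .
  qed
  also have "\<dots> = ennreal ((t / \<delta>) ^ DIM('f))" by (simp add: P.emeasure_space_1)
  finally show ?thesis .
qed

text \<open>Vanishing \<open>k\<close>-dimensional Hausdorff measure of \<open>Z\<close>, with an
  arbitrary function \<open>D\<close> in the place of a metric. The numbers \<open>d i\<close> bound
  the diameters, and only the part of \<open>C i\<close> inside \<open>Z\<close> is measured, so
  that estimates of \<open>D\<close> on \<open>Z\<close> suffice.\<close>

definition null_cover :: "nat \<Rightarrow> ('z \<Rightarrow> 'z \<Rightarrow> real) \<Rightarrow> 'z set \<Rightarrow> bool" where
  "null_cover k D Z \<longleftrightarrow> (\<forall>\<eta>>0. \<exists>(C :: nat \<Rightarrow> 'z set) d. Z \<subseteq> (\<Union>i. C i) \<and> (\<forall>i. 0 \<le> d i) \<and>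
     (\<forall>i. \<forall>z\<in>C i \<inter> Z. \<forall>z'\<in>C i \<inter> Z. D z z' \<le> d i) \<and> (\<Sum>i. ennreal (d i ^ k)) \<le> ennreal \<eta>)"

text \<open>Rescaling the diameters by \<open>C\<close> multiplies the sum by \<open>C ^ k\<close>;
  the added 1 keeps the denominator positive when \<open>C\<close> is 0.\<close>

lemma suminf_scale_le:
  assumes "(\<Sum>i. ennreal (d i ^ k)) \<le> ennreal (\<eta> / (C ^ k + 1))" "C \<ge> 0" "\<eta> > 0" "\<And>i. d i \<ge> (0::real)"
  shows "(\<Sum>i. ennreal ((C * d i) ^ k)) \<le> ennreal \<eta>"
proof -
  have "(\<Sum>i. ennreal ((C * d i) ^ k)) = ennreal (C ^ k) * (\<Sum>i. ennreal (d i ^ k))"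
    using assms by (simp add: power_mult_distrib ennreal_mult)
  also have "\<dots> \<le> ennreal (C ^ k) * ennreal (\<eta> / (C ^ k + 1))"
    using assms(1) by (rule mult_left_mono) simp
  also have "\<dots> = ennreal (C ^ k * (\<eta> / (C ^ k + 1)))"
    using assms by (intro ennreal_mult[symmetric]) auto
  also have "\<dots> \<le> ennreal \<eta>"
  proof (rule ennreal_leI)
    have "C ^ k * \<eta> \<le> \<eta> * (C ^ k + 1)" using assms by (simp add: algebra_simps)
    moreover have "C ^ k + 1 > 0" using assms(2) by (simp add: add_nonneg_pos)
    ultimately show "C ^ k * (\<eta> / (C ^ k + 1)) \<le> \<eta>" by (simp add: pos_divide_le_eq)
  qed
  finally show ?thesis .
qed

lemma null_cover_mono:
  assumes nc: "null_cover k D Z" and "Z' \<subseteq> Z" "C \<ge> 0"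
    and le: "\<And>z z'. z \<in> Z' \<Longrightarrow> z' \<in> Z' \<Longrightarrow> D' z z' \<le> C * D z z'"
  shows "null_cover k D' Z'"
  unfolding null_cover_def
proof (intro allI impI)
  fix \<eta> :: real assume "\<eta> > 0"
  have "C ^ k + 1 > 0" using assms(3) by (simp add: add_nonneg_pos)
  then have ep: "\<eta> / (C ^ k + 1) > 0" using \<open>\<eta> > 0\<close> by simp
  obtain W d where W': "Z \<subseteq> (\<Union>i::nat. W i)" "\<forall>i. 0 \<le> d i"
    "\<forall>i. \<forall>z\<in>W i \<inter> Z. \<forall>z'\<in>W i \<inter> Z. D z z' \<le> d i" "(\<Sum>i. ennreal (d i ^ k)) \<le> ennreal (\<eta> / (C ^ k + 1))"
    using nc[unfolded null_cover_def, THEN spec, THEN mp, OF ep] by (elim exE conjE) (rule that)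
  note W = W'(1) W'(2,3)[rule_format] W'(4)
  show "\<exists>(W :: nat \<Rightarrow> 'a set) d. Z' \<subseteq> (\<Union>i. W i) \<and> (\<forall>i. 0 \<le> d i) \<and>
     (\<forall>i. \<forall>z\<in>W i \<inter> Z'. \<forall>z'\<in>W i \<inter> Z'. D' z z' \<le> d i) \<and> (\<Sum>i. ennreal (d i ^ k)) \<le> ennreal \<eta>"
  proof (intro exI[of _ W] exI[of _ "\<lambda>i. C * d i"] conjI allI ballI)
    show "Z' \<subseteq> (\<Union>i. W i)" using W(1) assms(2) by blast
    show "0 \<le> C * d i" for i using W(2) assms(3) by simp
    fix i z z' assume z: "z \<in> W i \<inter> Z'" "z' \<in> W i \<inter> Z'"
    then have "D z z' \<le> d i" using W(3)[of z i z'] assms(2) by blast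
    then have "C * D z z' \<le> C * d i" using assms(3) by (rule mult_left_mono)
    then show "D' z z' \<le> C * d i" using le[of z z'] z by force
  qed (rule suminf_scale_le[OF W(4) assms(3) \<open>\<eta> > 0\<close> W(2)])
qed

text \<open>The \<open>N ^ card B\<close> cells of a grid have size at most \<open>c / N\<close> in
  the sum distance, so the total is at most \<open>c ^ k / N\<close> because
  \<open>card B < k\<close>.\<close>

lemma null_cover_grid:
  fixes \<phi> :: "'b \<Rightarrow> 'z \<Rightarrow> real"
  assumes B: "finite B" "card B < k" and bd: "\<And>b z. b \<in> B \<Longrightarrow> z \<in> Z \<Longrightarrow> \<bar>\<phi> b z\<bar> \<le> R"
  shows "null_cover k (\<lambda>z z'. \<Sum>b\<in>B. \<bar>\<phi> b z - \<phi> b z'\<bar>) Z"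
  unfolding null_cover_def
proof (intro allI impI)
  fix \<eta> :: real assume eta: "\<eta> > 0"
  \<comment> \<open>The summand 1 puts the rescaled coordinates \<open>w\<close> strictly below 1,
    so that cell indices stay below \<open>N\<close>, and it keeps \<open>S\<close> positive when
    \<open>R\<close> is 0.\<close>
  define S where "S = 2 * \<bar>R\<bar> + 1"
  have S: "S > 0" by (simp add: S_def)
  define c where "c = real (card B) * S"
  have c: "c \<ge> 0" using S by (simp add: c_def)
  obtain N :: nat where N: "N > 0" "c ^ k / \<eta> < real N"
  proof -
    obtain N :: nat where "c ^ k / \<eta> < real N" using reals_Archimedean2 by blast
    then show ?thesis using that[of "Suc N"] by auto
  qed
  define w where "w b z = (\<phi> b z + \<bar>R\<bar>) / S" for b z
  define \<kappa> where "\<kappa> z = (\<lambda>b\<in>B. nat \<lfloor>real N * w b z\<rfloor>)" for z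
  have w01: "0 \<le> w b z" "w b z < 1" if "b \<in> B" "z \<in> Z" for b z
    using bd[OF that] S by (auto simp: w_def S_def)
  have \<kappa>: "\<kappa> z \<in> PiE B (\<lambda>_. {..<N})" if "z \<in> Z" for z
  proof (rule PiE_I)
    fix b assume b: "b \<in> B"
    have "real N * w b z < real N" using w01[OF b that] N(1) by simp
    then have "\<lfloor>real N * w b z\<rfloor> < int N" by linarith
    then show "\<kappa> z b \<in> {..<N}" using b N(1) by (simp add: \<kappa>_def nat_less_iff)
  qed (simp add: \<kappa>_def)
  define P where "P = PiE B (\<lambda>_. {..<N})"
  have P: "finite P" "card P = N ^ card B" using B(1) by (auto simp: P_def card_PiE finite_PiE)
  obtain h where h: "bij_betw h {0..<card P} P" using ex_bij_betw_nat_finite[OF P(1)] by blast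
  \<comment> \<open>Indices from \<open>card P\<close> on carry the empty set and the bound 0; they
    add nothing to the sum because \<open>k\<close> is positive.\<close>
  define C where "C i = {z. i < card P \<and> \<kappa> z = h i}" for i
  define d where "d i = (if i < card P then c / real N else 0)" for i
  show "\<exists>(C :: nat \<Rightarrow> 'z set) d. Z \<subseteq> (\<Union>i. C i) \<and> (\<forall>i. 0 \<le> d i) \<and>
     (\<forall>i. \<forall>z\<in>C i \<inter> Z. \<forall>z'\<in>C i \<inter> Z. (\<Sum>b\<in>B. \<bar>\<phi> b z - \<phi> b z'\<bar>) \<le> d i) \<and> (\<Sum>i. ennreal (d i ^ k)) \<le> ennreal \<eta>"
  proof (intro exI[of _ C] exI[of _ d] conjI allI ballI)
    show "Z \<subseteq> (\<Union>i. C i)"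
    proof
      fix z assume "z \<in> Z"
      then have "\<kappa> z \<in> h ` {0..<card P}" using \<kappa> h by (simp add: bij_betw_def P_def)
      then show "z \<in> (\<Union>i. C i)" by (auto simp: C_def)
    qed
    show "0 \<le> d i" for i using c by (simp add: d_def)
    fix i z z' assume z: "z \<in> C i \<inter> Z" "z' \<in> C i \<inter> Z"
    have "\<bar>\<phi> b z - \<phi> b z'\<bar> \<le> S / real N" if b: "b \<in> B" for b
    proof -
      have "\<kappa> z b = \<kappa> z' b" using z by (simp add: C_def)
      then have "\<lfloor>real N * w b z\<rfloor> = \<lfloor>real N * w b z'\<rfloor>"
        using w01[OF b] z b by (simp add: \<kappa>_def eq_nat_nat_iff)
      then have "\<bar>real N * w b z - real N * w b z'\<bar> \<le> 1" by linarith
      moreover have "real N * w b z - real N * w b z' = (real N / S) * (\<phi> b z - \<phi> b z')"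
        by (simp add: w_def algebra_simps diff_divide_distrib[symmetric])
      ultimately have "real N / S * \<bar>\<phi> b z - \<phi> b z'\<bar> \<le> 1" using S by (simp add: abs_mult)
      then show ?thesis using S N(1) by (simp add: field_simps)
    qed
    then have "(\<Sum>b\<in>B. \<bar>\<phi> b z - \<phi> b z'\<bar>) \<le> real (card B) * (S / real N)"
      by (intro sum_bounded_above) auto
    then show "(\<Sum>b\<in>B. \<bar>\<phi> b z - \<phi> b z'\<bar>) \<le> d i" using z by (simp add: C_def d_def c_def)
  next
    have k0: "k > 0" using B(2) by simp
    have "(\<Sum>i. ennreal (d i ^ k)) = (\<Sum>i<card P. ennreal (d i ^ k))"
      by (rule suminf_finite) (use k0 in \<open>auto simp: d_def\<close>)
    also have "\<dots> = ennreal (real (card P) * (c / real N) ^ k)"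
      using c by (simp add: d_def ennreal_of_nat_eq_real_of_nat ennreal_mult)
    also have "\<dots> \<le> ennreal \<eta>"
    proof (rule ennreal_leI)
      have "real N ^ Suc (card B) \<le> real N ^ k" using B(2) N(1) by (intro power_increasing) auto
      then have 1: "real N ^ card B * real N \<le> real N ^ k" by (simp add: mult.commute)
      have "real (card P) * (c / real N) ^ k * real N = (real N ^ card B * real N) * (c ^ k / real N ^ k)"
        by (simp add: P(2) power_divide)
      also have "\<dots> \<le> real N ^ k * (c ^ k / real N ^ k)" using 1 c by (intro mult_right_mono) auto
      also have "\<dots> = c ^ k" using N(1) by simp
      also have "\<dots> \<le> \<eta> * real N" using N(2) eta by (simp add: field_simps)
      finally show "real (card P) * (c / real N) ^ k \<le> \<eta>" using N(1) by simp
    qed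
    finally show "(\<Sum>i. ennreal (d i ^ k)) \<le> ennreal \<eta>" .
  qed
qed

text \<open>Some exponent \<open>s < k\<close> has vanishing Hausdorff measure. For diameters at
  most 1 the power \<open>k\<close> is below the power \<open>s\<close>, and at scales below
  \<open>\<delta>\<close> the Lipschitz estimate transfers the cover to \<open>D\<close>.\<close>

lemma null_cover_hausdorff:
  assumes dim: "hausdorff_dim \<rho> X < of_nat k" and "\<delta> > 0" "C \<ge> 0"
    and lip: "\<And>x y. \<rho> x y < \<delta> \<Longrightarrow> D x y \<le> C * \<rho> x y"
  shows "null_cover k D X"
  unfolding null_cover_def
proof (intro allI impI)
  fix \<eta> :: real assume eta: "\<eta> > 0"
  obtain s where s: "0 < s" "hausdorff_measure \<rho> s X = 0" "ennreal s < of_nat k"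
    using dim unfolding hausdorff_dim_def INF_less_iff by auto
  have sk: "s < real k" using s by (simp add: ennreal_of_nat_eq_real_of_nat ennreal_less_iff)
  define \<delta>' where "\<delta>' = min (\<delta> / 2) 1"
  have d': "\<delta>' > 0" "\<delta>' < \<delta>" "\<delta>' \<le> 1" using \<open>\<delta> > 0\<close> by (auto simp: \<delta>'_def)
  have "hausdorff_premeasure \<rho> s \<delta>' X \<le> hausdorff_measure \<rho> s X"
    unfolding hausdorff_measure_def by (rule SUP_upper) (use d' in auto)
  then have "hausdorff_premeasure \<rho> s \<delta>' X = 0" using s(2) by simp
  moreover have ep: "C ^ k + 1 > 0" using \<open>C \<ge> 0\<close> by (simp add: add_nonneg_pos)
  ultimately have "hausdorff_premeasure \<rho> s \<delta>' X < ennreal (\<eta> / (C ^ k + 1))" using eta by simp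
  then obtain W where W: "X \<subseteq> (\<Union>i::nat. W i)" "\<And>i x y. x \<in> W i \<Longrightarrow> y \<in> W i \<Longrightarrow> \<rho> x y \<le> \<delta>'"
    and Ws: "(\<Sum>i. ennreal (set_diam \<rho> (W i) powr s)) < ennreal (\<eta> / (C ^ k + 1))"
    unfolding hausdorff_premeasure_def INF_less_iff by auto
  have bdd: "bdd_above ((\<lambda>(x, y). \<rho> x y) ` (W i \<times> W i))" for i
    using W(2) by (intro bdd_aboveI2[of _ _ \<delta>']) auto
  have diam: "\<rho> x y \<le> set_diam \<rho> (W i)" if "x \<in> W i" "y \<in> W i" for x y i
    using that cSUP_upper[OF _ bdd[of i], of "(x, y)"] by (auto simp: set_diam_def)
  have diam1: "set_diam \<rho> (W i) \<le> 1" for i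
  proof (cases "W i = {}")
    case False
    then show ?thesis using W(2)[of _ i] d'(3)
      by (auto simp: set_diam_def intro!: cSUP_least intro: order_trans)
  qed (simp add: set_diam_def)
  \<comment> \<open>Here \<open>\<rho>\<close> is an arbitrary function whose supremum may be
    negative, whereas the bounds of a cover are nonnegative.\<close>
  define d where "d i = max 0 (set_diam \<rho> (W i))" for i
  have le: "d i ^ k \<le> set_diam \<rho> (W i) powr s" for i
  proof (cases "set_diam \<rho> (W i) > 0")
    case True
    then have "d i ^ k = set_diam \<rho> (W i) powr real k" by (simp add: d_def powr_realpow)
    also have "\<dots> \<le> set_diam \<rho> (W i) powr s" using True diam1 sk by (intro powr_mono') auto
    finally show ?thesis .
  next
    case False
    then show ?thesis using s(1) sk by (cases k) (auto simp: d_def)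
  qed
  have "(\<Sum>i. ennreal (d i ^ k)) \<le> (\<Sum>i. ennreal (set_diam \<rho> (W i) powr s))"
    by (intro suminf_le ennreal_leI le) auto
  then have sum: "(\<Sum>i. ennreal (d i ^ k)) \<le> ennreal (\<eta> / (C ^ k + 1))" using Ws by simp
  show "\<exists>(W :: nat \<Rightarrow> 'a set) d. X \<subseteq> (\<Union>i. W i) \<and> (\<forall>i. 0 \<le> d i) \<and>
     (\<forall>i. \<forall>z\<in>W i \<inter> X. \<forall>z'\<in>W i \<inter> X. D z z' \<le> d i) \<and> (\<Sum>i. ennreal (d i ^ k)) \<le> ennreal \<eta>"
  proof (intro exI[of _ W] exI[of _ "\<lambda>i. C * d i"] conjI allI ballI W(1))
    show "0 \<le> C * d i" for i using \<open>C \<ge> 0\<close> by (simp add: d_def)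
    fix i z z' assume z: "z \<in> W i \<inter> X" "z' \<in> W i \<inter> X"
    then have "D z z' \<le> C * \<rho> z z'" using lip W(2)[of z i z'] d'(2) by force
    also have "\<dots> \<le> C * d i" using diam[of z i z'] z \<open>C \<ge> 0\<close> by (intro mult_left_mono) (auto simp: d_def)
    finally show "D z z' \<le> C * d i" .
  qed (rule suminf_scale_le[OF sum \<open>C \<ge> 0\<close> eta], simp add: d_def)
qed

text \<open>A zero at some \<open>w\<close> in the piece \<open>C i\<close> makes the value at the
  chosen point \<open>z i\<close> at most \<open>(n + 1) * d i\<close>, as the vectors
  \<open>L j\<close> have norm at most 1. This has probability at most
  \<open>(K * d i) ^ DIM('f)\<close>, and the cover makes the sum of these arbitrarily
  small.\<close>

lemma AE_nonvanishing:
  fixes a :: "'z \<Rightarrow> 'f::euclidean_space" and u :: "nat \<Rightarrow> 'z \<Rightarrow> real"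
  assumes nc: "null_cover DIM('f) D Z" and "\<delta> > 0"
    and lip: "\<And>z z'. z \<in> Z \<Longrightarrow> z' \<in> Z \<Longrightarrow> norm (a z - a z') \<le> D z z'"
      "\<And>i z z'. i < n \<Longrightarrow> z \<in> Z \<Longrightarrow> z' \<in> Z \<Longrightarrow> \<bar>u i z - u i z'\<bar> \<le> D z z'"
    and big: "\<And>z. z \<in> Z \<Longrightarrow> \<exists>i<n. \<bar>u i z\<bar> \<ge> \<delta>"
  shows "AE L in coeff_measure n. \<forall>z\<in>Z. a z + (\<Sum>i<n. u i z *\<^sub>R L i) \<noteq> 0"
proof -
  let ?M = "coeff_measure n :: (nat \<Rightarrow> 'f) measure"
  \<comment> \<open>\<open>Suc n\<close> counts \<open>a\<close> and the \<open>n\<close> functions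
    \<open>u j\<close>; the division by \<open>\<delta>\<close> comes from the small-ball
    estimate.\<close>
  define K where "K = real (Suc n) / \<delta>"
  have K: "K \<ge> 0" using \<open>\<delta> > 0\<close> by (simp add: K_def)
  have Kp: "K ^ DIM('f) + 1 > 0" using K by (simp add: add_nonneg_pos)
  \<comment> \<open>The bad event is a union over the possibly uncountable \<open>Z\<close> and need
    not be measurable. It is enclosed in measurable sets of arbitrarily small measure, which are
    intersected at the end.\<close>
  have "\<exists>N\<in>sets ?M. emeasure ?M N \<le> ennreal \<eta> \<and>
      (\<forall>L\<in>space ?M. (\<forall>i<n. norm (L i) \<le> 1) \<longrightarrow> (\<exists>z\<in>Z. a z + (\<Sum>i<n. u i z *\<^sub>R L i) = 0) \<longrightarrow> L \<in> N)"
    if eta: "\<eta> > 0" for \<eta>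
  proof -
    obtain C d where C': "Z \<subseteq> (\<Union>i::nat. C i)" "\<forall>i. 0 \<le> d i"
      "\<forall>i. \<forall>z\<in>C i \<inter> Z. \<forall>z'\<in>C i \<inter> Z. D z z' \<le> d i"
      "(\<Sum>i. ennreal (d i ^ DIM('f))) \<le> ennreal (\<eta> / (K ^ DIM('f) + 1))"
      using nc[unfolded null_cover_def, THEN spec, THEN mp, OF divide_pos_pos[OF eta Kp]]
      by (elim exE conjE) (rule that)
    note C = C'(1) C'(2,3)[rule_format] C'(4)
    define z where "z i = (SOME z. z \<in> C i \<inter> Z)" for i
    have z: "z i \<in> C i \<inter> Z" if "C i \<inter> Z \<noteq> {}" for i unfolding z_def using that by (metis ex_in_conv someI)
    define b where "b i = (if C i \<inter> Z = {} then {} else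
      {L \<in> space ?M. norm (a (z i) + (\<Sum>j<n. u j (z i) *\<^sub>R L j)) \<le> real (Suc n) * d i})" for i
    have "{L \<in> space ?M. norm (a (z i) + (\<Sum>j<n. u j (z i) *\<^sub>R L j)) \<le> real (Suc n) * d i} \<in> sets ?M" for i
      by measurable
    then have bm: "b i \<in> sets ?M" for i by (simp add: b_def)
    have be: "emeasure ?M (b i) \<le> ennreal ((K * d i) ^ DIM('f))" for i
    proof (cases "C i \<inter> Z = {}")
      case False
      obtain j where j: "j < n" "\<bar>u j (z i)\<bar> \<ge> \<delta>" using big z[OF False] by blast
      have "emeasure ?M (b i) \<le> ennreal ((real (Suc n) * d i / \<delta>) ^ DIM('f))"
        unfolding b_def using False
        by (simp only: if_False)
          (rule small_ball_probability[where u = "\<lambda>j. u j (z i)", OF j \<open>\<delta> > 0\<close>], use C(2) in simp)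
      then show ?thesis by (simp add: K_def)
    qed (simp add: b_def)
    have "emeasure ?M (\<Union>i. b i) \<le> (\<Sum>i. emeasure ?M (b i))"
      by (rule emeasure_subadditive_countably) (use bm in auto)
    also have "\<dots> \<le> (\<Sum>i. ennreal ((K * d i) ^ DIM('f)))" by (intro suminf_le be) auto
    also have "\<dots> \<le> ennreal \<eta>" by (rule suminf_scale_le[OF C(4) K eta C(2)])
    finally have 1: "emeasure ?M (\<Union>i. b i) \<le> ennreal \<eta>" .
    have 2: "L \<in> (\<Union>i. b i)" if L: "L \<in> space ?M" "\<forall>i<n. norm (L i) \<le> 1"
      and w: "w \<in> Z" "a w + (\<Sum>i<n. u i w *\<^sub>R L i) = 0" for L w
    proof -
      obtain i where i: "w \<in> C i" using C(1) w(1) by blast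
      then have ne: "C i \<inter> Z \<noteq> {}" using w by blast
      note zi = z[OF ne]
      have Dd: "D (z i) w \<le> d i" using C(3)[OF zi, of w] i w by blast
      have "a (z i) + (\<Sum>j<n. u j (z i) *\<^sub>R L j) = (a (z i) - a w) + (\<Sum>j<n. (u j (z i) - u j w) *\<^sub>R L j)"
        using w(2) by (simp add: scaleR_diff_left sum_subtractf algebra_simps)
      also have "norm \<dots> \<le> norm (a (z i) - a w) + norm (\<Sum>j<n. (u j (z i) - u j w) *\<^sub>R L j)"
        by (rule norm_triangle_ineq)
      also have "norm (\<Sum>j<n. (u j (z i) - u j w) *\<^sub>R L j) \<le> real (card {..<n}) * d i"
      proof (rule sum_norm_bound)
        fix j assume "j \<in> {..<n}"
        then have "\<bar>u j (z i) - u j w\<bar> \<le> d i" "norm (L j) \<le> 1"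
          using lip(2)[of j "z i" w] zi w Dd L(2) by force+
        then show "norm ((u j (z i) - u j w) *\<^sub>R L j) \<le> d i"
          using mult_mono[of "\<bar>u j (z i) - u j w\<bar>" "d i" "norm (L j)" 1] C(2)[of i] by simp
      qed
      also have "norm (a (z i) - a w) \<le> d i" using lip(1)[of "z i" w] zi w Dd by force
      finally have "norm (a (z i) + (\<Sum>j<n. u j (z i) *\<^sub>R L j)) \<le> real (Suc n) * d i"
        by (simp add: algebra_simps)
      then have "L \<in> b i" using ne L(1) by (simp add: b_def)
      then show ?thesis by blast
    qed
    show ?thesis using bm 1 2 by (intro bexI[of _ "\<Union>i. b i"]) blast+
  qed
  then have "\<forall>m::nat. \<exists>N\<in>sets ?M. emeasure ?M N \<le> ennreal (inverse (real (Suc m))) \<and>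
      (\<forall>L\<in>space ?M. (\<forall>i<n. norm (L i) \<le> 1) \<longrightarrow> (\<exists>z\<in>Z. a z + (\<Sum>i<n. u i z *\<^sub>R L i) = 0) \<longrightarrow> L \<in> N)"
    by simp
  then obtain N where N: "\<And>m. N m \<in> sets ?M" "\<And>m. emeasure ?M (N m) \<le> ennreal (inverse (real (Suc m)))"
    "\<And>m L. L \<in> space ?M \<Longrightarrow> (\<forall>i<n. norm (L i) \<le> 1) \<Longrightarrow> (\<exists>z\<in>Z. a z + (\<Sum>i<n. u i z *\<^sub>R L i) = 0) \<Longrightarrow> L \<in> N m"
    by metis
  have Nm: "(\<Inter>m. N m) \<in> sets ?M" using N(1) by auto
  have "(\<lambda>m. ennreal (inverse (real (Suc m)))) \<longlonglongrightarrow> ennreal 0"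
    by (intro tendsto_ennrealI LIMSEQ_inverse_real_of_nat)
  moreover have "emeasure ?M (\<Inter>m. N m) \<le> ennreal (inverse (real (Suc m)))" for m
    using emeasure_mono[of "\<Inter>m. N m" "N m" ?M] N(1,2) by (meson INT_lower UNIV_I order_trans)
  ultimately have "emeasure ?M (\<Inter>m. N m) \<le> ennreal 0"
    by (intro LIMSEQ_le_const) auto
  then have "(\<Inter>m. N m) \<in> null_sets ?M" using Nm by (simp add: null_sets_def)
  then have "AE L in ?M. L \<notin> (\<Inter>m. N m)" by (rule AE_not_in)
  with AE_coeff AE_space show ?thesis
  proof eventually_elim
    case (elim L)
    show ?case
    proof (intro ballI notI)
      fix z assume "z \<in> Z" "a z + (\<Sum>i<n. u i z *\<^sub>R L i) = 0"
      then have "L \<in> N m" for m using N(3)[OF elim(2,1)] by blast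
      then show False using elim(3) by blast
    qed
  qed
qed

section \<open>Almost every probe is good at a given point\<close>

text \<open>Injectivity on \<open>E\<close> bounds \<open>T\<close> below by a positive factor; near
  \<open>x\<close> the remainder of the derivative consumes at most half of it.\<close>

lemma has_derivative_lower_bound:
  fixes f :: "'e::euclidean_space \<Rightarrow> 'f::euclidean_space"
  assumes E: "subspace E" "S \<subseteq> E" "x \<in> S" and der: "(f has_derivative T) (at x within S)"
    and inj: "\<And>w. w \<in> E \<Longrightarrow> T w = 0 \<Longrightarrow> w = 0"
  obtains e d where "e > 0" "d > 0" "\<And>y. y \<in> S \<Longrightarrow> norm (y - x) < d \<Longrightarrow> e * norm (y - x) \<le> norm (f y - f x)"
proof -
  have bl: "bounded_linear T" using der by (rule has_derivative_bounded_linear)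
  obtain e where e: "e > 0" "\<And>w. w \<in> E \<Longrightarrow> norm (T w) \<ge> e * norm w"
    using injective_imp_isometric[OF closed_subspace[OF E(1)] E(1) bl] inj by blast
  obtain d where d: "d > 0" "\<And>y. y \<in> S \<Longrightarrow> norm (y - x) < d \<Longrightarrow> norm (f y - f x - T (y - x)) \<le> e / 2 * norm (y - x)"
    using der e(1) unfolding has_derivative_within_alt by (meson half_gt_zero)
  show ?thesis
  proof (rule that[of "e / 2" d])
    fix y assume y: "y \<in> S" "norm (y - x) < d"
    have "y - x \<in> E" using y(1) E by (auto intro: subspace_diff)
    then have "e * norm (y - x) \<le> norm (T (y - x))" by (rule e(2))
    also have "\<dots> \<le> norm (f y - f x) + norm (f y - f x - T (y - x))"
      using norm_triangle_ineq4[of "f y - f x" "f y - f x - T (y - x)"] by simp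
    also have "\<dots> \<le> norm (f y - f x) + e / 2 * norm (y - x)" using d(2)[OF y] by simp
    finally show "e / 2 * norm (y - x) \<le> norm (f y - f x)" by (simp add: field_simps)
  qed (use e d in auto)
qed

text \<open>Dividing by \<open>Suc n\<close> rather than \<open>n\<close> makes the contradiction
  strict and is meaningful for \<open>n = 0\<close>.\<close>

lemma finite_sum_ge_imp:
  fixes a :: "nat \<Rightarrow> real"
  assumes "(\<Sum>i<n. a i) \<ge> s" "s > 0"
  shows "\<exists>i<n. a i \<ge> s / real (Suc n)"
proof (rule ccontr)
  assume "\<not> ?thesis"
  then have "(\<Sum>i<n. a i) \<le> real (card {..<n}) * (s / real (Suc n))"
    by (intro sum_bounded_above) (auto simp: not_le intro: less_imp_le)
  also have "\<dots> < s" using assms(2) by (simp add: field_simps)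
  finally show False using assms(1) by simp
qed

section \<open>The derivative and the collisions of a random perturbation at a fixed point\<close>

context cr_embedded
begin

abbreviation perturbed :: "('m \<Rightarrow> 'f::euclidean_space) \<Rightarrow> (nat \<Rightarrow> 'f) \<Rightarrow> 'm \<Rightarrow> 'f" where
  "perturbed v L x \<equiv> v x + probe L x"

lemma perturbed_Cr: "v \<in> Cr_functions r E A \<Longrightarrow> perturbed v L \<in> Cr_functions r E A"
  using Cr_functions_add probe_Cr by blast

lemma perturbed_diff:
  "perturbed v L y - perturbed v L x = (v y - v x) + (\<Sum>i<n. (f i y - f i x) *\<^sub>R L i)"
  by (simp add: probe_def scaleR_diff_left sum_subtractf)

text \<open>The infinitesimal form of \<open>dd_lower\<close>: the estimate along a line is divided
  by \<open>t\<close>, and \<open>t\<close> tends to 0. It expresses that the \<open>f i\<close>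
  form an immersion.\<close>

lemma coordinate_derivatives_injective:
  assumes "((U, c), p, R) \<in> J" "x \<in> chart_ball ((U, c), p, R)"
  obtains C where "C > 0" "\<And>w. w \<in> E \<Longrightarrow>
    norm w \<le> C * (\<Sum>i<n. \<bar>frechet_derivative (\<lambda>y. f i (inv_into U c y)) (at (c x) within c ` U) w\<bar>)"
proof -
  have U: "(U, c) \<in> A" using good[OF assms(1)] by (auto simp: good_ball_def)
  have xU: "x \<in> U" using assms(2) by (auto simp: chart_ball_def)
  let ?D = "\<lambda>i. frechet_derivative (\<lambda>y. f i (inv_into U c y)) (at (c x) within c ` U)"
  obtain C where C: "C \<ge> 0" "\<And>x y. x \<in> chart_cball ((U, c), p, R) \<Longrightarrow> y \<in> chart_cball ((U, c), p, R) \<Longrightarrow>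
    norm (c x - c y) \<le> C * dd x y" using dd_lower[OF assms(1)] by blast
  have bU: "chart_ball ((U, c), p, R) \<subseteq> U" by (auto simp: chart_ball_def)
  have op: "openin (top_of_set E) (c ` chart_ball ((U, c), p, R))"
    using openin_chart_image[OF U open_chart_ball[OF U] bU] .
  have main: "norm w \<le> (C + 1) * (\<Sum>i<n. \<bar>?D i w\<bar>)" if w: "w \<in> E" for w
  proof -
    obtain d where d: "d > 0" "\<And>t. \<bar>t\<bar> < d \<Longrightarrow> c x + t *\<^sub>R w \<in> c ` chart_ball ((U, c), p, R)"
      using openin_subspace_line[OF E op _ w, of "c x"] assms(2) by blast
    define g where "g t = (\<Sum>i<n. \<bar>f i (inv_into U c (c x + t *\<^sub>R w)) - f i x\<bar>)" for t
    have lower: "norm w * \<bar>t\<bar> \<le> C * g t" if t: "\<bar>t\<bar> < d" for t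
    proof -
      obtain z where z: "z \<in> chart_ball ((U, c), p, R)" "c x + t *\<^sub>R w = c z" using d(2)[OF t] by blast
      have "norm (c z - c x) \<le> C * dd z x" using C(2) z(1) assms(2) chart_ball_subset by blast
      moreover have "c z - c x = t *\<^sub>R w" using z(2) by (simp add: algebra_simps)
      moreover have "inv_into U c (c z) = z" using chart_inv(4)[OF U] z(1) bU by auto
      ultimately show ?thesis using z(2) by (simp add: g_def dd_def mult.commute)
    qed
    have lim: "((\<lambda>t::real. \<Sum>i<n. \<bar>(f i (inv_into U c (c x + t *\<^sub>R w)) - f i x) / t\<bar>) \<longlongrightarrow> (\<Sum>i<n. \<bar>?D i w\<bar>)) (at 0)"
    proof (intro tendsto_sum tendsto_rabs)
      fix i assume i: "i \<in> {..<n}"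
      have "((\<lambda>t. f i (inv_into U c (c x + t *\<^sub>R w))) has_vector_derivative ?D i w) (at 0)"
        using has_derivative_along_line[OF E chart(2)[OF U] _ w Cr_on_has_derivative[OF Cr_functions_chart[OF f_Cr U] r1]] xU i
        by blast
      then have "((\<lambda>t. f i (inv_into U c (c x + t *\<^sub>R w))) has_real_derivative ?D i w) (at 0)"
        by (simp add: has_real_derivative_iff_has_vector_derivative)
      then show "((\<lambda>t. (f i (inv_into U c (c x + t *\<^sub>R w)) - f i x) / t) \<longlongrightarrow> ?D i w) (at 0)"
        using chart_inv(4)[OF U xU] by (simp add: DERIV_def)
    qed
    have ev: "\<forall>\<^sub>F t in at (0::real). norm w \<le> C * (\<Sum>i<n. \<bar>(f i (inv_into U c (c x + t *\<^sub>R w)) - f i x) / t\<bar>)"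
      unfolding eventually_at
    proof (intro exI[of _ d] conjI d(1) ballI impI)
      fix t :: real assume t: "t \<noteq> 0 \<and> dist t 0 < d"
      have "(\<Sum>i<n. \<bar>(f i (inv_into U c (c x + t *\<^sub>R w)) - f i x) / t\<bar>) = g t / \<bar>t\<bar>"
        by (simp add: g_def sum_divide_distrib)
      moreover have "norm w \<le> C * g t / \<bar>t\<bar>" using lower[of t] t by (simp add: field_simps)
      ultimately show "norm w \<le> C * (\<Sum>i<n. \<bar>(f i (inv_into U c (c x + t *\<^sub>R w)) - f i x) / t\<bar>)" by simp
    qed
    have "norm w \<le> C * (\<Sum>i<n. \<bar>?D i w\<bar>)"
      by (rule tendsto_lowerbound[OF tendsto_mult[OF tendsto_const lim] ev at_neq_bot])
    also have "\<dots> \<le> (C + 1) * (\<Sum>i<n. \<bar>?D i w\<bar>)" by (intro mult_right_mono sum_nonneg) auto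
    finally show ?thesis .
  qed
  show ?thesis by (rule that[of "C + 1"]) (use C(1) main in auto)
qed

text \<open>A linear map fails to be injective on \<open>E\<close> iff it vanishes somewhere on one of the affine slices
  \<open>{w \<in> E. w \<bullet> b = 1}\<close>, and these have dimension less than \<open>dim E\<close>.\<close>

lemma AE_injective_derivative:
  fixes v :: "'m \<Rightarrow> 'f::euclidean_space"
  assumes v: "v \<in> Cr_functions r E A" and j: "((U, c), p, R) \<in> J" "x \<in> chart_ball ((U, c), p, R)"
    and dim: "dim E \<le> DIM('f)"
  shows "AE L in coeff_measure n. \<forall>w\<in>E. w \<noteq> 0 \<longrightarrow>
    frechet_derivative (\<lambda>y. v (inv_into U c y)) (at (c x) within c ` U) w +
    (\<Sum>i<n. frechet_derivative (\<lambda>y. f i (inv_into U c y)) (at (c x) within c ` U) w *\<^sub>R L i) \<noteq> 0"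
proof -
  have U: "(U, c) \<in> A" using good[OF j(1)] by (auto simp: good_ball_def)
  have xU: "c x \<in> c ` U" using j(2) by (auto simp: chart_ball_def)
  define Dv where "Dv = frechet_derivative (\<lambda>y. v (inv_into U c y)) (at (c x) within c ` U)"
  define D where "D i = frechet_derivative (\<lambda>y. f i (inv_into U c y)) (at (c x) within c ` U)" for i
  have blv: "bounded_linear Dv"
    unfolding Dv_def using Cr_on_has_derivative[OF Cr_functions_chart[OF v U] r1 xU] by (rule has_derivative_bounded_linear)
  have bl: "bounded_linear (D i)" if "i < n" for i
    unfolding D_def using Cr_on_has_derivative[OF Cr_functions_chart[OF f_Cr[OF that] U] r1 xU] by (rule has_derivative_bounded_linear)
  obtain C where C: "C > 0" "\<And>w. w \<in> E \<Longrightarrow> norm w \<le> C * (\<Sum>i<n. \<bar>D i w\<bar>)"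
    using coordinate_derivatives_injective[OF j] unfolding D_def by blast
  obtain B where B: "finite B" "B \<subseteq> E" "card B = dim E" "\<And>b. b \<in> B \<Longrightarrow> norm b = 1"
    "\<And>w. w \<in> E \<Longrightarrow> (\<Sum>b\<in>B. (w \<bullet> b) *\<^sub>R b) = w"
    using subspace_orthonormal_basis[OF E] by metis
  define K where "K = onorm Dv + (\<Sum>i<n. onorm (D i))"
  have on: "onorm (D i) \<ge> 0" if "i < n" for i using bl[OF that] by (rule onorm_pos_le)
  have K0: "K \<ge> 0" using onorm_pos_le[OF blv] on by (auto simp: K_def intro!: add_nonneg_nonneg sum_nonneg)
  have Kv: "norm (Dv w) \<le> K * norm w" for w
  proof -
    have "onorm Dv \<le> K" using on by (auto simp: K_def intro!: sum_nonneg)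
    then show ?thesis using onorm[OF blv, of w] by (meson mult_right_mono norm_ge_zero order_trans)
  qed
  have Ki: "\<bar>D i w\<bar> \<le> K * norm w" if i: "i < n" for i w
  proof -
    have "onorm (D i) \<le> (\<Sum>i<n. onorm (D i))" using i on by (intro member_le_sum) auto
    then have "onorm (D i) \<le> K" using onorm_pos_le[OF blv] by (simp add: K_def)
    then show ?thesis using onorm[OF bl[OF i], of w] by (metis mult_right_mono norm_ge_zero order_trans real_norm_def)
  qed
  \<comment> \<open>Grid covers need bounded coordinates, so each slice is cut into countably many
    bounded pieces.\<close>
  have slice: "AE L in coeff_measure n. \<forall>w\<in>{w \<in> E. w \<bullet> b = 1 \<and> norm w \<le> real m}. Dv w + (\<Sum>i<n. D i w *\<^sub>R L i) \<noteq> 0"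
    if b: "b \<in> B" for b m
  proof -
    let ?Z = "{w \<in> E. w \<bullet> b = 1 \<and> norm w \<le> real m}"
    let ?g = "\<lambda>w w'. \<Sum>b'\<in>B - {b}. \<bar>w \<bullet> b' - w' \<bullet> b'\<bar>"
    \<comment> \<open>The normalized coordinate \<open>b\<close> is fixed, which leaves
      \<open>dim E - 1\<close> free ones; hence \<open>dim E \<le> DIM('f)\<close> is
      enough.\<close>
    have card: "card (B - {b}) < DIM('f)" using B(1,3) b dim card_gt_0_iff[of B] by (auto simp: card_Diff_singleton)
    have le: "norm (w - w') \<le> ?g w w'" if ww: "w \<in> ?Z" "w' \<in> ?Z" for w w'
    proof -
      have wE: "w - w' \<in> E" using ww E by (auto intro: subspace_diff)
      have "w - w' = ((w - w') \<bullet> b) *\<^sub>R b + (\<Sum>b'\<in>B - {b}. ((w - w') \<bullet> b') *\<^sub>R b')"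
        using B(5)[OF wE] sum.remove[OF B(1) b, of "\<lambda>b'. ((w - w') \<bullet> b') *\<^sub>R b'"] by simp
      also have "\<dots> = (\<Sum>b'\<in>B - {b}. ((w - w') \<bullet> b') *\<^sub>R b')" using ww by (simp add: inner_diff_left)
      finally have "norm (w - w') = norm (\<Sum>b'\<in>B - {b}. ((w - w') \<bullet> b') *\<^sub>R b')" by simp
      also have "\<dots> \<le> ?g w w'" by (rule sum_norm_le) (use B(4) in \<open>simp add: inner_diff_left\<close>)
      finally show ?thesis .
    qed
    have "null_cover DIM('f) ?g ?Z"
    proof (rule null_cover_grid[OF _ card, of _ _ "real m"])
      fix b' w assume "b' \<in> B - {b}" "w \<in> ?Z"
      then show "\<bar>w \<bullet> b'\<bar> \<le> real m" using Cauchy_Schwarz_ineq2[of w b'] B(4)[of b'] by simp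
    qed (use B(1) in simp)
    then have nc: "null_cover DIM('f) (\<lambda>w w'. K * norm (w - w')) ?Z"
      by (rule null_cover_mono[OF _ subset_refl K0]) (use le K0 in \<open>auto intro: mult_left_mono\<close>)
    have linv: "Dv (w - w') = Dv w - Dv w'" for w w'
      using blv by (simp add: bounded_linear.linear linear_diff)
    have lini: "D i (w - w') = D i w - D i w'" if "i < n" for i w w'
      using bl[OF that] by (simp add: bounded_linear.linear linear_diff)
    show ?thesis
    proof (rule AE_nonvanishing[OF nc])
      show "1 / C / real (Suc n) > 0" using C(1) by simp
      show "norm (Dv w - Dv w') \<le> K * norm (w - w')" for w w' using Kv[of "w - w'"] linv by simp
      show "\<bar>D i w - D i w'\<bar> \<le> K * norm (w - w')" if "i < n" for i w w' using Ki[OF that, of "w - w'"] lini[OF that] by simp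
      fix w assume w: "w \<in> ?Z"
      have "1 \<le> norm w" using w Cauchy_Schwarz_ineq2[of w b] B(4)[OF b] by simp
      also have "\<dots> \<le> C * (\<Sum>i<n. \<bar>D i w\<bar>)" using C(2) w by blast
      finally have "1 / C \<le> (\<Sum>i<n. \<bar>D i w\<bar>)" using C(1) by (simp add: field_simps)
      then show "\<exists>i<n. 1 / C / real (Suc n) \<le> \<bar>D i w\<bar>" using C(1) by (intro finite_sum_ge_imp) auto
    qed
  qed
  have "AE L in coeff_measure n. \<forall>b\<in>B. \<forall>m::nat. \<forall>w\<in>{w \<in> E. w \<bullet> b = 1 \<and> norm w \<le> real m}. Dv w + (\<Sum>i<n. D i w *\<^sub>R L i) \<noteq> 0"
    using slice B(1) by (intro AE_finite_allI) (auto simp: AE_all_countable)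
  then show ?thesis
    unfolding Dv_def[symmetric] D_def[symmetric]
  proof eventually_elim
    case (elim L)
    show ?case
    proof (intro ballI impI notI)
      fix w assume w: "w \<in> E" "w \<noteq> 0" and z: "Dv w + (\<Sum>i<n. D i w *\<^sub>R L i) = 0"
      have "\<exists>b\<in>B. w \<bullet> b \<noteq> 0" using B(5)[OF w(1)] w(2) by (metis (no_types, lifting) scale_zero_left sum.neutral)
      then obtain b where b: "b \<in> B" "w \<bullet> b \<noteq> 0" by blast
      \<comment> \<open>Dividing by a nonzero coordinate moves \<open>w\<close> into a slice, and
        linearity preserves the vanishing.\<close>
      define s where "s = 1 / (w \<bullet> b)"
      have lv: "Dv (s *\<^sub>R w) = s *\<^sub>R Dv w" using blv by (simp add: bounded_linear.linear linear_scale)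
      have li: "D i (s *\<^sub>R w) = s * D i w" if "i < n" for i using bl[OF that] by (simp add: bounded_linear.linear linear_scale)
      obtain m :: nat where m: "norm (s *\<^sub>R w) \<le> real m" using real_arch_simple by blast
      have "s *\<^sub>R w \<in> {w \<in> E. w \<bullet> b = 1 \<and> norm w \<le> real m}"
        using w(1) b(2) m E by (simp add: s_def subspace_scale)
      then have "Dv (s *\<^sub>R w) + (\<Sum>i<n. D i (s *\<^sub>R w) *\<^sub>R L i) \<noteq> 0" using elim b(1) by blast
      moreover have "Dv (s *\<^sub>R w) + (\<Sum>i<n. D i (s *\<^sub>R w) *\<^sub>R L i) = s *\<^sub>R (Dv w + (\<Sum>i<n. D i w *\<^sub>R L i))"
        using lv li by (simp add: scaleR_add_right scaleR_sum_right)
      ultimately show False using z by simp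
    qed
  qed
qed

lemma AE_local_lower_bound:
  fixes v :: "'m \<Rightarrow> 'f::euclidean_space"
  assumes v: "v \<in> Cr_functions r E A" and dim: "dim E \<le> DIM('f)"
  shows "AE L in coeff_measure n. \<exists>W C. open W \<and> x \<in> W \<and> C \<ge> 0 \<and>
    (\<forall>y\<in>W. dd x y \<le> C * norm (perturbed v L x - perturbed v L y))"
proof -
  obtain U c p R where j: "((U, c), p, R) \<in> J" "(U, c) \<in> A" "x \<in> chart_ball ((U, c), p, R)" "x \<in> U"
    "x \<in> chart_cball ((U, c), p, R)" by (rule chart_at)
  obtain C where C: "C \<ge> 0" "\<And>x y. x \<in> chart_cball ((U, c), p, R) \<Longrightarrow> y \<in> chart_cball ((U, c), p, R) \<Longrightarrow>
    dd x y \<le> C * norm (c x - c y)" using dd_upper[OF j(1)] by blast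
  show ?thesis
    using AE_injective_derivative[OF v j(1,3) dim]
  proof eventually_elim
    case (elim L)
    let ?Dv = "frechet_derivative (\<lambda>y. v (inv_into U c y)) (at (c x) within c ` U)"
    let ?D = "\<lambda>i. frechet_derivative (\<lambda>y. f i (inv_into U c y)) (at (c x) within c ` U)"
    let ?T = "\<lambda>w. ?Dv w + (\<Sum>i<n. ?D i w *\<^sub>R L i)"
    have cx: "c x \<in> c ` U" using j(4) by blast
    have der: "((\<lambda>y. perturbed v L (inv_into U c y)) has_derivative ?T) (at (c x) within c ` U)"
      unfolding probe_def
      by (intro has_derivative_add has_derivative_sum has_derivative_scaleR_left
          Cr_on_has_derivative[OF Cr_functions_chart[OF v j(2)] r1 cx]
          Cr_on_has_derivative[OF Cr_functions_chart[OF f_Cr j(2)] r1 cx]) auto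
    have inj: "w = 0" if "w \<in> E" "?T w = 0" for w using elim that by blast
    obtain e d where ed: "e > 0" "d > 0" "\<And>z. z \<in> c ` U \<Longrightarrow> norm (z - c x) < d \<Longrightarrow>
        e * norm (z - c x) \<le> norm (perturbed v L (inv_into U c z) - perturbed v L (inv_into U c (c x)))"
      using has_derivative_lower_bound[OF E openin_imp_subset[OF chart(2)[OF j(2)]] cx der inj] by blast
    define W where "W = chart_ball ((U, c), p, R) \<inter> (U \<inter> c -` ball (c x) d)"
    have "open W" unfolding W_def
      by (intro open_Int open_chart_ball continuous_open_preimage chart[OF j(2)] chart_inv[OF j(2)] j(2) open_ball)
    moreover have "x \<in> W" using j ed(2) by (simp add: W_def)
    moreover have "dd x y \<le> C / e * norm (perturbed v L x - perturbed v L y)" if y: "y \<in> W" for y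
    proof -
      have yU: "y \<in> U" "norm (c y - c x) < d" "y \<in> chart_cball ((U, c), p, R)"
        using y subsetD[OF chart_ball_subset, of y "((U, c), p, R)"] by (auto simp: W_def dist_norm norm_minus_commute)
      have "e * norm (c y - c x) \<le> norm (perturbed v L y - perturbed v L x)"
        using ed(3)[OF _ yU(2)] yU(1) j(4) chart_inv(4)[OF j(2)] by simp
      then have "norm (c x - c y) \<le> norm (perturbed v L x - perturbed v L y) / e"
        using ed(1) by (simp add: field_simps norm_minus_commute)
      then have "C * norm (c x - c y) \<le> C * (norm (perturbed v L x - perturbed v L y) / e)"
        using C(1) by (rule mult_left_mono)
      then show ?thesis using C(2)[OF j(5) yU(3)] by simp
    qed
    moreover have "C / e \<ge> 0" using C(1) ed(1) by simp
    ultimately show ?case by blast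
  qed
qed

text \<open>Where \<open>dd x y\<close> is at least \<open>1 / (m + 1)\<close>, some coefficient
  \<open>f i y - f i x\<close> is bounded below and \<open>AE_nonvanishing\<close> applies.
  Countably many \<open>m\<close> exhaust the points other than \<open>x\<close>.\<close>

lemma AE_avoids:
  fixes v :: "'m \<Rightarrow> 'f::euclidean_space"
  assumes nc: "null_cover DIM('f) D Y"
    and D: "\<And>y z. y \<in> Y \<Longrightarrow> z \<in> Y \<Longrightarrow> norm (v y - v z) \<le> D y z" "\<And>y z. y \<in> Y \<Longrightarrow> z \<in> Y \<Longrightarrow> dd y z \<le> D y z"
  shows "AE L in coeff_measure n. \<forall>y\<in>Y. y \<noteq> x \<longrightarrow> perturbed v L y \<noteq> perturbed v L x"
proof -
  have "AE L in coeff_measure n. \<forall>y\<in>{y \<in> Y. dd x y \<ge> 1 / real (Suc m)}. (v y - v x) + (\<Sum>i<n. (f i y - f i x) *\<^sub>R L i) \<noteq> 0" for m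
  proof (rule AE_nonvanishing)
    show "null_cover DIM('f) D {y \<in> Y. dd x y \<ge> 1 / real (Suc m)}"
      by (rule null_cover_mono[OF nc _ zero_le_one]) auto
    show "1 / real (Suc m) / real (Suc n) > 0" by simp
    fix y z assume yz: "y \<in> {y \<in> Y. dd x y \<ge> 1 / real (Suc m)}" "z \<in> {y \<in> Y. dd x y \<ge> 1 / real (Suc m)}"
    then show "norm (v y - v x - (v z - v x)) \<le> D y z" using D(1) by simp
    fix i assume i: "i < n"
    have "\<bar>f i y - f i z\<bar> \<le> dd y z" unfolding dd_def using i by (intro member_le_sum) auto
    then show "\<bar>f i y - f i x - (f i z - f i x)\<bar> \<le> D y z" using D(2)[of y z] yz by simp
  next
    fix y assume "y \<in> {y \<in> Y. dd x y \<ge> 1 / real (Suc m)}"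
    then have "1 / real (Suc m) \<le> (\<Sum>i<n. \<bar>f i y - f i x\<bar>)" by (simp add: dd_def abs_minus_commute)
    then show "\<exists>i<n. 1 / real (Suc m) / real (Suc n) \<le> \<bar>f i y - f i x\<bar>" by (rule finite_sum_ge_imp) simp
  qed
  then have "AE L in coeff_measure n. \<forall>m. \<forall>y\<in>{y \<in> Y. dd x y \<ge> 1 / real (Suc m)}. (v y - v x) + (\<Sum>i<n. (f i y - f i x) *\<^sub>R L i) \<noteq> 0"
    by (simp add: AE_all_countable)
  then show ?thesis
  proof eventually_elim
    case (elim L)
    show ?case
    proof (intro ballI impI notI)
      fix y assume y: "y \<in> Y" "y \<noteq> x" "perturbed v L y = perturbed v L x"
      have "dd x y > 0" using y(2) dd_nonneg[of x y] dd_eq_0[of x y] by fastforce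
      then obtain m where "inverse (real (Suc m)) < dd x y" using reals_Archimedean by blast
      then have "1 / real (Suc m) \<le> dd x y" by (simp add: inverse_eq_divide)
      then have "(v y - v x) + (\<Sum>i<n. (f i y - f i x) *\<^sub>R L i) \<noteq> 0" using elim y(1) by blast
      then show False using y(3) perturbed_diff[where v = v and L = L and y = y and x = x] by simp
    qed
  qed
qed

text \<open>The local bound settles a neighbourhood \<open>W\<close> of \<open>x\<close>. On the
  compact rest of \<open>Y\<close> the images keep a positive distance from that of \<open>x\<close>
  by \<open>avoid\<close>, while \<open>dd x y\<close> is bounded.\<close>

lemma AE_good_point:
  fixes v :: "'m \<Rightarrow> 'f::euclidean_space"
  assumes v: "v \<in> Cr_functions r E A" and dim: "dim E \<le> DIM('f)" and Y: "closed Y"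
    and avoid: "AE L in coeff_measure n. \<forall>y\<in>Y. y \<noteq> x \<longrightarrow> perturbed v L y \<noteq> perturbed v L x"
  shows "AE L in coeff_measure n. \<exists>C\<ge>0. \<forall>y\<in>Y. dd x y \<le> C * norm (perturbed v L x - perturbed v L y)"
  using AE_local_lower_bound[OF v dim, of x] avoid
proof eventually_elim
  case (elim L)
  then obtain W C where W: "open W" "x \<in> W" "C \<ge> 0"
    "\<And>y. y \<in> W \<Longrightarrow> dd x y \<le> C * norm (perturbed v L x - perturbed v L y)" by metis
  let ?\<phi> = "perturbed v L"
  have "compact (UNIV \<inter> (Y - W))" using compact_UNIV Y W(1) by (intro compact_Int_closed closed_Diff)
  then have cpt: "compact (Y - W)" by simp
  show ?case
  proof (cases "Y - W = {}")
    case True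
    then show ?thesis using W by blast
  next
    case False
    have "continuous_on (Y - W) (\<lambda>y. norm (?\<phi> x - ?\<phi> y))"
      by (intro continuous_intros Cr_functions_continuous[OF perturbed_Cr[OF v]])
    then obtain z where z: "z \<in> Y - W" "\<And>y. y \<in> Y - W \<Longrightarrow> norm (?\<phi> x - ?\<phi> z) \<le> norm (?\<phi> x - ?\<phi> y)"
      using continuous_attains_inf[OF cpt False] by blast
    obtain z' where z': "\<And>y. y \<in> Y - W \<Longrightarrow> dd x y \<le> dd x z'"
      using continuous_attains_sup[OF cpt False continuous_on_dd[of _ x]] by blast
    define \<eta> where "\<eta> = norm (?\<phi> x - ?\<phi> z)"
    have eta: "\<eta> > 0" using elim(2) z(1) W(2) by (auto simp: \<eta>_def)
    have "dd x y \<le> (C + dd x z' / \<eta>) * norm (?\<phi> x - ?\<phi> y)" if y: "y \<in> Y" for y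
    proof (cases "y \<in> W")
      case True
      have "0 \<le> dd x z' / \<eta> * norm (?\<phi> x - ?\<phi> y)" using eta dd_nonneg by simp
      then show ?thesis using W(4)[OF True] by (simp add: distrib_right)
    next
      case False
      then have "\<eta> \<le> norm (?\<phi> x - ?\<phi> y)" using z(2) y by (simp add: \<eta>_def)
      then have "dd x z' / \<eta> * \<eta> \<le> dd x z' / \<eta> * norm (?\<phi> x - ?\<phi> y)"
        using eta dd_nonneg by (intro mult_left_mono) auto
      moreover have "dd x y \<le> dd x z'" using z' False y by blast
      moreover have "0 \<le> C * norm (?\<phi> x - ?\<phi> y)" using W(3) by simp
      ultimately show ?thesis using eta by (simp add: distrib_right)
    qed
    moreover have "C + dd x z' / \<eta> \<ge> 0" using W(3) eta dd_nonneg by simp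
    ultimately show ?thesis by blast
  qed
qed

text \<open>The manifold is a finite union of closed coordinate balls, and each of them is covered
  by a grid in \<open>dim E\<close> coordinates.\<close>

lemma AE_avoids_manifold:
  fixes v :: "'m \<Rightarrow> 'f::euclidean_space"
  assumes v: "v \<in> Cr_functions r E A" and dim: "dim E < DIM('f)"
  shows "AE L in coeff_measure n. \<forall>y. y \<noteq> x \<longrightarrow> perturbed v L y \<noteq> perturbed v L x"
proof -
  have "AE L in coeff_measure n. \<forall>y\<in>chart_cball j. y \<noteq> x \<longrightarrow> perturbed v L y \<noteq> perturbed v L x" if j: "j \<in> J" for j
  proof -
    obtain U c p R where jj: "j = ((U, c), p, R)" by (metis surj_pair)
    note j' = j[unfolded jj]
    have U: "(U, c) \<in> A" and R: "R > 0" using good[OF j'] by (auto simp: good_ball_def)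
    obtain C where C: "C \<ge> 0" "\<And>x y. x \<in> chart_cball ((U, c), p, R) \<Longrightarrow> y \<in> chart_cball ((U, c), p, R) \<Longrightarrow>
      dd x y \<le> C * norm (c x - c y)" using dd_upper[OF j'] by blast
    obtain C' where C': "C' \<ge> 0" "\<And>x y. x \<in> chart_cball ((U, c), p, R) \<Longrightarrow> y \<in> chart_cball ((U, c), p, R) \<Longrightarrow>
      norm (v x - v y) \<le> C' * norm (c x - c y)" using Cr_functions_lipschitz[OF v good[OF j']] by blast
    obtain B where B: "finite B" "B \<subseteq> E" "card B = dim E" "\<And>b. b \<in> B \<Longrightarrow> norm b = 1"
      "\<And>w. w \<in> E \<Longrightarrow> (\<Sum>b\<in>B. (w \<bullet> b) *\<^sub>R b) = w"
      using subspace_orthonormal_basis[OF E] by metis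
    let ?K = "chart_cball ((U, c), p, R)"
    let ?g = "\<lambda>y z. \<Sum>b\<in>B. \<bar>c y \<bullet> b - c z \<bullet> b\<bar>"
    have le: "norm (c y - c z) \<le> ?g y z" if "y \<in> ?K" "z \<in> ?K" for y z
    proof -
      have "c y - c z \<in> E" using that chart_inv(5)[OF U] E by (auto simp: chart_cball_def intro: subspace_diff)
      then have "norm (c y - c z) = norm (\<Sum>b\<in>B. ((c y - c z) \<bullet> b) *\<^sub>R b)" using B(5) by simp
      also have "\<dots> \<le> ?g y z" by (rule sum_norm_le) (use B(4) in \<open>simp add: inner_diff_left\<close>)
      finally show ?thesis .
    qed
    have "null_cover DIM('f) ?g ?K"
    proof (rule null_cover_grid[OF B(1), of _ _ _ "norm p + R"])
      fix b y assume b: "b \<in> B" and y: "y \<in> ?K"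
      have "norm (c y) \<le> norm p + R"
        using y norm_triangle_ineq[of p "c y - p"] by (simp add: chart_cball_def dist_norm)
      then show "\<bar>c y \<bullet> b\<bar> \<le> norm p + R" using Cauchy_Schwarz_ineq2[of "c y" b] B(4)[OF b] by simp
    qed (use B(3) dim in simp)
    then have nc: "null_cover DIM('f) (\<lambda>y z. (C + C') * norm (c y - c z)) ?K"
      by (rule null_cover_mono[OF _ subset_refl, of _ _ _ "C + C'"]) (use le C(1) C'(1) in \<open>auto intro: mult_left_mono\<close>)
    show ?thesis
      unfolding jj
    proof (rule AE_avoids[OF nc])
      fix y z assume yz: "y \<in> ?K" "z \<in> ?K"
      have "C * norm (c y - c z) \<le> (C + C') * norm (c y - c z)" "C' * norm (c y - c z) \<le> (C + C') * norm (c y - c z)"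
        using C(1) C'(1) by (auto intro: mult_right_mono)
      then show "norm (v y - v z) \<le> (C + C') * norm (c y - c z)" "dd y z \<le> (C + C') * norm (c y - c z)"
        using C(2)[OF yz] C'(2)[OF yz] by linarith+
    qed
  qed
  then have "AE L in coeff_measure n. \<forall>j\<in>J. \<forall>y\<in>chart_cball j. y \<noteq> x \<longrightarrow> perturbed v L y \<noteq> perturbed v L x"
    by (rule AE_finite_allI[OF fin_J])
  then show ?thesis
  proof eventually_elim
    case (elim L)
    show ?case
    proof (intro allI)
      fix y
      obtain j where "j \<in> J" "y \<in> chart_cball j" using cover chart_ball_subset by blast
      then show "y \<noteq> x \<longrightarrow> perturbed v L y \<noteq> perturbed v L x" using elim by blast
    qed
  qed
qed

end

section \<open>Collisions in a set of small Hausdorff dimension\<close>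

context cr_riemannian
begin

text \<open>The function \<open>?D\<close> majorizes the increments of \<open>v\<close> and of all
  \<open>f i\<close> at once and is bounded by a multiple of \<open>\<rho>\<close> at small scales,
  so fine Hausdorff covers of \<open>X\<close> transfer to it.\<close>

lemma AE_avoids_low_dimension:
  fixes v :: "'m \<Rightarrow> 'f::euclidean_space"
  assumes v: "v \<in> Cr_functions r E A" and dim: "hausdorff_dim \<rho> X < of_nat DIM('f)"
  shows "AE L in coeff_measure n. \<forall>y\<in>X. y \<noteq> x \<longrightarrow> perturbed v L y \<noteq> perturbed v L x"
proof -
  obtain C \<delta> where C: "C \<ge> 0" "\<delta> > 0" "\<And>x y. \<rho> x y < \<delta> \<Longrightarrow> norm (v x - v y) \<le> C * \<rho> x y"
    using Cr_functions_rho_lipschitz[OF v] by blast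
  have "\<exists>C \<delta>. C \<ge> 0 \<and> \<delta> > 0 \<and> (\<forall>x y. \<rho> x y < \<delta> \<longrightarrow> norm (f i x - f i y) \<le> C * \<rho> x y)" if "i < n" for i
    using Cr_functions_rho_lipschitz[OF f_Cr[OF that]] by metis
  then obtain C' \<delta>' where C': "\<And>i. i < n \<Longrightarrow> C' i \<ge> 0 \<and> \<delta>' i > 0 \<and> (\<forall>x y. \<rho> x y < \<delta>' i \<longrightarrow> norm (f i x - f i y) \<le> C' i * \<rho> x y)"
    by metis
  define d where "d = Min (insert \<delta> (\<delta>' ` {..<n}))"
  have d: "d > 0" "d \<le> \<delta>" "\<And>i. i < n \<Longrightarrow> d \<le> \<delta>' i" using C(2) C' by (auto simp: d_def)
  have dd: "dd x y \<le> (\<Sum>i<n. C' i) * \<rho> x y" if "\<rho> x y < d" for x y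
    unfolding dd_def sum_distrib_right
  proof (rule sum_mono)
    fix i assume "i \<in> {..<n}"
    then show "\<bar>f i x - f i y\<bar> \<le> C' i * \<rho> x y" using C'[of i] d(3)[of i] that by force
  qed
  have S0: "(\<Sum>i<n. C' i) \<ge> 0" using C' by (auto intro: sum_nonneg)
  let ?D = "\<lambda>x y. norm (v x - v y) + dd x y"
  have "null_cover DIM('f) ?D X"
  proof (rule null_cover_hausdorff[OF dim d(1)])
    show "C + (\<Sum>i<n. C' i) \<ge> 0" using C(1) S0 by simp
    show "?D x y \<le> (C + (\<Sum>i<n. C' i)) * \<rho> x y" if "\<rho> x y < d" for x y
      using C(3)[of x y] dd[OF that] that d(2) by (simp add: distrib_right)
  qed
  then show ?thesis by (rule AE_avoids) (auto simp: dd_nonneg)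
qed

end

section \<open>Prevalence\<close>

definition borel_of_top :: "'w topology \<Rightarrow> 'w measure" where
  "borel_of_top T = sigma (topspace T) {U. openin T U}"

lemma space_borel_of_top: "space (borel_of_top T) = topspace T"
  and sets_borel_of_top: "sets (borel_of_top T) = borel_sets_of T"
proof -
  have "{U. openin T U} \<subseteq> Pow (topspace T)" using openin_subset by blast
  then show "space (borel_of_top T) = topspace T" "sets (borel_of_top T) = borel_sets_of T"
    by (auto simp: borel_of_top_def borel_sets_of_def)
qed

lemma openin_borel_of_top: "openin T U \<Longrightarrow> U \<in> sets (borel_of_top T)"
  by (simp add: sets_borel_of_top borel_sets_of_def sigma_sets.Basic)

lemma closedin_borel_of_top:
  assumes "closedin T K"
  shows "K \<in> sets (borel_of_top T)"
proof -
  have "topspace T - (topspace T - K) \<in> sets (borel_of_top T)"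
    using assms openin_borel_of_top[of T] sets.compl_sets[of "topspace T - K" "borel_of_top T"]
    by (simp add: space_borel_of_top openin_diff)
  then show ?thesis using closedin_subset[OF assms] by (simp add: double_diff)
qed

text \<open>The product measure lives on functions equal to \<open>undefined\<close> from
  \<open>n\<close> on, whereas the continuity of \<open>probe\<close> refers to the space of all
  functions; this inclusion links the two.\<close>

lemma measurable_coeff_id: "(\<lambda>L. L) \<in> borel_measurable (coeff_measure n :: (nat \<Rightarrow> 'f::euclidean_space) measure)"
proof (rule measurable_coordinatewise_then_product)
  fix i
  show "(\<lambda>L. L i) \<in> borel_measurable (coeff_measure n :: (nat \<Rightarrow> 'f) measure)"
  proof (cases "i < n")
    case False
    then have "L i = undefined" if "L \<in> space (coeff_measure n :: (nat \<Rightarrow> 'f) measure)" for L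
      using that by (auto simp: coeff_measure_def space_PiM PiE_def extensional_def)
    then show ?thesis by (subst measurable_cong[of _ _ "\<lambda>_. undefined"]) auto
  qed simp
qed

text \<open>One point of \<open>Y\<close> is chosen for each basic open set that meets the values of
  \<open>\<psi>\<close> on \<open>Y\<close>; the values on \<open>D\<close> are then dense among
  those on \<open>Y\<close>.\<close>

lemma countable_dense_choice:
  fixes \<psi> :: "'a \<Rightarrow> 'b::second_countable_topology"
  obtains D where "countable D" "D \<subseteq> Y" "\<And>F y. closed F \<Longrightarrow> (\<forall>y\<in>D. \<psi> y \<in> F) \<Longrightarrow> y \<in> Y \<Longrightarrow> \<psi> y \<in> F"
proof -
  obtain B :: "'b set set" where B: "countable B" "topological_basis B" using ex_countable_basis by blast
  define ch where "ch b = (SOME y. y \<in> Y \<and> \<psi> y \<in> b)" for b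
  have ch: "ch b \<in> Y \<and> \<psi> (ch b) \<in> b" if "y \<in> Y" "\<psi> y \<in> b" for y b
    unfolding ch_def by (rule someI[of _ y]) (use that in blast)
  define D where "D = ch ` {b \<in> B. \<exists>y\<in>Y. \<psi> y \<in> b}"
  show ?thesis
  proof (rule that[of D])
    show "countable D" using B(1) by (auto simp: D_def)
    show "D \<subseteq> Y" using ch by (auto simp: D_def)
    fix F y assume F: "closed F" "\<forall>y\<in>D. \<psi> y \<in> F" "y \<in> Y"
    show "\<psi> y \<in> F"
    proof (rule ccontr)
      assume "\<psi> y \<notin> F"
      then have "\<psi> y \<in> - F" by simp
      moreover have "open (- F)" using F(1) by (rule open_Compl)
      ultimately obtain b where b: "b \<in> B" "\<psi> y \<in> b" "b \<subseteq> - F"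
        using topological_basisE[OF B(2)] by metis
      then have "ch b \<in> D" "\<psi> (ch b) \<in> b" using F(3) ch by (auto simp: D_def)
      then show False using F(2) b(3) by blast
    qed
  qed
qed

section \<open>Measurability of the good property\<close>

context cr_embedded
begin

definition good_at :: "'m set \<Rightarrow> ('m \<Rightarrow> 'f::euclidean_space) \<Rightarrow> 'm \<Rightarrow> bool" where
  "good_at Y \<phi> x \<longleftrightarrow> (\<exists>C\<ge>0. \<forall>y\<in>Y. dd x y \<le> C * norm (\<phi> x - \<phi> y))"

text \<open>Integer constants present the good points as a countable increasing union of sets, which
  are closed for \<open>\<phi>\<close> of class C^r.\<close>

definition good_set :: "'m set \<Rightarrow> nat \<Rightarrow> ('m \<Rightarrow> 'f::euclidean_space) \<Rightarrow> 'm set" where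
  "good_set Y C \<phi> = {x. \<forall>y\<in>Y. dd x y \<le> real C * norm (\<phi> x - \<phi> y)}"

lemma good_at_iff: "good_at Y \<phi> x \<longleftrightarrow> (\<exists>C. x \<in> good_set Y C \<phi>)"
proof
  assume "good_at Y \<phi> x"
  then obtain C where C: "C \<ge> 0" "\<forall>y\<in>Y. dd x y \<le> C * norm (\<phi> x - \<phi> y)" unfolding good_at_def by blast
  obtain N :: nat where "C \<le> real N" using real_arch_simple by blast
  then have "x \<in> good_set Y N \<phi>"
    using C(2) by (simp add: good_set_def) (meson mult_right_mono norm_ge_zero order_trans)
  then show "\<exists>C. x \<in> good_set Y C \<phi>" by blast
next
  assume "\<exists>C. x \<in> good_set Y C \<phi>"
  then obtain C where "\<forall>y\<in>Y. dd x y \<le> real C * norm (\<phi> x - \<phi> y)" by (auto simp: good_set_def)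
  then show "good_at Y \<phi> x" unfolding good_at_def by (intro exI[of _ "real C"]) simp
qed

lemma good_set_mono: "C \<le> C' \<Longrightarrow> good_set Y C \<phi> \<subseteq> good_set Y C' \<phi>"
  unfolding good_set_def by clarsimp (meson mult_right_mono norm_ge_zero of_nat_mono order_trans)

lemma closed_good_set:
  assumes "\<phi> \<in> Cr_functions r E A"
  shows "closed (good_set Y C \<phi>)"
proof -
  have "closed {x. dd x y \<le> real C * norm (\<phi> x - \<phi> y)}" for y
  proof (rule closed_Collect_le)
    show "continuous_on UNIV (\<lambda>x. dd x y)" using continuous_on_dd[of UNIV y] by (simp add: dd_commute)
    show "continuous_on UNIV (\<lambda>x. real C * norm (\<phi> x - \<phi> y))"
      by (intro continuous_intros Cr_functions_continuous[OF assms])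
  qed
  then have "closed (\<Inter>y\<in>Y. {x. dd x y \<le> real C * norm (\<phi> x - \<phi> y)})" by blast
  moreover have "good_set Y C \<phi> = (\<Inter>y\<in>Y. {x. dd x y \<le> real C * norm (\<phi> x - \<phi> y)})"
    by (auto simp: good_set_def)
  ultimately show ?thesis by simp
qed

context
  fixes \<mu> :: "'m measure" and X :: "'m set"
  assumes prob: "prob_space \<mu>" and sets_mu: "sets \<mu> = sets (restrict_space borel X)"
begin

lemma space_mu: "space \<mu> = X"
  using sets_eq_imp_space_eq[OF sets_mu] by (simp add: space_restrict_space)

lemma sets_good_set: "\<phi> \<in> Cr_functions r E A \<Longrightarrow> X \<inter> good_set Y C \<phi> \<in> sets \<mu>"
  using closed_good_set[of \<phi> Y C] by (auto simp: sets_mu sets_restrict_space)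

text \<open>Continuity from below in \<open>C\<close> replaces the almost-everywhere statement by
  countably many strict inequalities, each of which will define an open set of functions.\<close>

lemma AE_good_iff:
  assumes \<phi>: "\<phi> \<in> Cr_functions r E A"
  shows "(AE x in \<mu>. good_at Y \<phi> x) \<longleftrightarrow>
    (\<forall>m. \<exists>C. measure \<mu> (X \<inter> good_set Y C \<phi>) > 1 - 1 / real (Suc m))"
proof -
  interpret prob_space \<mu> by (rule prob)
  let ?G = "\<lambda>C. X \<inter> good_set Y C \<phi>"
  have G: "?G C \<in> sets \<mu>" for C using sets_good_set[OF \<phi>] .
  have UG: "(\<Union>C. ?G C) \<in> sets \<mu>" using G by blast
  have "incseq ?G" using good_set_mono by (force simp: incseq_def)
  then have lim: "(\<lambda>C. measure \<mu> (?G C)) \<longlonglongrightarrow> measure \<mu> (\<Union>C. ?G C)"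
    using G by (intro finite_Lim_measure_incseq) auto
  have eq: "(AE x in \<mu>. good_at Y \<phi> x) \<longleftrightarrow> measure \<mu> (\<Union>C. ?G C) = 1"
  proof -
    have "(AE x in \<mu>. good_at Y \<phi> x) \<longleftrightarrow> (AE x in \<mu>. x \<in> (\<Union>C. ?G C))"
      by (rule AE_cong) (auto simp: good_at_iff space_mu)
    then show ?thesis using AE_in_set_eq_1[OF UG] by simp
  qed
  show ?thesis
    unfolding eq
  proof
    assume 1: "measure \<mu> (\<Union>C. ?G C) = 1"
    show "\<forall>m. \<exists>C. measure \<mu> (?G C) > 1 - 1 / real (Suc m)"
    proof
      fix m
      have "\<forall>\<^sub>F C in sequentially. measure \<mu> (?G C) > 1 - 1 / real (Suc m)"
        using order_tendstoD(1)[OF lim, of "1 - 1 / real (Suc m)"] 1 by simp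
      then show "\<exists>C. measure \<mu> (?G C) > 1 - 1 / real (Suc m)"
        by (meson eventually_sequentially order_refl)
    qed
  next
    assume *: "\<forall>m. \<exists>C. measure \<mu> (?G C) > 1 - 1 / real (Suc m)"
    have "1 - inverse (real (Suc m)) \<le> measure \<mu> (\<Union>C. ?G C)" for m
    proof -
      obtain C where "measure \<mu> (?G C) > 1 - 1 / real (Suc m)" using * by blast
      moreover have "measure \<mu> (?G C) \<le> measure \<mu> (\<Union>C. ?G C)" by (rule finite_measure_mono[OF _ UG]) blast
      ultimately show ?thesis by (simp add: inverse_eq_divide)
    qed
    moreover have "(\<lambda>m. 1 - inverse (real (Suc m))) \<longlonglongrightarrow> 1 - 0"
      by (intro tendsto_diff tendsto_const LIMSEQ_inverse_real_of_nat)
    ultimately have "1 - 0 \<le> measure \<mu> (\<Union>C. ?G C)" by (intro LIMSEQ_le_const2) auto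
    then show "measure \<mu> (\<Union>C. ?G C) = 1" using prob_le_1[of "\<Union>C. ?G C"] by linarith
  qed
qed

text \<open>The translation by \<open>v\<close> is included because transferring the statement about
  \<open>v + e\<close> from the coefficients to the image measure requires a measurable set of
  \<open>e\<close>.\<close>

lemma good_borel:
  fixes v :: "'m \<Rightarrow> 'f::euclidean_space"
  assumes v: "v \<in> Cr_functions r E A"
  shows "{e \<in> Cr_functions r E A. AE x in \<mu>. good_at Y (\<lambda>x. v x + e x) x} \<in> sets (borel_of_top (Cr_topology r E A))"
proof -
  interpret prob_space \<mu> by (rule prob)
  let ?F = "Cr_functions r E A :: ('m \<Rightarrow> 'f) set"
  let ?O = "\<lambda>m. {e \<in> ?F. \<exists>C. measure \<mu> (X \<inter> good_set Y C (\<lambda>x. v x + e x)) > 1 - 1 / real (Suc m)}"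
  have "openin (Cr_topology r E A) (?O m)" for m
  proof (subst openin_subopen, intro ballI)
    fix e assume "e \<in> ?O m"
    then obtain C where e: "e \<in> ?F" and C: "measure \<mu> (X \<inter> good_set Y C (\<lambda>x. v x + e x)) > 1 - 1 / real (Suc m)"
      by blast
    \<comment> \<open>A perturbation of this size costs at most half of \<open>dd x y\<close>, so
      the constant \<open>C\<close> becomes \<open>2 * C\<close>; \<open>Suc C\<close> admits the
      case \<open>C = 0\<close>.\<close>
    have "0 < 1 / (2 * real (Suc C))" by simp
    then obtain W where W: "openin (Cr_topology r E A) W" "e \<in> W"
      "\<And>e' x y. e' \<in> W \<Longrightarrow> norm ((e' x - e x) - (e' y - e y)) \<le> 1 / (2 * real (Suc C)) * dd x y"
      using Cr_nhd_lipschitz_small[OF e] by metis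
    have "e' \<in> ?O m" if e': "e' \<in> W" for e'
    proof -
      have e'F: "e' \<in> ?F" using openin_subset[OF W(1)] e' by (auto simp: topspace_Cr_topology)
      have "good_set Y C (\<lambda>x. v x + e x) \<subseteq> good_set Y (2 * C) (\<lambda>x. v x + e' x)"
        unfolding good_set_def
      proof clarify
        fix x y assume x: "\<forall>y\<in>Y. dd x y \<le> real C * norm (v x + e x - (v y + e y))" and y: "y \<in> Y"
        let ?n = "norm (v x + e x - (v y + e y))" and ?n' = "norm (v x + e' x - (v y + e' y))"
        have nn: "?n \<le> ?n' + norm ((e' x - e x) - (e' y - e y))"
          using norm_triangle_ineq4[of "v x + e' x - (v y + e' y)" "(e' x - e x) - (e' y - e y)"]
          by (simp add: algebra_simps)
        define k where "k = 1 / (2 * real (Suc C)) * dd x y"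
        have "norm ((e' x - e x) - (e' y - e y)) \<le> k" unfolding k_def by (rule W(3)[OF e'])
        then have "?n \<le> ?n' + k" using nn by simp
        then have "real C * ?n \<le> real C * (?n' + k)" by (rule mult_left_mono) simp
        moreover have "dd x y \<le> real C * ?n" using x y by blast
        moreover have "real C * k \<le> 1 / 2 * dd x y"
        proof -
          have "real C * k = real C / (2 * real (Suc C)) * dd x y" by (simp add: k_def)
          also have "\<dots> \<le> 1 / 2 * dd x y" by (intro mult_right_mono dd_nonneg) (simp add: field_simps)
          finally show ?thesis .
        qed
        ultimately show "dd x y \<le> real (2 * C) * ?n'" by (simp add: distrib_left)
      qed
      then have "measure \<mu> (X \<inter> good_set Y C (\<lambda>x. v x + e x)) \<le> measure \<mu> (X \<inter> good_set Y (2 * C) (\<lambda>x. v x + e' x))"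
        using sets_good_set[OF Cr_functions_add[OF v e'F]] by (intro finite_measure_mono) auto
      then have "1 - 1 / real (Suc m) < measure \<mu> (X \<inter> good_set Y (2 * C) (\<lambda>x. v x + e' x))"
        using C by linarith
      then show ?thesis by (intro CollectI conjI exI[of _ "2 * C"] e'F)
    qed
    then show "\<exists>T. openin (Cr_topology r E A) T \<and> e \<in> T \<and> T \<subseteq> ?O m" using W by blast
  qed
  then have "(\<Inter>m. ?O m) \<in> sets (borel_of_top (Cr_topology r E A))"
    by (intro sets.countable_INT) (auto intro: openin_borel_of_top)
  moreover have "{e \<in> ?F. AE x in \<mu>. good_at Y (\<lambda>x. v x + e x) x} = (\<Inter>m. ?O m)"
    using AE_good_iff[OF Cr_functions_add[OF v]] by auto
  ultimately show ?thesis by simp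
qed

lemma measurable_continuous_mu:
  fixes h :: "'m \<Rightarrow> 'b::topological_space"
  assumes "continuous_on UNIV h"
  shows "h \<in> borel_measurable \<mu>"
proof -
  have "h \<in> borel_measurable (restrict_space borel X)"
    using borel_measurable_continuous_onI[OF assms] by (rule measurable_restrict_space1)
  then show ?thesis by (simp cong: measurable_cong_sets add: sets_mu)
qed

text \<open>Fubini requires joint measurability in \<open>x\<close> and \<open>L\<close>. For fixed
  \<open>x\<close>, \<open>L\<close> and \<open>C\<close> the inequality is a closed condition on
  the values \<open>f i y\<close> and \<open>v y\<close>; these are collected in
  \<open>?\<psi>\<close>, so one countable \<open>D\<close> replaces \<open>Y\<close> for all
  \<open>x\<close>, \<open>L\<close> and \<open>C\<close>.\<close>

lemma AE_commute_good:
  fixes v :: "'m \<Rightarrow> 'f::euclidean_space"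
  assumes v: "v \<in> Cr_functions r E A" and ae: "\<And>x. AE L in coeff_measure n. good_at Y (perturbed v L) x"
  shows "AE L in coeff_measure n. AE x in \<mu>. good_at Y (perturbed v L) x"
proof -
  let ?M = "coeff_measure n :: (nat \<Rightarrow> 'f) measure"
  interpret P: pair_sigma_finite \<mu> ?M
    by (intro pair_sigma_finite.intro prob_space_imp_sigma_finite prob prob_space_coeff)
  let ?\<psi> = "\<lambda>y. ((\<lambda>i. if i < n then f i y else 0 :: real), v y)"
  obtain D where D: "countable D" "D \<subseteq> Y"
    "\<And>F y. closed F \<Longrightarrow> (\<forall>y\<in>D. ?\<psi> y \<in> F) \<Longrightarrow> y \<in> Y \<Longrightarrow> ?\<psi> y \<in> F"
    using countable_dense_choice[of Y ?\<psi>] by blast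
  have eq: "(\<forall>y\<in>Y. dd x y \<le> real C * norm (perturbed v L x - perturbed v L y)) \<longleftrightarrow>
      (\<forall>y\<in>D. dd x y \<le> real C * norm (perturbed v L x - perturbed v L y))" for x L C
  proof
    assume *: "\<forall>y\<in>D. dd x y \<le> real C * norm (perturbed v L x - perturbed v L y)"
    define F where "F = {q :: (nat \<Rightarrow> real) \<times> 'f. (\<Sum>i<n. \<bar>f i x - fst q i\<bar>) \<le>
      real C * norm (perturbed v L x - (snd q + (\<Sum>i<n. fst q i *\<^sub>R L i)))}"
    have coord: "continuous_on UNIV (\<lambda>q :: (nat \<Rightarrow> real) \<times> 'f. fst q i)" for i
      by (rule continuous_on_product_then_coordinatewise) (intro continuous_intros)
    have "closed F"
      unfolding F_def by (intro closed_Collect_le continuous_intros coord)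
    moreover have mem: "?\<psi> y \<in> F \<longleftrightarrow> dd x y \<le> real C * norm (perturbed v L x - perturbed v L y)" for y
      by (simp add: F_def dd_def probe_def)
    ultimately show "\<forall>y\<in>Y. dd x y \<le> real C * norm (perturbed v L x - perturbed v L y)"
      using D(3)[of F] * by blast
  qed (use D(2) in blast)
  let ?S = "{q \<in> space (\<mu> \<Otimes>\<^sub>M ?M). good_at Y (perturbed v (snd q)) (fst q)}"
  have fm [measurable]: "f i \<in> borel_measurable \<mu>" if "i < n" for i
    using measurable_continuous_mu[OF continuous_on_f[OF that]] .
  have vm [measurable]: "v \<in> borel_measurable \<mu>" using measurable_continuous_mu[OF Cr_functions_continuous[OF v]] .
  have pm [measurable]: "(\<lambda>q. perturbed v (snd q) (fst q)) \<in> borel_measurable (\<mu> \<Otimes>\<^sub>M ?M)"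
    unfolding probe_def by measurable
  have pm' [measurable]: "(\<lambda>q. perturbed v (snd q) y) \<in> borel_measurable (\<mu> \<Otimes>\<^sub>M ?M)" for y
    unfolding probe_def by measurable
  have dm [measurable]: "(\<lambda>q. dd (fst q) y) \<in> borel_measurable (\<mu> \<Otimes>\<^sub>M ?M)" for y
    unfolding dd_def by measurable
  have Q: "{q \<in> space (\<mu> \<Otimes>\<^sub>M ?M). dd (fst q) y \<le> real C * norm (perturbed v (snd q) (fst q) - perturbed v (snd q) y)} \<in> sets (\<mu> \<Otimes>\<^sub>M ?M)" (is "?Q C y \<in> _") for C y
    by measurable
  have "(\<Union>C. space (\<mu> \<Otimes>\<^sub>M ?M) \<inter> (\<Inter>y\<in>D. ?Q C y)) \<in> sets (\<mu> \<Otimes>\<^sub>M ?M)"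
  proof (intro sets.countable_UN image_subsetI)
    fix C
    show "space (\<mu> \<Otimes>\<^sub>M ?M) \<inter> (\<Inter>y\<in>D. ?Q C y) \<in> sets (\<mu> \<Otimes>\<^sub>M ?M)"
    \<comment> \<open>The rule for countable intersections asks for a nonempty index set.\<close>
    proof (cases "D = {}")
      case False
      then show ?thesis using Q D(1) by (intro sets.Int sets.top sets.countable_INT') auto
    qed simp
  qed
  moreover have "?S = (\<Union>C. space (\<mu> \<Otimes>\<^sub>M ?M) \<inter> (\<Inter>y\<in>D. ?Q C y))"
    by (auto simp: good_at_iff good_set_def eq)
  ultimately have "?S \<in> sets (\<mu> \<Otimes>\<^sub>M ?M)" by simp
  then show ?thesis
    using P.AE_commute[of "\<lambda>x L. good_at Y (perturbed v L) x"] ae by simp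
qed

section \<open>The probe measure and prevalence\<close>

definition probe_measure :: "('m \<Rightarrow> 'f::euclidean_space) measure" where
  "probe_measure = distr (coeff_measure n) (borel_of_top (Cr_topology r E A)) probe"

lemma measurable_probe: "probe \<in> measurable (coeff_measure n) (borel_of_top (Cr_topology r E A :: ('m \<Rightarrow> 'f::euclidean_space) topology))"
  unfolding borel_of_top_def
proof (rule measurable_measure_of)
  let ?T = "Cr_topology r E A :: ('m \<Rightarrow> 'f) topology"
  show "{U. openin ?T U} \<subseteq> Pow (topspace ?T)" using openin_subset by blast
  show "probe \<in> space (coeff_measure n) \<rightarrow> topspace ?T" using probe_Cr by (auto simp: topspace_Cr_topology)
  fix U assume "U \<in> {U. openin ?T U}"
  then have "open (probe -` U :: (nat \<Rightarrow> 'f) set)"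
    using openin_continuous_map_preimage[OF continuous_map_probe, of U] by (simp add: vimage_def)
  then have "(\<lambda>L. L) -` (probe -` U) \<inter> space (coeff_measure n) \<in> sets (coeff_measure n :: (nat \<Rightarrow> 'f) measure)"
    by (intro measurable_sets[OF measurable_coeff_id]) simp
  then show "probe -` U \<inter> space (coeff_measure n) \<in> sets (coeff_measure n :: (nat \<Rightarrow> 'f) measure)" by simp
qed

lemma probe_measure_compact:
  "\<exists>K. compactin (Cr_topology r E A) K \<and> emeasure (probe_measure :: ('m \<Rightarrow> 'f::euclidean_space) measure) K = 1"
proof -
  let ?T = "Cr_topology r E A :: ('m \<Rightarrow> 'f) topology"
  let ?M = "coeff_measure n :: (nat \<Rightarrow> 'f) measure"
  \<comment> \<open>Coordinates from \<open>n\<close> on are frozen at \<open>undefined\<close>,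
    matching the extensional functions of the product space. The product of these sets is compact
    and carries the full measure.\<close>
  define S where "S i = (if i < n then cball 0 1 else {undefined :: 'f})" for i :: nat
  have "compactin (product_topology (\<lambda>_::nat. euclidean) UNIV) (PiE UNIV S)"
    unfolding compactin_PiE by (auto simp: S_def)
  then have "compactin euclidean (PiE UNIV S)" by (simp add: euclidean_product_topology)
  then have K: "compactin ?T (probe ` PiE UNIV S)" using continuous_map_probe by (rule image_compactin)
  have Km: "probe ` PiE UNIV S \<in> sets (borel_of_top ?T)"
    using compactin_imp_closedin[OF Hausdorff_Cr_topology K] by (rule closedin_borel_of_top)
  have "AE L in ?M. L \<in> PiE UNIV S"
    using AE_coeff AE_space
  proof eventually_elim
    case (elim L)
    then have "L i = undefined" if "\<not> i < n" for i
      using that by (auto simp: coeff_measure_def space_PiM PiE_def extensional_def)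
    then show ?case using elim(1) by (auto simp: S_def)
  qed
  then have "AE L in ?M. L \<in> probe -` (probe ` PiE UNIV S) \<inter> space ?M"
    using AE_space by eventually_elim auto
  then have "emeasure ?M (probe -` (probe ` PiE UNIV S) \<inter> space ?M) = 1"
    by (intro prob_space.emeasure_eq_1_AE[OF prob_space_coeff] measurable_sets[OF measurable_probe Km])
  then have "emeasure (probe_measure :: ('m \<Rightarrow> 'f) measure) (probe ` PiE UNIV S) = 1"
    unfolding probe_measure_def using emeasure_distr[OF measurable_probe Km] by simp
  then show ?thesis using K by blast
qed

text \<open>A finite family \<open>\<Y>\<close> lets one probe measure treat both assertions of the
  theorem at the same time.\<close>

lemma prevalent_good:
  fixes S :: "('m \<Rightarrow> 'f::euclidean_space) set"
  assumes fin: "finite \<Y>"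
    and ae: "\<And>Y (v :: 'm \<Rightarrow> 'f) x. Y \<in> \<Y> \<Longrightarrow> v \<in> Cr_functions r E A \<Longrightarrow> AE L in coeff_measure n. good_at Y (perturbed v L) x"
    and S: "S \<subseteq> Cr_functions r E A"
      "\<And>\<phi>. \<phi> \<in> Cr_functions r E A \<Longrightarrow> (\<And>Y. Y \<in> \<Y> \<Longrightarrow> AE x in \<mu>. good_at Y \<phi> x) \<Longrightarrow> \<phi> \<in> S"
  shows "prevalent (Cr_topology r E A) S"
proof -
  let ?T = "Cr_topology r E A :: ('m \<Rightarrow> 'f) topology"
  let ?F = "Cr_functions r E A :: ('m \<Rightarrow> 'f) set"
  let ?B = "{\<phi> \<in> ?F. \<forall>Y\<in>\<Y>. AE x in \<mu>. good_at Y \<phi> x}"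
  have borel: "{e \<in> ?F. \<forall>Y\<in>\<Y>. AE x in \<mu>. good_at Y (\<lambda>x. v x + e x) x} \<in> sets (borel_of_top ?T)" if v: "v \<in> ?F" for v
  proof -
    have "{e \<in> space (borel_of_top ?T). \<forall>Y\<in>\<Y>. AE x in \<mu>. good_at Y (\<lambda>x. v x + e x) x} \<in> sets (borel_of_top ?T)"
      using fin good_borel[OF v] by (intro sets.sets_Collect_finite_All) (auto simp: space_borel_of_top topspace_Cr_topology)
    then show ?thesis by (simp add: space_borel_of_top topspace_Cr_topology)
  qed
  have zero: "(\<lambda>_. 0) \<in> ?F" by (rule Cr_functionsI) (intro Cr_on_const[OF E chart(2)])
  have "prevalent_borel ?T ?B"
    unfolding prevalent_borel_def
  proof (intro conjI exI[of _ probe_measure] ballI)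
    show "?B \<in> borel_sets_of ?T" using borel[OF zero] by (simp add: sets_borel_of_top)
    show "space probe_measure = topspace ?T" "sets probe_measure = borel_sets_of ?T"
      by (simp_all add: probe_measure_def space_borel_of_top sets_borel_of_top)
    show "\<exists>K. compactin ?T K \<and> 0 < emeasure probe_measure K \<and> emeasure probe_measure K < \<infinity>"
      using probe_measure_compact by force
    fix v assume "v \<in> topspace ?T"
    then have v: "v \<in> ?F" by (simp add: topspace_Cr_topology)
    have eq: "v + e \<in> ?B \<longleftrightarrow> (\<forall>Y\<in>\<Y>. AE x in \<mu>. good_at Y (\<lambda>x. v x + e x) x)" if "e \<in> ?F" for e
      using Cr_functions_add[OF v that] by (simp add: plus_fun_def)
    have m: "{e \<in> space (borel_of_top ?T). v + e \<in> ?B} \<in> sets (borel_of_top ?T)"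
    proof -
      have "{e \<in> space (borel_of_top ?T). v + e \<in> ?B} = {e \<in> ?F. \<forall>Y\<in>\<Y>. AE x in \<mu>. good_at Y (\<lambda>x. v x + e x) x}"
        using eq by (auto simp only: space_borel_of_top topspace_Cr_topology)
      then show ?thesis using borel[OF v] by simp
    qed
    have "AE L in coeff_measure n. \<forall>Y\<in>\<Y>. AE x in \<mu>. good_at Y (perturbed v L) x"
      by (rule AE_finite_allI[OF fin]) (rule AE_commute_good[OF v ae[OF _ v]])
    then have "AE L in coeff_measure n. v + probe L \<in> ?B"
      using eq[OF probe_Cr] by simp
    then show "AE e in probe_measure. v + e \<in> ?B"
      unfolding probe_measure_def by (subst AE_distr_iff[OF measurable_probe m])
  qed
  moreover have "?B \<subseteq> S" using S(2) by blast
  ultimately show ?thesis using S(1) by (auto simp: prevalent_def topspace_Cr_topology)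
qed

end

end

section \<open>Local embeddings\<close>

lemma Cr_map_std_iff:
  fixes f :: "'a::euclidean_space \<Rightarrow> 'b::euclidean_space"
  shows "Cr_map r UNIV std_atlas UNIV std_atlas S f \<longleftrightarrow> Cr_on r UNIV S f"
proof -
  have "inv_into UNIV (\<lambda>x::'a. x) = (\<lambda>x. x)" by (rule inv_unique_comp) (auto simp: o_def)
  then show ?thesis by (auto simp: Cr_map_def std_atlas_def o_def intro: Cr_on_continuous_on)
qed

lemma Cr_on_restrict_subspace:
  assumes "Cr_on r UNIV S f" "open S" "subspace L" "openin (top_of_set L) T" "T \<subseteq> S"
  shows "Cr_on r L T f"
  by (rule Cr_on_compose[OF assms(3,4), of UNIV S "\<lambda>x. x" r f])
    (use assms in \<open>auto intro: Cr_on_linear bounded_linear_ident\<close>)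

context cr_embedded
begin

text \<open>Near \<open>x\<close> the coordinate distance is at most a multiple of
  \<open>dd\<close>, which is at most a multiple of \<open>norm (\<phi> x - \<phi> y)\<close>.
  Difference quotients along \<open>w\<close> therefore bound the derivative below by a multiple of
  \<open>norm w\<close>.\<close>

lemma good_at_derivative_injective:
  fixes \<phi> :: "'m \<Rightarrow> 'f::euclidean_space"
  assumes \<phi>: "\<phi> \<in> Cr_functions r E A" and gx: "good_at UNIV \<phi> x"
    and j: "((U, c), p, R) \<in> J" "x \<in> chart_ball ((U, c), p, R)"
    and w: "w \<in> E" "frechet_derivative (\<lambda>y. \<phi> (inv_into U c y)) (at (c x) within c ` U) w = 0"
  shows "w = 0"
proof -
  have U: "(U, c) \<in> A" using good[OF j(1)] by (auto simp: good_ball_def)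
  have xU: "x \<in> U" using j(2) by (auto simp: chart_ball_def)
  have bU: "chart_ball ((U, c), p, R) \<subseteq> U" by (auto simp: chart_ball_def)
  obtain C where C: "C \<ge> 0" "\<And>x y. x \<in> chart_cball ((U, c), p, R) \<Longrightarrow> y \<in> chart_cball ((U, c), p, R) \<Longrightarrow>
    norm (c x - c y) \<le> C * dd x y" using dd_lower[OF j(1)] by blast
  obtain C' where C': "C' \<ge> 0" "\<And>y. dd x y \<le> C' * norm (\<phi> x - \<phi> y)" using gx unfolding good_at_def by blast
  have op: "openin (top_of_set E) (c ` chart_ball ((U, c), p, R))"
    using openin_chart_image[OF U open_chart_ball[OF U] bU] .
  obtain d where d: "d > 0" "\<And>t. \<bar>t\<bar> < d \<Longrightarrow> c x + t *\<^sub>R w \<in> c ` chart_ball ((U, c), p, R)"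
    using openin_subspace_line[OF E op _ w(1), of "c x"] j(2) by blast
  have "((\<lambda>t. \<phi> (inv_into U c (c x + t *\<^sub>R w))) has_vector_derivative 0) (at 0)"
    using has_derivative_along_line[OF E chart(2)[OF U] _ w(1) Cr_on_has_derivative[OF Cr_functions_chart[OF \<phi> U] r1]] xU w(2)
    by fastforce
  then have "norm w / (C * C' + 1) \<le> norm (0 :: 'f)"
  proof (rule vector_derivative_norm_ge[OF _ d(1)])
    fix t :: real assume "\<bar>t\<bar> < d"
    then obtain z where z: "z \<in> chart_ball ((U, c), p, R)" "c x + t *\<^sub>R w = c z" using d(2) by blast
    have zU: "inv_into U c (c z) = z" "inv_into U c (c x) = x" using chart_inv(4)[OF U] z(1) bU xU by auto
    have "c z - c x = t *\<^sub>R w" using z(2) by (simp add: algebra_simps)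
    then have "\<bar>t\<bar> * norm w = norm (c x - c z)" by (metis norm_minus_commute norm_scaleR)
    also have "\<dots> \<le> C * dd x z"
      using C(2)[OF subsetD[OF chart_ball_subset j(2)] subsetD[OF chart_ball_subset z(1)]] .
    also have "\<dots> \<le> C * (C' * norm (\<phi> x - \<phi> z))" using C'(2) C(1) by (rule mult_left_mono)
    also have "\<dots> \<le> (C * C' + 1) * norm (\<phi> x - \<phi> z)" by (simp add: algebra_simps)
    finally have "\<bar>t\<bar> * norm w \<le> (C * C' + 1) * norm (\<phi> z - \<phi> x)" by (simp add: norm_minus_commute)
    moreover have "C * C' + 1 > 0" using C(1) C'(1) by (simp add: add_nonneg_pos)
    ultimately show "norm w / (C * C' + 1) * \<bar>t\<bar> \<le>
        norm (\<phi> (inv_into U c (c x + t *\<^sub>R w)) - \<phi> (inv_into U c (c x + 0 *\<^sub>R w)))"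
      using z(2) zU by (simp add: field_simps)
  qed
  moreover have "C * C' + 1 > 0" using C(1) C'(1) by (simp add: add_nonneg_pos)
  ultimately show ?thesis by (simp add: field_simps)
qed

text \<open>With \<open>T\<close> the injective derivative of \<open>\<phi>\<close> at \<open>x\<close> in a chart and \<open>Ti\<close> a left inverse of it, the map
  \<open>G y = \<phi> (p + Ti y) + (y - T (Ti y))\<close> has derivative \<open>id\<close> at \<open>0\<close> and extends the local
  parametrization of the image from \<open>L = T ` E\<close> to the ambient space; its inverse is a slice chart.\<close>

lemma good_at_imp_local_embedding:
  fixes \<phi> :: "'m \<Rightarrow> real ^ 'k"
  assumes \<phi>: "\<phi> \<in> Cr_functions r E A" and gx: "good_at UNIV \<phi> x"
  shows "\<exists>U V L. open U \<and> x \<in> U \<and> open V \<and> \<phi> x \<in> V \<and>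
          dim L = dim E \<and> embedded_submanifold r L (V \<inter> range \<phi>) \<and>
          Cr_diffeo r E A L (slice_atlas r L (V \<inter> range \<phi>)) U (V \<inter> range \<phi>) \<phi>"
proof -
  have UU: "subspace (UNIV :: (real ^ 'k) set)" "\<And>S :: (real ^ 'k) set. open S \<Longrightarrow> openin (top_of_set UNIV) S"
    by auto
  obtain U0 c p R where j: "((U0, c), p, R) \<in> J" "(U0, c) \<in> A" "x \<in> chart_ball ((U0, c), p, R)" "x \<in> U0"
    "x \<in> chart_cball ((U0, c), p, R)" by (rule chart_at)
  note ch = chart_inv[OF j(2)]
  let ?S = "c ` U0" and ?ci = "inv_into U0 c"
  let ?h = "\<lambda>y. \<phi> (?ci y)"
  have S: "openin (top_of_set E) ?S" using chart(2)[OF j(2)] .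
  have h: "Cr_on r E ?S ?h" using Cr_functions_chart[OF \<phi> j(2)] .
  define q where "q = c x"
  have qS: "q \<in> ?S" and qE: "q \<in> E" using j(4) ch(5) by (auto simp: q_def)
  define T where "T = frechet_derivative ?h (at q within ?S)"
  have derT: "(?h has_derivative T) (at q within ?S)"
    unfolding T_def using Cr_on_has_derivative[OF h r1 qS] .
  have linT: "linear T" and blT: "bounded_linear T"
    using derT has_derivative_linear has_derivative_bounded_linear by blast+
  have T0: "w = 0" if "w \<in> E" "T w = 0" for w
    using good_at_derivative_injective[OF \<phi> gx j(1,3) that(1)] that(2) by (simp add: T_def q_def)
  have injT: "inj_on T E"
  proof (rule inj_onI)
    fix a b assume ab: "a \<in> E" "b \<in> E" "T a = T b"
    then have "T (a - b) = 0" by (simp add: linear_diff[OF linT])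
    then show "a = b" using T0[of "a - b"] ab E by (simp add: subspace_diff)
  qed
  have sE: "span E = E" using E by (simp add: span_eq_iff)
  \<comment> \<open>Range in \<open>E\<close> keeps \<open>q + Ti y\<close> inside \<open>E\<close>,
    where \<open>?S\<close> is relatively open; this makes \<open>\<Omega>\<close> open in the
    ambient space.\<close>
  obtain Ti where Ti: "range Ti \<subseteq> E" "linear Ti" "\<And>w. w \<in> E \<Longrightarrow> Ti (T w) = w"
    using linear_inj_on_left_inverse[OF linT, of E] injT sE by auto
  have blTi: "bounded_linear Ti" using Ti(2) by (simp add: linear_conv_bounded_linear)
  have TiE: "Ti y \<in> E" for y using Ti(1) by blast
  define L where "L = T ` E"
  have L: "subspace L" using linear_subspace_image[OF linT E] by (simp add: L_def)
  have dimL: "dim L = dim E" unfolding L_def using dim_image_eq[OF linT, of E] injT sE by simp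
  define \<Omega> where "\<Omega> = {y. q + Ti y \<in> ?S}"
  have contTi: "continuous_on A' (\<lambda>y. q + Ti y)" for A'
    using blTi by (intro continuous_intros linear_continuous_on)
  have "openin (top_of_set UNIV) (UNIV \<inter> (\<lambda>y. q + Ti y) -` ?S)"
    by (rule continuous_openin_preimage[OF contTi _ S]) (use TiE qE E in \<open>auto intro: subspace_add\<close>)
  then have op\<Omega>: "open \<Omega>" by (simp add: \<Omega>_def vimage_def)
  note \<Omega>' = UU(2)[OF op\<Omega>]
  define G where "G y = ?h (q + Ti y) + (y + - T (Ti y))" for y
  have aff: "Cr_on r UNIV W (\<lambda>y. q + Ti y)" if "open W" for W
    by (intro Cr_on_add[OF UU(1) UU(2)[OF that]] Cr_on_const[OF UU(1) UU(2)[OF that]]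
        Cr_on_linear[OF UU(1) UU(2)[OF that] blTi])
  have blTT: "bounded_linear (\<lambda>y. y + - T (Ti y))"
    using bounded_linear_compose[OF blT blTi] by (intro bounded_linear_add bounded_linear_minus bounded_linear_ident)
  have G: "Cr_on r UNIV \<Omega> G"
    unfolding G_def
    by (intro Cr_on_add[OF UU(1) \<Omega>'] Cr_on_compose[OF UU(1) \<Omega>' E S _ aff[OF op\<Omega>] h] Cr_on_linear[OF UU(1) \<Omega>' blTT])
      (auto simp: \<Omega>_def)
  have Ti0: "Ti 0 = 0" and TT0: "T 0 = 0" using Ti(2) linT by (auto simp: linear_0)
  have z\<Omega>: "0 \<in> \<Omega>" using qS by (simp add: \<Omega>_def Ti0)
  have "(G has_derivative (\<lambda>y. T (Ti y) + (y + - T (Ti y)))) (at 0 within \<Omega>)"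
    unfolding G_def
  proof (rule has_derivative_add)
    have "((\<lambda>y. q + Ti y) has_derivative Ti) (at 0 within \<Omega>)"
      using has_derivative_add[OF has_derivative_const bounded_linear_imp_has_derivative[OF blTi]] by simp
    moreover have "(?h has_derivative T) (at (q + Ti 0) within (\<lambda>y. q + Ti y) ` \<Omega>)"
      by (rule has_derivative_subset[of _ _ _ ?S]) (use derT in \<open>auto simp: Ti0 \<Omega>_def\<close>)
    ultimately show "((\<lambda>y. ?h (q + Ti y)) has_derivative (\<lambda>y. T (Ti y))) (at 0 within \<Omega>)"
      using diff_chain_within by (fastforce simp: o_def)
    show "((\<lambda>y. y + - T (Ti y)) has_derivative (\<lambda>y. y + - T (Ti y))) (at 0 within \<Omega>)"
      by (rule bounded_linear_imp_has_derivative[OF blTT])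
  qed
  then have "(G has_derivative (\<lambda>y. y)) (at 0)"
    using at_within_open[OF z\<Omega> op\<Omega>] by simp
  then have "frechet_derivative G (at 0) = (\<lambda>y. y)" by (rule frechet_derivative_at[symmetric])
  then have "inj (frechet_derivative G (at 0))" by (simp add: inj_def)
  then obtain U' V' g where g: "open U'" "U' \<subseteq> \<Omega>" "0 \<in> U'" "open V'" "G 0 \<in> V'" "homeomorphism U' V' G g"
    "Cr_on r UNIV V' g"
    by (rule Cr_inverse_function[OF op\<Omega> G r1 z\<Omega>])
  have gG: "z \<in> U' \<Longrightarrow> g (G z) = z" and Gg: "y \<in> V' \<Longrightarrow> G (g y) = y" and gV: "y \<in> V' \<Longrightarrow> g y \<in> U'"
    and GU: "z \<in> U' \<Longrightarrow> G z \<in> V'" for y z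
    using g(6) by (auto simp: homeomorphism_def)
  have GT: "G (T w) = ?h (q + w)" if "w \<in> E" for w using Ti(3)[OF that] by (simp add: G_def)
  define O1 where "O1 = U0 \<inter> (\<lambda>y. T (c y - q)) -` U'"
  have opO: "open O1" unfolding O1_def
    by (intro continuous_open_preimage chart(1)[OF j(2)] g(1)
        continuous_on_compose2[OF linear_continuous_on[OF blT, of UNIV]] continuous_intros ch(2)) auto
  have xO: "x \<in> O1" using j(4) g(3) by (simp add: O1_def q_def TT0)
  have yE: "c y - q \<in> E" if "y \<in> U0" for y using ch(5)[OF that] qE E by (simp add: subspace_diff)
  have \<phi>G: "\<phi> y = G (T (c y - q))" if "y \<in> U0" for y
    using GT[OF yE[OF that]] ch(4)[OF that] by simp
  obtain C' where C': "\<And>y. dd x y \<le> C' * norm (\<phi> x - \<phi> y)" using gx unfolding good_at_def by blast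
  have inj_x: "y = x" if "\<phi> y = \<phi> x" for y
    using C'[of y] that dd_nonneg[of x y] dd_eq_0[of x y] by fastforce
  have cont: "continuous_on S' \<phi>" for S' using \<phi> by (rule Cr_functions_continuous)
  have "compact (UNIV \<inter> (- O1))" using compact_UNIV opO by (intro compact_Int_closed) auto
  then have "compact (\<phi> ` (- O1))" using compact_continuous_image[OF cont] by simp
  then have clO: "closed (\<phi> ` (- O1))" by (rule compact_imp_closed)
  \<comment> \<open>Removing the image of the complement of \<open>O1\<close> forces every preimage
    of a point of \<open>V\<close> into \<open>O1\<close>, so the image of \<open>\<phi>\<close> has
    a single sheet in \<open>V\<close>. The point \<open>\<phi> x\<close> survives because its fibre
    is \<open>{x}\<close>.\<close>
  define V where "V = V' - \<phi> ` (- O1)"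
  have V: "open V" unfolding V_def using g(4) clO by (rule open_Diff)
  have VV': "V \<subseteq> V'" by (auto simp: V_def)
  have "\<phi> x \<notin> \<phi> ` (- O1)" using xO inj_x by (metis ComplD imageE)
  moreover have "\<phi> x = G 0" using \<phi>G[OF j(4)] by (simp add: q_def TT0)
  ultimately have xV: "\<phi> x \<in> V" using g(5) unfolding V_def by simp
  define U where "U = \<phi> -` V"
  have UO: "U \<subseteq> O1" by (auto simp: U_def V_def)
  have opU: "open U" unfolding U_def using cont[of UNIV] V by (simp add: open_vimage)
  have xU: "x \<in> U" using xV by (simp add: U_def)
  define N where "N = V \<inter> range \<phi>"
  have N: "N = \<phi> ` U" by (auto simp: N_def U_def)
  have NV: "N \<subseteq> V" by (auto simp: N_def)
  define ret where "ret y = ?ci (q + Ti (g y))" for y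
  have UO0: "y \<in> U0" "T (c y - q) \<in> U'" if "y \<in> U" for y
    using subsetD[OF UO that] by (auto simp: O1_def)
  have g\<phi>: "g (\<phi> y) = T (c y - q)" if "y \<in> U" for y
    using \<phi>G[OF UO0(1)[OF that]] gG[OF UO0(2)[OF that]] by simp
  have coord: "q + Ti (g (\<phi> y)) = c y" if "y \<in> U" for y
    using g\<phi>[OF that] Ti(3)[OF yE[OF UO0(1)[OF that]]] by simp
  have ret\<phi>: "ret (\<phi> y) = y" if "y \<in> U" for y
    using coord[OF that] ch(4)[OF UO0(1)[OF that]] by (simp add: ret_def)
  have inj\<phi>: "inj_on \<phi> U" using ret\<phi> by (metis inj_on_inverseI)
  have inv\<phi>: "inv_into U \<phi> y = ret y" if "y \<in> N" for y
    using that inj\<phi> ret\<phi> by (auto simp: N)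
  have gVimg: "g ` V = U' \<inter> G -` V"
    using gV Gg gG VV' by (force simp: image_iff)
  have opgV: "open (g ` V)"
    unfolding gVimg using g(1,6) V by (intro continuous_open_preimage) (auto simp: homeomorphism_def)
  have injg: "inj_on g V" using Gg VV' by (metis inj_on_inverseI subsetD)
  have slice: "slice_chart r L N V g"
    unfolding slice_chart_def
  proof (intro conjI V opgV)
    show "Cr_diffeo r UNIV std_atlas UNIV std_atlas V (g ` V) g"
      unfolding Cr_diffeo_def Cr_map_std_iff
    proof (intro conjI)
      show "bij_betw g V (g ` V)" using injg by (simp add: bij_betw_def)
      show "Cr_on r UNIV V g" using Cr_on_subset[OF UU(1) UU(2)[OF g(4)] UU(2)[OF V] VV' g(7)] .
      have "Cr_on r UNIV (g ` V) G"
        by (rule Cr_on_subset[OF UU(1) \<Omega>' UU(2)[OF opgV] _ G]) (use gVimg g(2) in blast)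
      then show "Cr_on r UNIV (g ` V) (inv_into V g)"
        by (rule Cr_on_cong[OF UU(1) UU(2)[OF opgV]]) (use injg Gg VV' in auto)
    qed
    show "g ` (V \<inter> N) = g ` V \<inter> L"
    proof (intro equalityI subsetI)
      fix z assume "z \<in> g ` (V \<inter> N)"
      then obtain y where y: "y \<in> U" "z = g (\<phi> y)" by (auto simp: N)
      then have "z = T (c y - q)" using g\<phi> by simp
      moreover have "y \<in> U0" using y(1) UO by (auto simp: O1_def)
      ultimately have "z \<in> L" using yE by (auto simp: L_def)
      then show "z \<in> g ` V \<inter> L" using y by (auto simp: U_def)
    next
      \<comment> \<open>On \<open>L\<close> the correction term of \<open>G\<close> vanishes, so
        \<open>G\<close> sends \<open>z = T w\<close> to the value of \<open>\<phi>\<close> at the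
        point with coordinates \<open>q + w\<close>.\<close>
      fix z assume z: "z \<in> g ` V \<inter> L"
      then obtain y w where y: "y \<in> V" "z = g y" and w: "w \<in> E" "z = T w" by (auto simp: L_def)
      have "z \<in> \<Omega>" using gV y VV' g(2) by blast
      then have "q + w \<in> ?S" using w Ti(3) by (simp add: \<Omega>_def)
      then have "\<phi> (?ci (q + w)) = G z" using GT[OF w(1)] w(2) by simp
      also have "G z = y" using Gg y VV' by auto
      finally have "y \<in> N" using y(1) unfolding N_def by (metis IntI rangeI)
      then show "z \<in> g ` (V \<inter> N)" using y by blast
    qed
  qed
  have emb: "embedded_submanifold r L N"
    unfolding embedded_submanifold_def using L slice NV by blast
  have diffeo: "Cr_diffeo r E A L (slice_atlas r L N) U N \<phi>"
    unfolding Cr_diffeo_def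
  proof (intro conjI)
    show "bij_betw \<phi> U N" using inj\<phi> N by (simp add: bij_betw_def)
    \<comment> \<open>\<open>slice_atlas\<close> consists of all slice charts of \<open>N\<close>,
      so regularity has to be checked in an arbitrary one; \<open>g\<close> is used to express the
      inverse of \<open>\<phi>\<close>.\<close>
    have sl: "\<exists>W. P = W \<inter> N \<and> slice_chart r L N W \<psi>" if "(P, \<psi>) \<in> slice_atlas r L N" for P \<psi>
      using that by (auto simp: slice_atlas_def)
    have slD: "open W" "open (\<psi> ` W)" "inj_on \<psi> W" "Cr_on r UNIV W \<psi>" "Cr_on r UNIV (\<psi> ` W) (inv_into W \<psi>)"
      "\<psi> ` (W \<inter> N) = \<psi> ` W \<inter> L" if "slice_chart r L N W \<psi>" for W \<psi>
      using that unfolding slice_chart_def Cr_diffeo_def Cr_map_std_iff bij_betw_def by auto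
    show "Cr_map r E A L (slice_atlas r L N) U \<phi>"
      unfolding Cr_map_def
    proof (intro conjI cont ballI, clarify)
      fix U1 c1 P \<psi> assume U1: "(U1, c1) \<in> A" and P: "(P, \<psi>) \<in> slice_atlas r L N"
      obtain W where W: "P = W \<inter> N" "slice_chart r L N W \<psi>" using sl[OF P] by blast
      note s = slD[OF W(2)]
      have D: "U \<inter> U1 \<inter> \<phi> -` P = U \<inter> U1 \<inter> \<phi> -` W" using N W(1) by auto
      have "open (\<phi> -` W)" using cont[of UNIV] s(1) by (simp add: open_vimage)
      then have op: "openin (top_of_set E) (c1 ` (U \<inter> U1 \<inter> \<phi> -` W))"
        using opU chart(1)[OF U1] by (intro openin_chart_image[OF U1]) auto
      have "Cr_on r E (c1 ` (U \<inter> U1 \<inter> \<phi> -` W)) (\<lambda>y. \<psi> (\<phi> (inv_into U1 c1 y)))"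
      proof (rule Cr_on_compose[OF E op UU(1) UU(2)[OF s(1)] _ _ s(4)])
        show "(\<lambda>y. \<phi> (inv_into U1 c1 y)) ` c1 ` (U \<inter> U1 \<inter> \<phi> -` W) \<subseteq> W"
          using chart_inv(4)[OF U1] by auto
        show "Cr_on r E (c1 ` (U \<inter> U1 \<inter> \<phi> -` W)) (\<lambda>y. \<phi> (inv_into U1 c1 y))"
          by (rule Cr_on_subset[OF E chart(2)[OF U1] op _ Cr_functions_chart[OF \<phi> U1]]) auto
      qed
      then show "Cr_on r E (c1 ` (U \<inter> U1 \<inter> \<phi> -` P)) (\<psi> \<circ> \<phi> \<circ> inv_into U1 c1)"
        unfolding D by (simp add: o_def)
    qed
    have contret: "continuous_on N (inv_into U \<phi>)"
    proof (rule continuous_on_eq)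
      have "continuous_on N g"
        using g(6) NV VV' by (auto simp: homeomorphism_def intro: continuous_on_subset)
      then have "continuous_on N (\<lambda>y. q + Ti (g y))"
        by (rule continuous_on_compose2[OF contTi[of UNIV]]) auto
      then show "continuous_on N ret"
        unfolding ret_def
      proof (rule continuous_on_compose2[OF ch(3)])
        show "(\<lambda>y. q + Ti (g y)) ` N \<subseteq> c ` U0"
        proof clarify
          fix y assume "y \<in> N"
          then obtain z where "z \<in> U" "y = \<phi> z" by (auto simp: N)
          then show "q + Ti (g y) \<in> c ` U0" using coord UO by (auto simp: O1_def)
        qed
      qed
    qed (simp add: inv\<phi>)
    show "Cr_map r L (slice_atlas r L N) E A N (inv_into U \<phi>)"
      unfolding Cr_map_def
    proof (intro conjI contret ballI, clarify)
      fix P \<psi> U1 c1 assume U1: "(U1, c1) \<in> A" and P: "(P, \<psi>) \<in> slice_atlas r L N"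
      obtain W where W: "P = W \<inter> N" "slice_chart r L N W \<psi>" using sl[OF P] by blast
      note s = slD[OF W(2)]
      let ?\<theta> = "inv_into W \<psi>"
      define Z where "Z = \<psi> ` W \<inter> L"
      have Zo: "openin (top_of_set L) Z" unfolding Z_def using s(2) by (auto simp: openin_open)
      have \<theta>: "?\<theta> z \<in> W \<inter> N" "\<psi> (?\<theta> z) = z" if z: "z \<in> Z" for z
      proof -
        have "z \<in> \<psi> ` (W \<inter> N)" using z s(6) unfolding Z_def by simp
        then obtain y where "y \<in> W \<inter> N" "z = \<psi> y" by blast
        then show "?\<theta> z \<in> W \<inter> N" "\<psi> (?\<theta> z) = z" using s(3) by auto
      qed
      have \<theta>c: "continuous_on Z ?\<theta>"
        using Cr_on_continuous_on[OF s(5)] by (rule continuous_on_subset) (simp add: Z_def)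
      have "continuous_on Z (\<lambda>z. inv_into U \<phi> (?\<theta> z))"
        using \<theta> by (intro continuous_on_compose2[OF contret \<theta>c]) auto
      then have "openin (top_of_set Z) (Z \<inter> (\<lambda>z. inv_into U \<phi> (?\<theta> z)) -` U1)"
        using chart(1)[OF U1] by (rule continuous_openin_preimage_gen)
      then have op: "openin (top_of_set L) (Z \<inter> (\<lambda>z. inv_into U \<phi> (?\<theta> z)) -` U1)"
        using Zo by (rule openin_trans)
      have D: "\<psi> ` (N \<inter> P \<inter> inv_into U \<phi> -` U1) = Z \<inter> (\<lambda>z. inv_into U \<phi> (?\<theta> z)) -` U1" (is "_ = ?D")
      proof (intro equalityI subsetI)
        fix z assume "z \<in> \<psi> ` (N \<inter> P \<inter> inv_into U \<phi> -` U1)"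
        then obtain y where y: "y \<in> W \<inter> N" "z = \<psi> y" "inv_into U \<phi> y \<in> U1" using W(1) by auto
        then have "z \<in> Z" using s(6) unfolding Z_def by blast
        moreover have "?\<theta> z = y" using y s(3) by simp
        ultimately show "z \<in> ?D" using y(3) by simp
      next
        fix z assume z: "z \<in> ?D"
        then have "?\<theta> z \<in> N \<inter> P \<inter> inv_into U \<phi> -` U1" using \<theta>(1)[of z] W(1) by auto
        then show "z \<in> \<psi> ` (N \<inter> P \<inter> inv_into U \<phi> -` U1)" using \<theta>(2)[of z] z by (metis IntD1 image_eqI)
      qed
      have DZ: "?D \<subseteq> Z" by blast
      have val: "q + Ti (g (?\<theta> z)) \<in> c ` (U0 \<inter> U1) \<and> ?ci (q + Ti (g (?\<theta> z))) = inv_into U \<phi> (?\<theta> z)" if z: "z \<in> ?D" for z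
      proof -
        have tN: "?\<theta> z \<in> N" using \<theta> z by blast
        then obtain y where y: "y \<in> U" "?\<theta> z = \<phi> y" by (auto simp: N)
        have "inv_into U \<phi> (?\<theta> z) = y" using inv\<phi>[OF tN] y ret\<phi> by simp
        moreover have "y \<in> U0" using y(1) UO by (auto simp: O1_def)
        ultimately show ?thesis using z coord[OF y(1)] y(2) ch(4) by auto
      qed
      \<comment> \<open>In coordinates the inverse of \<open>\<phi>\<close> is composed of the
        inverse slice chart, the ambient map \<open>g\<close>, the affine map into \<open>E\<close>,
        and a chart transition.\<close>
      have 1: "Cr_on r L ?D ?\<theta>"
        by (rule Cr_on_restrict_subspace[OF s(5,2) L op]) (auto simp: Z_def)
      have 2: "Cr_on r L ?D (\<lambda>z. g (?\<theta> z))"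
        by (rule Cr_on_compose[OF L op UU(1) UU(2)[OF g(4)] _ 1 g(7)]) (use \<theta> NV VV' in blast)
      have 3: "Cr_on r L ?D (\<lambda>z. q + Ti (g (?\<theta> z)))"
        by (rule Cr_on_compose[OF L op UU(1) UU(2)[OF open_UNIV] _ 2 aff[OF open_UNIV]]) auto
      have op': "openin (top_of_set E) (c ` (U0 \<inter> U1))"
        using chart(1)[OF j(2)] chart(1)[OF U1] by (intro openin_chart_image[OF j(2)]) auto
      have "Cr_on r L ?D (\<lambda>z. c1 (?ci (q + Ti (g (?\<theta> z)))))"
        by (rule Cr_on_compose[OF L op E op' _ 3 Cr_transition[OF j(2) U1]]) (use val in blast)
      then have "Cr_on r L ?D (c1 \<circ> inv_into U \<phi> \<circ> inv_into P \<psi>)"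
      proof (rule Cr_on_cong[OF L op])
        fix z assume z: "z \<in> ?D"
        have "inv_into P \<psi> z = ?\<theta> z"
        proof (rule inv_into_f_eq)
          show "inj_on \<psi> P" using s(3) W(1) by (auto intro: inj_on_subset)
          show "?\<theta> z \<in> P" "\<psi> (?\<theta> z) = z" using \<theta>[of z] z W(1) by auto
        qed
        then show "c1 (?ci (q + Ti (g (?\<theta> z)))) = (c1 \<circ> inv_into U \<phi> \<circ> inv_into P \<psi>) z"
          using val[OF z] by simp
      qed
      then show "Cr_on r L (\<psi> ` (N \<inter> P \<inter> inv_into U \<phi> -` U1)) (c1 \<circ> inv_into U \<phi> \<circ> inv_into P \<psi>)"
        unfolding D .
    qed
  qed
  show ?thesis
    using opU xU V xV dimL emb diffeo unfolding N_def by (intro exI[of _ U] exI[of _ V] exI[of _ L] conjI)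
qed

end

theorem theorem1p2:
  fixes r :: enat
    and E :: "'e::euclidean_space set"
    and A :: "('m::t2_space, 'e) chart set"
    and g :: "('m, 'e) chart \<Rightarrow> 'm \<Rightarrow> 'e \<Rightarrow> 'e \<Rightarrow> real"
    and \<rho> :: "'m \<Rightarrow> 'm \<Rightarrow> real"
    and X :: "'m set"
    and \<mu> :: "'m measure"
  assumes "1 \<le> r"
    and "Cr_atlas r E A"
    and "compact (UNIV :: 'm set)"
    and "riemannian_metric E A g"
    and "induced_distance A g \<rho>"
    and "compact X"
    and "prob_space \<mu>"
    and "sets \<mu> = sets (restrict_space borel X)"
  shows "prevalent (Cr_topology r E A)
    {\<phi> \<in> Cr_functions r E A :: ('m \<Rightarrow> real ^ 'k) set.
      (hausdorff_dim \<rho> X < of_nat CARD('k) \<and> dim E \<le> CARD('k) \<longrightarrow>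
        (AE x in \<mu>. \<exists>C\<ge>0. \<forall>y\<in>X. \<rho> x y \<le> C * norm (\<phi> x - \<phi> y))) \<and>
      (dim E < CARD('k) \<longrightarrow>
        (AE x in \<mu>. \<exists>U V L. open U \<and> x \<in> U \<and> open V \<and> \<phi> x \<in> V \<and>
          dim L = dim E \<and> embedded_submanifold r L (V \<inter> range \<phi>) \<and>
          Cr_diffeo r E A L (slice_atlas r L (V \<inter> range \<phi>)) U (V \<inter> range \<phi>) \<phi>))}"
proof -
  interpret cr_manifold r E A
    using assms(1-3) by unfold_locales
  obtain J where J: "finite J" "\<And>j. j \<in> J \<Longrightarrow> good_ball j" "(\<Union>j\<in>J. chart_ball j) = UNIV"
    using good_ball_cover by blast
  obtain n and f :: "nat \<Rightarrow> 'm \<Rightarrow> real" where f: "\<And>i. i < n \<Longrightarrow> f i \<in> Cr_functions r E A"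
    "\<And>x y. (\<And>i. i < n \<Longrightarrow> f i x = f i y) \<Longrightarrow> x = y"
    "\<And>U c p R. ((U, c), p, R) \<in> J \<Longrightarrow> \<exists>C\<ge>0. \<forall>x\<in>chart_cball ((U, c), p, R). \<forall>y\<in>chart_cball ((U, c), p, R).
       norm (c x - c y) \<le> C * (\<Sum>i<n. \<bar>f i x - f i y\<bar>)"
    by (rule bump_family[OF J]) (assumption | rule that | blast)+
  interpret cr_riemannian r E A J n f g \<rho>
  proof unfold_locales
    show "x = y" if "\<And>i. i < n \<Longrightarrow> f i x = f i y" for x y using that by (rule f(2))
  qed (use assms(4,5) J f(1,3) in simp_all)
  let ?H1 = "hausdorff_dim \<rho> X < of_nat CARD('k) \<and> dim E \<le> CARD('k)" and ?H2 = "dim E < CARD('k)"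
  obtain C where C: "C \<ge> 0" "\<And>x y. \<rho> x y \<le> C * dd x y" using rho_le_dd by blast
  \<comment> \<open>An assertion whose dimension hypothesis fails holds vacuously and contributes no
    set to the family.\<close>
  define \<Y> where "\<Y> = (if ?H1 then {X} else {}) \<union> (if ?H2 then {UNIV} else {})"
  show ?thesis
  proof (rule prevalent_good[OF assms(7,8), of \<Y>])
    show "finite \<Y>" by (simp add: \<Y>_def)
  next
    fix Y and v :: "'m \<Rightarrow> real ^ 'k" and x
    assume Y: "Y \<in> \<Y>" and v: "v \<in> Cr_functions r E A"
    then consider "Y = X" ?H1 | "Y = UNIV" ?H2 by (auto simp: \<Y>_def split: if_splits)
    then show "AE L in coeff_measure n. good_at Y (perturbed v L) x"
    proof cases
      case 1
      then show ?thesis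
        unfolding good_at_def using AE_good_point[OF v _ compact_imp_closed[OF assms(6)] AE_avoids_low_dimension[OF v]]
        by simp
    next
      case 2
      then show ?thesis
        unfolding good_at_def using AE_good_point[OF v _ closed_UNIV] AE_avoids_manifold[OF v] by simp
    qed
  next
    fix \<phi> :: "'m \<Rightarrow> real ^ 'k"
    assume \<phi>: "\<phi> \<in> Cr_functions r E A" and ae: "\<And>Y. Y \<in> \<Y> \<Longrightarrow> AE x in \<mu>. good_at Y \<phi> x"
    have 1: "AE x in \<mu>. \<exists>C\<ge>0. \<forall>y\<in>X. \<rho> x y \<le> C * norm (\<phi> x - \<phi> y)" if ?H1
    proof -
      have "AE x in \<mu>. good_at X \<phi> x" using that by (intro ae) (simp add: \<Y>_def)
      then show ?thesis
      proof eventually_elim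
        case (elim x)
        then obtain C' where C': "C' \<ge> 0" "\<forall>y\<in>X. dd x y \<le> C' * norm (\<phi> x - \<phi> y)" unfolding good_at_def by blast
        have "\<rho> x y \<le> (C * C') * norm (\<phi> x - \<phi> y)" if "y \<in> X" for y
          using C(2)[of x y] mult_left_mono[OF C'(2)[rule_format, OF that] C(1)] by (simp add: mult.assoc)
        then show ?case using C(1) C'(1) by (intro exI[of _ "C * C'"]) simp
      qed
    qed
    have 2: "AE x in \<mu>. \<exists>U V L. open U \<and> x \<in> U \<and> open V \<and> \<phi> x \<in> V \<and>
          dim L = dim E \<and> embedded_submanifold r L (V \<inter> range \<phi>) \<and>
          Cr_diffeo r E A L (slice_atlas r L (V \<inter> range \<phi>)) U (V \<inter> range \<phi>) \<phi>" if ?H2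
    proof -
      have "AE x in \<mu>. good_at UNIV \<phi> x" using that by (intro ae) (simp add: \<Y>_def)
      then show ?thesis by eventually_elim (rule good_at_imp_local_embedding[OF \<phi>])
    qed
    show "\<phi> \<in> {\<phi> \<in> Cr_functions r E A.
      (?H1 \<longrightarrow> (AE x in \<mu>. \<exists>C\<ge>0. \<forall>y\<in>X. \<rho> x y \<le> C * norm (\<phi> x - \<phi> y))) \<and>
      (?H2 \<longrightarrow> (AE x in \<mu>. \<exists>U V L. open U \<and> x \<in> U \<and> open V \<and> \<phi> x \<in> V \<and>
          dim L = dim E \<and> embedded_submanifold r L (V \<inter> range \<phi>) \<and>
          Cr_diffeo r E A L (slice_atlas r L (V \<inter> range \<phi>)) U (V \<inter> range \<phi>) \<phi>))}"
      by (intro CollectI conjI \<phi> impI 1 2) simp_all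
  qed blast
qed

end
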